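(* Let $N\ge 1$, let $B\subset\mathbb{R}^N$ be a ball and let $p,q>0$. Consider the Lane-Emden system $$\Delta u+v^q=0\ \text{ in }B,\qquad \Delta v+u^p=0\ \text{ in }B,\qquad u,v>0\ \text{ in }B,\qquad u=v=0\ \text{ on }\partial B. \quad (\ast)$$ Then: (i) For every pair $u,v\in C^2(B)\cap C(\overline{B})$ solving $(\ast)$, both $u$ and $v$ are radially symmetric (about the center of $B$) and strictly decreasing (in the radial variable). (ii) If $\dfrac{N}{p+1}+\dfrac{N}{q+1}>N-2$ and $pq\ne 1$, then $(\ast)$ has a unique solution $(u,v)$ with $u,v\in C^2(B)\cap C(\overline{B})$. *)

theory Defs
  imports "HOL-Analysis.Analysis"
begin

text \<open>
  The space \<open>\<real>\<^sup>N\<close> is an arbitrary type of class \<open>euclidean_space\<close>, with \<open>N = DIM('a)\<close>; a direction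
  \<open>i \<in> Basis\<close> plays the role of a coordinate index.
\<close>

definition partial :: "'a::euclidean_space \<Rightarrow> ('a \<Rightarrow> real) \<Rightarrow> 'a \<Rightarrow> real" where
  "partial i f x = deriv (\<lambda>t. f (x + t *\<^sub>R i)) 0"

definition has_continuous_partials_on :: "('a::euclidean_space \<Rightarrow> real) \<Rightarrow> 'a set \<Rightarrow> bool"
    (infix "has'_continuous'_partials'_on" 50) where
  "f has_continuous_partials_on S \<longleftrightarrow>
    (\<forall>i\<in>Basis. (\<forall>x\<in>S. (\<lambda>t. f (x + t *\<^sub>R i)) differentiable (at 0)) \<and> continuous_on S (partial i f))"

text \<open>The class \<open>C\<^sup>2(S)\<close>; meant for open \<open>S\<close>, where the values of \<open>f\<close> outside \<open>S\<close> are irrelevant.\<close>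

definition C2_on :: "('a::euclidean_space \<Rightarrow> real) \<Rightarrow> 'a set \<Rightarrow> bool" (infix "C2'_on" 50) where
  "f C2_on S \<longleftrightarrow> continuous_on S f \<and> f has_continuous_partials_on S \<and>
    (\<forall>i\<in>Basis. partial i f has_continuous_partials_on S)"

definition laplacian :: "('a::euclidean_space \<Rightarrow> real) \<Rightarrow> 'a \<Rightarrow> real" where
  "laplacian f x = (\<Sum>i\<in>Basis. partial i (partial i f) x)"

text \<open>
  Functions on the closure of \<open>B\<close> are represented by total functions whose values outside
  the closure of \<open>B\<close> carry no information.
\<close>

definition lane_emden_solution ::
  "'a::euclidean_space set \<Rightarrow> real \<Rightarrow> real \<Rightarrow> ('a \<Rightarrow> real) \<Rightarrow> ('a \<Rightarrow> real) \<Rightarrow> bool" where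
  "lane_emden_solution B p q u v \<longleftrightarrow>
    u C2_on B \<and> continuous_on (closure B) u \<and>
    v C2_on B \<and> continuous_on (closure B) v \<and>
    (\<forall>x\<in>B. laplacian u x + v x powr q = 0) \<and>
    (\<forall>x\<in>B. laplacian v x + u x powr p = 0) \<and>
    (\<forall>x\<in>B. u x > 0 \<and> v x > 0) \<and>
    (\<forall>x\<in>frontier B. u x = 0 \<and> v x = 0)"

definition radial_strictly_decreasing :: "'a::euclidean_space \<Rightarrow> real \<Rightarrow> ('a \<Rightarrow> real) \<Rightarrow> bool" where
  "radial_strictly_decreasing c R f \<longleftrightarrow>
    (\<exists>\<phi>::real \<Rightarrow> real. (\<forall>x\<in>cball c R. f x = \<phi> (dist c x)) \<and> strict_antimono_on {0..R} \<phi>)"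

end

theory Submission
  imports Defs "HOL-Library.Landau_Symbols"
begin

text \<open>
  Symmetry follows from moving planes. If \<open>v\<^sup>\<lambda> \<ge> t v\<close> on a cap for the reflected functions, then
  \<open>-\<Delta>(u\<^sup>\<lambda> - u) \<ge> -(1 - t\<^sup>q) v\<^sup>q\<close>, and a barrier that is small relative to the distance to the sphere gives
  \<open>u\<^sup>\<lambda> \<ge> (1 - (1 - t)/2) u\<close> on a narrow region; iterating between \<open>u\<close> and \<open>v\<close> from \<open>t = 0\<close> yields
  \<open>u\<^sup>\<lambda> \<ge> u\<close>. This multiplicative form needs no Lipschitz bound on the nonlinearities, so exponents below
  one cause no difficulty. For the plane \<open>x \<bullet> e = \<lambda>\<close>, comparison with the harmonic function
  \<open>4 c \<lambda> (x \<bullet> e - \<lambda>)\<close> makes the inequality quantitatively strict, which is what lets the plane move on.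

  Solutions being radial, two of them can be rescaled to \<open>u\<^sub>1(0) = u\<^sub>2(0)\<close> because \<open>pq \<noteq> 1\<close>. If
  \<open>v\<^sub>1(0) > v\<^sub>2(0)\<close>, then \<open>v\<^sub>1 > v\<^sub>2\<close> and \<open>u\<^sub>1 \<le> u\<^sub>2\<close> as long as both exist, contradicting the boundary
  values; so the initial values agree and the solutions coincide. Existence is by shooting with
  \<open>u(0) = 1\<close>, \<open>v(0) = b\<close>: at the critical \<open>b\<close> either \<open>u\<close> and \<open>v\<close> vanish simultaneously or the solution is
  entire and positive, and the latter is excluded below the critical hyperbola by Pohozaev's identity.
\<close>

section \<open>Second-order expansions and the Laplacian\<close>

text \<open>Solutions are only continuous up to the sphere, so no normal derivative is available
  there. The Hopf lemma therefore appears as a lower bound by a multiple of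
  \<open>1 - x \<bullet> x\<close>, and every comparison in the ball goes through one weak maximum
  principle that asks only for pointwise second-order expansions. The planes have arbitrary normals
  while \<open>laplacian\<close> is tied to the basis, which is why expansions come before any
  equation. For radial profiles the missing Lipschitz bound leaves uniqueness of the initial value
  problem only as long as both components are positive, so shooting cannot rest on continuous
  dependence. Monotone dependence on the initial value takes its place; limits from above and from
  below the critical value may be different solutions beyond the first zero, and each is used on the
  side where it gives information. Subcriticality enters through the nonexistence of entire
  solutions: the slope bounds give decay of the product \<open>U V\<close>, the Pohozaev functional
  bounds the same product from below by a power \<open>2 - N\<close> of the radius, and the two
  rates are incompatible below the hyperbola.\<close>

lemma has_continuous_partials_line:
  fixes f :: "'a::euclidean_space \<Rightarrow> real"
  assumes f: "f has_continuous_partials_on S" and i: "i \<in> Basis" and x: "x + t *\<^sub>R i \<in> S"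
  shows "((\<lambda>s. f (x + s *\<^sub>R i)) has_real_derivative partial i f (x + t *\<^sub>R i)) (at t)"
proof -
  have "(\<lambda>s. f (x + t *\<^sub>R i + s *\<^sub>R i)) differentiable (at 0)"
    using f i x by (auto simp: has_continuous_partials_on_def)
  then have "((\<lambda>s. f (x + t *\<^sub>R i + s *\<^sub>R i)) has_real_derivative partial i f (x + t *\<^sub>R i)) (at 0)"
    unfolding partial_def using DERIV_deriv_iff_real_differentiable by blast
  then have "((\<lambda>s. f (x + (s + t) *\<^sub>R i)) has_real_derivative partial i f (x + t *\<^sub>R i)) (at 0)"
    by (simp add: algebra_simps scaleR_add_left)
  then show ?thesis
    using DERIV_shift[of "\<lambda>s. f (x + s *\<^sub>R i)" "partial i f (x + t *\<^sub>R i)" 0 t] by simp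
qed

text \<open>The increment is made one coordinate at a time, and the mean value inequality is applied
  on each edge, where the partial derivative differs from its value at \<open>x\<close> by less than
  \<open>e'\<close>.\<close>

lemma has_derivative_continuous_partials:
  fixes f :: "'a::euclidean_space \<Rightarrow> real"
  assumes f: "f has_continuous_partials_on S" and S: "open S" and x: "x \<in> S"
  shows "(f has_derivative (\<lambda>h. (\<Sum>i\<in>Basis. partial i f x *\<^sub>R i) \<bullet> h)) (at x)"
  unfolding has_derivative_at_alt
proof (intro conjI allI impI)
  show "bounded_linear (\<lambda>h. (\<Sum>i\<in>Basis. partial i f x *\<^sub>R i) \<bullet> h)"
    by (rule bounded_linear_inner_right)
  fix e :: real assume e: "e > 0"
  define e' where "e' = e / real DIM('a)"
  have e': "e' > 0" using e by (simp add: e'_def)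
  have "\<forall>\<^sub>F y in nhds x. y \<in> S \<and> (\<forall>i\<in>Basis. \<bar>partial i f y - partial i f x\<bar> < e')"
  proof (intro eventually_conj)
    show "\<forall>\<^sub>F y in nhds x. y \<in> S" using S x by (rule eventually_nhds_in_open)
    show "\<forall>\<^sub>F y in nhds x. \<forall>i\<in>Basis. \<bar>partial i f y - partial i f x\<bar> < e'"
    proof (intro eventually_ball_finite ballI finite_Basis)
      fix i :: 'a assume "i \<in> Basis"
      then have "continuous_on S (partial i f)" using f by (simp add: has_continuous_partials_on_def)
      then have "isCont (partial i f) x" using S x continuous_on_eq_continuous_at by blast
      then have "(partial i f \<longlongrightarrow> partial i f x) (nhds x)"
        by (simp add: isCont_def tendsto_at_iff_tendsto_nhds)
      then show "\<forall>\<^sub>F y in nhds x. \<bar>partial i f y - partial i f x\<bar> < e'"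
        using tendstoD[OF _ e'] by (force simp: dist_real_def)
    qed
  qed
  then obtain d where d: "d > 0" and dd: "\<And>y. dist y x < d \<Longrightarrow> y \<in> S \<and> (\<forall>i\<in>Basis. \<bar>partial i f y - partial i f x\<bar> < e')"
    unfolding eventually_nhds_metric by blast
  show "\<exists>d>0. \<forall>y. norm (y - x) < d \<longrightarrow>
      norm (f y - f x - (\<Sum>i\<in>Basis. partial i f x *\<^sub>R i) \<bullet> (y - x)) \<le> e * norm (y - x)"
  proof (intro exI[of _ d] conjI d allI impI)
    fix y assume y: "norm (y - x) < d"
    define h where "h = y - x"
    define P where "P B = (\<Sum>i\<in>B. (h \<bullet> i) *\<^sub>R i)" for B
    have P_inner: "P B \<bullet> b = (if b \<in> B then h \<bullet> b else 0)" if "B \<subseteq> Basis" "b \<in> Basis" for B b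
    proof -
      have fin: "finite B" using that finite_subset finite_Basis by blast
      have "P B \<bullet> b = (\<Sum>i\<in>B. if i = b then h \<bullet> i else 0)"
        unfolding P_def inner_sum_left using that by (intro sum.cong refl) (auto simp: inner_Basis)
      also have "\<dots> = (if b \<in> B then h \<bullet> b else 0)"
        using fin by (simp add: sum.delta)
      finally show ?thesis .
    qed
    have *: "\<bar>f (x + P B) - f x - (\<Sum>i\<in>B. (h \<bullet> i) * partial i f x)\<bar> \<le> e' * (\<Sum>i\<in>B. \<bar>h \<bullet> i\<bar>)"
      if "finite B" "B \<subseteq> Basis" for B
      using that
    proof (induction B rule: finite_induct)
      case empty then show ?case by (simp add: P_def)
    next
      case (insert j B)
      have j: "j \<in> Basis" and B: "B \<subseteq> Basis" using insert.prems by auto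
      define a where "a = h \<bullet> j"
      \<comment> \<open>Intermediate points stay within distance \<open>d\<close> of
        \<open>x\<close>, since each of their coordinates differs from that of \<open>x\<close> by
        at most the corresponding coordinate of \<open>h\<close>.\<close>
      have near: "dist (x + P B + s *\<^sub>R j) x < d" if s: "s \<in> closed_segment 0 a" for s
      proof -
        have "\<bar>s\<bar> \<le> \<bar>a\<bar>" using s by (auto simp: closed_segment_eq_real_ivl split: if_splits)
        then have "norm (P B + s *\<^sub>R j) \<le> norm h"
          using insert.hyps j B
          by (intro norm_le_componentwise) (auto simp: inner_add_left P_inner inner_Basis a_def)
        then show ?thesis using y by (simp add: dist_norm h_def add.assoc)
      qed
      define g where "g s = f (x + P B + s *\<^sub>R j) - s * partial j f x" for s
      have "norm (g a - g 0) \<le> e' * norm (a - 0)"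
      proof (rule field_differentiable_bound[where S="closed_segment 0 a"
            and f' = "\<lambda>s. partial j f (x + P B + s *\<^sub>R j) - partial j f x"])
        fix s assume s: "s \<in> closed_segment 0 a"
        note dd[OF near[OF s]]
        then show "norm (partial j f (x + P B + s *\<^sub>R j) - partial j f x) \<le> e'" using j by force
        show "(g has_real_derivative partial j f (x + P B + s *\<^sub>R j) - partial j f x) (at s within closed_segment 0 a)"
          unfolding g_def using dd[OF near[OF s]]
          by (auto intro!: derivative_eq_intros has_field_derivative_at_within[OF has_continuous_partials_line[OF f j]])
      qed auto
      then have "\<bar>f (x + P B + a *\<^sub>R j) - f (x + P B) - a * partial j f x\<bar> \<le> e' * \<bar>a\<bar>"
        by (simp add: g_def algebra_simps)
      moreover have eqP: "x + P (insert j B) = x + P B + a *\<^sub>R j" using insert.hyps by (simp add: P_def a_def)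
      moreover have eqS: "(\<Sum>i\<in>insert j B. (h \<bullet> i) * partial i f x) = a * partial j f x + (\<Sum>i\<in>B. (h \<bullet> i) * partial i f x)"
        "e' * (\<Sum>i\<in>insert j B. \<bar>h \<bullet> i\<bar>) = e' * \<bar>a\<bar> + e' * (\<Sum>i\<in>B. \<bar>h \<bullet> i\<bar>)"
        using insert.hyps by (simp_all add: a_def distrib_left)
      ultimately show ?case using insert.IH[OF B] unfolding eqP eqS by linarith
    qed
    have "P Basis = h" by (simp add: P_def euclidean_representation)
    then have "\<bar>f y - f x - (\<Sum>i\<in>Basis. (h \<bullet> i) * partial i f x)\<bar> \<le> e' * (\<Sum>i\<in>Basis. \<bar>h \<bullet> i\<bar>)"
      using *[OF finite_Basis order_refl] by (simp add: h_def)
    also have "\<dots> \<le> e' * (\<Sum>i\<in>(Basis::'a set). norm h)"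
      using e' by (intro mult_left_mono sum_mono) (auto simp: Basis_le_norm)
    also have "\<dots> = e * norm h" by (simp add: e'_def)
    finally show "norm (f y - f x - (\<Sum>i\<in>Basis. partial i f x *\<^sub>R i) \<bullet> (y - x)) \<le> e * norm (y - x)"
      by (simp add: h_def inner_sum_right inner_commute[of _ "y - x"] mult.commute)
  qed
qed

text \<open>The second-order Taylor expansion, unlike the partial derivatives of the definition of the
  Laplacian, does not refer to the basis; this gives the invariance of the Laplacian under reflections
  in arbitrary hyperplanes.\<close>

definition laplace_at :: "('a::euclidean_space \<Rightarrow> real) \<Rightarrow> 'a \<Rightarrow> real \<Rightarrow> 'a \<Rightarrow> bool" where
  "laplace_at f g L x \<longleftrightarrow> (\<exists>A. linear A \<and> L = (\<Sum>i\<in>Basis. A i \<bullet> i) \<and>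
     (\<lambda>h. f (x + h) - f x - g \<bullet> h - (A h \<bullet> h) / 2) \<in> o[at 0](\<lambda>h. (norm h)\<^sup>2))"

text \<open>Along the segment from \<open>x\<close> to \<open>x + h\<close> the derivative of the
  Taylor error is the linearisation error of the gradient paired with \<open>h\<close>, of size at
  most \<open>e * (norm h)\<^sup>2\<close>; the mean value inequality then bounds the error
  itself.\<close>

lemma laplace_at_derivative:
  fixes f :: "'a::euclidean_space \<Rightarrow> real"
  assumes f: "\<forall>\<^sub>F y in nhds x. (f has_derivative (\<lambda>h. G y \<bullet> h)) (at y)"
    and G: "(G has_derivative A) (at x)"
  shows "laplace_at f (G x) (\<Sum>i\<in>Basis. A i \<bullet> i) x"
  unfolding laplace_at_def
proof (intro exI[of _ A] conjI refl)
  show lin: "linear A" using G has_derivative_linear by blast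
  show "(\<lambda>h. f (x + h) - f x - G x \<bullet> h - (A h \<bullet> h) / 2) \<in> o[at 0](\<lambda>h. (norm h)\<^sup>2)"
  proof (rule landau_o.smallI)
    fix e :: real assume e: "e > 0"
    from f obtain d1 where d1: "d1 > 0" "\<And>y. dist y x < d1 \<Longrightarrow> (f has_derivative (\<lambda>h. G y \<bullet> h)) (at y)"
      unfolding eventually_nhds_metric by blast
    from G e obtain d2 where d2: "d2 > 0" "\<And>y. norm (y - x) < d2 \<Longrightarrow> norm (G y - G x - A (y - x)) \<le> e * norm (y - x)"
      unfolding has_derivative_at_alt by blast
    have "norm (f (x + h) - f x - G x \<bullet> h - (A h \<bullet> h) / 2) \<le> e * norm ((norm h)\<^sup>2)"
      if h: "norm h < min d1 d2" for h
    proof -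
      define r where "r t = f (x + t *\<^sub>R h) - t * (G x \<bullet> h) - t\<^sup>2 * (A h \<bullet> h) / 2" for t
      have "norm (r 1 - r 0) \<le> (e * (norm h)\<^sup>2) * norm (1 - 0 :: real)"
      proof (rule field_differentiable_bound[where S="{0..1}" and f' = "\<lambda>t. (G (x + t *\<^sub>R h) - G x - A (t *\<^sub>R h)) \<bullet> h"])
        fix t :: real assume t: "t \<in> {0..1}"
        then have th: "norm (t *\<^sub>R h) \<le> norm h" by (simp add: mult_left_le_one_le)
        then have "norm (t *\<^sub>R h) < d2" using h by linarith
        then have "norm (G (x + t *\<^sub>R h) - G x - A (t *\<^sub>R h)) \<le> e * norm (t *\<^sub>R h)"
          using d2(2)[of "x + t *\<^sub>R h"] by simp
        also have "\<dots> \<le> e * norm h" using th e by simp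
        finally have le: "norm (G (x + t *\<^sub>R h) - G x - A (t *\<^sub>R h)) \<le> e * norm h" .
        have "norm ((G (x + t *\<^sub>R h) - G x - A (t *\<^sub>R h)) \<bullet> h) \<le> norm (G (x + t *\<^sub>R h) - G x - A (t *\<^sub>R h)) * norm h"
          by (metis Cauchy_Schwarz_ineq2 real_norm_def)
        also have "\<dots> \<le> e * norm h * norm h" using le by (intro mult_right_mono) auto
        finally show "norm ((G (x + t *\<^sub>R h) - G x - A (t *\<^sub>R h)) \<bullet> h) \<le> e * (norm h)\<^sup>2"
          by (simp add: power2_eq_square)
        have fd: "(f has_derivative (\<lambda>k. G (x + t *\<^sub>R h) \<bullet> k)) (at (x + t *\<^sub>R h))"
          using th h by (intro d1(2)) (auto simp: dist_norm)
        have "((\<lambda>t. f (x + t *\<^sub>R h)) has_derivative (\<lambda>s. G (x + t *\<^sub>R h) \<bullet> (s *\<^sub>R h))) (at t)"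
          by (rule has_derivative_compose[where f = "\<lambda>t. x + t *\<^sub>R h", OF _ fd])
             (auto intro!: derivative_eq_intros)
        then have "((\<lambda>t. f (x + t *\<^sub>R h)) has_real_derivative (G (x + t *\<^sub>R h) \<bullet> h)) (at t)"
          by (simp add: has_field_derivative_def mult_commute_abs)
        note D = has_field_derivative_at_within[OF this, of "{0..1}"]
        show "(r has_real_derivative (G (x + t *\<^sub>R h) - G x - A (t *\<^sub>R h)) \<bullet> h) (at t within {0..1})"
          unfolding r_def
          by (auto intro!: derivative_eq_intros D simp: inner_diff_left linear_cmul[OF lin])
      qed auto
      then show ?thesis by (simp add: r_def algebra_simps)
    qed
    then show "\<forall>\<^sub>F h in at 0. norm (f (x + h) - f x - G x \<bullet> h - (A h \<bullet> h) / 2) \<le> e * norm ((norm h)\<^sup>2)"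
      unfolding eventually_at using d1(1) d2(1) by (intro exI[of _ "min d1 d2"]) auto
  qed
qed

lemma C2_on_laplace_at:
  assumes f: "f C2_on S" and S: "open S" and x: "x \<in> S"
  shows "laplace_at f (\<Sum>i\<in>Basis. partial i f x *\<^sub>R i) (laplacian f x) x"
proof -
  define G where "G y = (\<Sum>i\<in>Basis. partial i f y *\<^sub>R i)" for y
  have G: "(G has_derivative (\<lambda>h. \<Sum>i\<in>Basis. ((\<Sum>j\<in>Basis. partial j (partial i f) x *\<^sub>R j) \<bullet> h) *\<^sub>R i)) (at x)"
    unfolding G_def using f S x
    by (intro has_derivative_sum has_derivative_scaleR_left has_derivative_continuous_partials[of _ S])
       (auto simp: C2_on_def)
  have "\<forall>\<^sub>F y in nhds x. (f has_derivative (\<lambda>h. G y \<bullet> h)) (at y)"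
    using eventually_nhds_in_open[OF S x]
    by eventually_elim (use f S in \<open>auto simp: G_def C2_on_def intro!: has_derivative_continuous_partials\<close>)
  from laplace_at_derivative[OF this G]
  have "laplace_at f (G x) (\<Sum>k\<in>Basis. (\<Sum>i\<in>Basis. ((\<Sum>j\<in>Basis. partial j (partial i f) x *\<^sub>R j) \<bullet> k) *\<^sub>R i) \<bullet> k) x" .
  also have "(\<Sum>k\<in>Basis. (\<Sum>i\<in>Basis. ((\<Sum>j\<in>Basis. partial j (partial i f) x *\<^sub>R j) \<bullet> k) *\<^sub>R i) \<bullet> k) = laplacian f x"
    unfolding laplacian_def by (intro sum.cong refl) simp
  finally show ?thesis by (simp add: G_def)
qed

lemma smallo_le:
  fixes f g :: "'a::real_normed_vector \<Rightarrow> real"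
  assumes "\<And>e. e > 0 \<Longrightarrow> \<forall>\<^sub>F h in at 0. \<bar>f h\<bar> \<le> e * \<bar>g h\<bar>"
  shows "f \<in> o[at 0](g)"
  using assms by (intro landau_o.smallI) auto

lemma laplace_at_const: "laplace_at (\<lambda>y. c) 0 0 x"
  unfolding laplace_at_def by (rule exI[of _ "\<lambda>_. 0"]) (auto simp: linear_zero)

lemma laplace_at_inner: "laplace_at (\<lambda>y. y \<bullet> e) e 0 x"
  unfolding laplace_at_def
  by (rule exI[of _ "\<lambda>_. 0"]) (auto simp: linear_zero inner_add_left inner_commute[of e])

lemma laplace_at_inner_self: "laplace_at (\<lambda>y::'a::euclidean_space. y \<bullet> y) (2 *\<^sub>R x) (2 * real DIM('a)) x"
  unfolding laplace_at_def
  by (rule exI[of _ "\<lambda>h. 2 *\<^sub>R h"])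
     (auto simp: inner_add_left inner_add_right inner_commute intro!: linearI simp: algebra_simps)

lemma laplace_at_add:
  assumes "laplace_at f g L x" "laplace_at f' g' L' x"
  shows "laplace_at (\<lambda>y. f y + f' y) (g + g') (L + L') x"
proof -
  from assms obtain A A' where A: "linear A" "L = (\<Sum>i\<in>Basis. A i \<bullet> i)"
     "(\<lambda>h. f (x + h) - f x - g \<bullet> h - (A h \<bullet> h) / 2) \<in> o[at 0](\<lambda>h. (norm h)\<^sup>2)"
   and A': "linear A'" "L' = (\<Sum>i\<in>Basis. A' i \<bullet> i)"
     "(\<lambda>h. f' (x + h) - f' x - g' \<bullet> h - (A' h \<bullet> h) / 2) \<in> o[at 0](\<lambda>h. (norm h)\<^sup>2)"
    unfolding laplace_at_def by blast
  show ?thesis unfolding laplace_at_def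
    using sum_in_smallo(1)[OF A(3) A'(3)] A A'
    by (intro exI[of _ "\<lambda>h. A h + A' h"])
       (auto intro: linear_compose_add simp: inner_add_left sum.distrib algebra_simps add_divide_distrib)
qed

lemma laplace_at_cmult:
  assumes "laplace_at f g L x"
  shows "laplace_at (\<lambda>y. c * f y) (c *\<^sub>R g) (c * L) x"
proof -
  from assms obtain A where A: "linear A" "L = (\<Sum>i\<in>Basis. A i \<bullet> i)"
     "(\<lambda>h. f (x + h) - f x - g \<bullet> h - (A h \<bullet> h) / 2) \<in> o[at 0](\<lambda>h. (norm h)\<^sup>2)"
    unfolding laplace_at_def by blast
  have "(\<lambda>h. c * (f (x + h) - f x - g \<bullet> h - (A h \<bullet> h) / 2)) \<in> o[at 0](\<lambda>h. (norm h)\<^sup>2)"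
    using A(3) by (cases "c = 0") auto
  moreover have "linear (\<lambda>h. c *\<^sub>R A h)"
    using A(1) by (intro linear_compose_scale_right)
  ultimately show ?thesis unfolding laplace_at_def using A(2)
    by (intro exI[of _ "\<lambda>h. c *\<^sub>R A h"])
       (auto simp: sum_distrib_left right_diff_distrib field_simps)
qed

lemma laplace_at_diff:
  assumes "laplace_at f g L x" "laplace_at f' g' L' x"
  shows "laplace_at (\<lambda>y. f y - f' y) (g - g') (L - L') x"
  using laplace_at_add[OF assms(1) laplace_at_cmult[OF assms(2), of "-1"]] by simp

lemma laplace_at_shift:
  "laplace_at (\<lambda>y. f (c + y)) g L x \<longleftrightarrow> laplace_at f g L (c + x)"
  unfolding laplace_at_def by (simp add: add.assoc)

text \<open>\<open>F 0 = 0\<close> turns the estimate on punctured neighbourhoods into one on full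
  neighbourhoods, as required when \<open>T\<close> has a kernel. The constant
  \<open>e / K\<^sup>2\<close> absorbs the operator bound \<open>K\<close> of
  \<open>T\<close>.\<close>

lemma smallo_linear_comp:
  fixes F :: "'a::euclidean_space \<Rightarrow> real"
  assumes F: "F \<in> o[at 0](\<lambda>h. (norm h)\<^sup>2)" and F0: "F 0 = 0"
    and T: "bounded_linear T"
  shows "(\<lambda>h. F (T h)) \<in> o[at 0](\<lambda>h. (norm h)\<^sup>2)"
proof (rule smallo_le)
  fix e :: real assume e: "e > 0"
  obtain K where K: "K > 0" "\<And>h. norm (T h) \<le> norm h * K"
    using bounded_linear.pos_bounded[OF T] by blast
  have "e / K\<^sup>2 > 0" using e K by simp
  from landau_o.smallD[OF F this] have "\<forall>\<^sub>F h in nhds 0. \<bar>F h\<bar> \<le> (e / K\<^sup>2) * (norm h)\<^sup>2"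
    using F0 by (auto simp: eventually_at_filter elim!: eventually_mono)
  moreover have "filterlim T (nhds 0) (at 0)"
    using T bounded_linear.tendsto_zero[OF T tendsto_ident_at] by simp
  ultimately have "\<forall>\<^sub>F h in at 0. \<bar>F (T h)\<bar> \<le> (e / K\<^sup>2) * (norm (T h))\<^sup>2"
    by (rule eventually_compose_filterlim)
  then show "\<forall>\<^sub>F h in at 0. \<bar>F (T h)\<bar> \<le> e * \<bar>(norm h)\<^sup>2\<bar>"
  proof eventually_elim
    case (elim h)
    have "(norm (T h))\<^sup>2 \<le> (norm h * K)\<^sup>2" using K(2) by (intro power_mono) auto
    then have "(e / K\<^sup>2) * (norm (T h))\<^sup>2 \<le> (e / K\<^sup>2) * (norm h * K)\<^sup>2"
      using e by (intro mult_left_mono) auto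
    also have "\<dots> = e * (norm h)\<^sup>2" using K by (simp add: power_mult_distrib)
    finally show ?case using elim by simp
  qed
qed

lemma laplace_at_scale:
  assumes "laplace_at f g L (R *\<^sub>R x)"
  shows "laplace_at (\<lambda>y. f (R *\<^sub>R y)) (R *\<^sub>R g) (R\<^sup>2 * L) x"
proof -
  from assms obtain A where A: "linear A" "L = (\<Sum>i\<in>Basis. A i \<bullet> i)"
     "(\<lambda>h. f (R *\<^sub>R x + h) - f (R *\<^sub>R x) - g \<bullet> h - (A h \<bullet> h) / 2) \<in> o[at 0](\<lambda>h. (norm h)\<^sup>2)"
    unfolding laplace_at_def by blast
  have "(\<lambda>h. f (R *\<^sub>R x + R *\<^sub>R h) - f (R *\<^sub>R x) - g \<bullet> (R *\<^sub>R h) - (A (R *\<^sub>R h) \<bullet> (R *\<^sub>R h)) / 2) \<in> o[at 0](\<lambda>h. (norm h)\<^sup>2)"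
    by (rule smallo_linear_comp[OF A(3)]) (auto simp: linear_0[OF A(1)] bounded_linear_scaleR_right)
  moreover have "linear (\<lambda>h. R\<^sup>2 *\<^sub>R A h)"
    using A(1) by (intro linear_compose_scale_right)
  ultimately show ?thesis unfolding laplace_at_def using A(2)
    by (intro exI[of _ "\<lambda>h. R\<^sup>2 *\<^sub>R A h"])
       (auto simp: sum_distrib_left scaleR_add_right linear_cmul[OF A(1)] power2_eq_square mult.assoc)
qed

section \<open>Invariance under reflections in hyperplanes\<close>

definition reflect :: "'a::euclidean_space \<Rightarrow> real \<Rightarrow> 'a \<Rightarrow> 'a" where
  "reflect e l x = x + (2 * (l - x \<bullet> e)) *\<^sub>R e"

text \<open>The linear part \<open>T\<close> of the reflection is symmetric and orthogonal, so the
  second-order term becomes \<open>T (A (T h))\<close>, whose trace is that of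
  \<open>A\<close>.\<close>

lemma laplace_at_reflect:
  fixes e :: "'a::euclidean_space"
  assumes "laplace_at f g L (reflect e l x)" and e: "norm e = 1"
  shows "\<exists>g'. laplace_at (\<lambda>y. f (reflect e l y)) g' L x"
proof -
  from assms obtain A where A: "linear A" "L = (\<Sum>i\<in>Basis. A i \<bullet> i)"
     "(\<lambda>h. f (reflect e l x + h) - f (reflect e l x) - g \<bullet> h - (A h \<bullet> h) / 2) \<in> o[at 0](\<lambda>h. (norm h)\<^sup>2)"
    unfolding laplace_at_def by blast
  define T where "T h = h - (2 * (h \<bullet> e)) *\<^sub>R e" for h :: 'a
  have T: "linear T" unfolding T_def
    by (intro linearI) (auto simp: inner_add_left algebra_simps)
  have Tadj: "T h \<bullet> k = h \<bullet> T k" for h k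
    by (simp add: T_def inner_diff_left inner_diff_right inner_commute)
  have rT: "reflect e l (x + h) = reflect e l x + T h" for h
    by (simp add: reflect_def T_def inner_add_left algebra_simps)
  have ee: "e \<bullet> e = 1" using e by (simp add: norm_eq_1)
  have 1: "(\<lambda>h. f (reflect e l x + T h) - f (reflect e l x) - g \<bullet> T h - (A (T h) \<bullet> T h) / 2) \<in> o[at 0](\<lambda>h. (norm h)\<^sup>2)"
    by (rule smallo_linear_comp[OF A(3)]) (auto simp: linear_0[OF A(1)] T linear_conv_bounded_linear[symmetric])
  have sum1: "(\<Sum>i\<in>Basis. (i \<bullet> e) * (w \<bullet> i)) = w \<bullet> e" for w :: 'a
    by (metis (no_types, lifting) euclidean_inner inner_commute mult.commute sum.cong)
  have sum2: "(\<Sum>i\<in>Basis. (i \<bullet> e) * (A i \<bullet> e)) = A e \<bullet> e"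
  proof -
    have "A e = A (\<Sum>i\<in>Basis. (e \<bullet> i) *\<^sub>R i)" by (simp add: euclidean_representation)
    also have "\<dots> = (\<Sum>i\<in>Basis. (e \<bullet> i) *\<^sub>R A i)"
      by (simp add: linear_sum[OF A(1)] linear_cmul[OF A(1)])
    finally have "A e \<bullet> e = (\<Sum>i\<in>Basis. (e \<bullet> i) *\<^sub>R A i) \<bullet> e" by simp
    then show ?thesis by (simp add: inner_sum_left inner_commute[of e])
  qed
  have sum3: "(\<Sum>i\<in>Basis. (i \<bullet> e) * (i \<bullet> e)) = 1"
    using sum1[of e] ee by (simp add: inner_commute)
  \<comment> \<open>\<open>T\<close> is the identity minus twice the projection onto
    \<open>e\<close>, so the corrections to the trace are -2, -2 and +4 times
    \<open>A e \<bullet> e\<close> and cancel.\<close>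
  have "(\<Sum>i\<in>Basis. T (A (T i)) \<bullet> i) = (\<Sum>i\<in>Basis. A (T i) \<bullet> T i)" by (simp add: Tadj)
  also have "\<dots> = (\<Sum>i\<in>Basis. A i \<bullet> i - 2 * ((i \<bullet> e) * (A i \<bullet> e)) - 2 * ((i \<bullet> e) * (A e \<bullet> i)) + 4 * (A e \<bullet> e) * ((i \<bullet> e) * (i \<bullet> e)))"
  proof (rule sum.cong[OF refl])
    fix i :: 'a
    have "A (T i) = A i - (2 * (i \<bullet> e)) *\<^sub>R A e"
      by (simp add: T_def linear_diff[OF A(1)] linear_cmul[OF A(1)])
    show "A (T i) \<bullet> T i = A i \<bullet> i - 2 * ((i \<bullet> e) * (A i \<bullet> e)) - 2 * ((i \<bullet> e) * (A e \<bullet> i)) + 4 * (A e \<bullet> e) * ((i \<bullet> e) * (i \<bullet> e))"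
      unfolding \<open>A (T i) = _\<close> unfolding T_def
      by (simp add: inner_diff_left inner_diff_right algebra_simps)
  qed
  also have "\<dots> = L" unfolding sum.distrib sum_subtractf sum_distrib_left[symmetric] sum1 sum2 sum3 A(2) by simp
  finally have trace: "(\<Sum>i\<in>Basis. T (A (T i)) \<bullet> i) = L" .
  have "linear (\<lambda>h. T (A (T h)))"
    using linear_compose[OF linear_compose[OF T A(1)] T] by (simp add: o_def)
  with 1 trace have "laplace_at (\<lambda>y. f (reflect e l y)) (T g) L x"
    unfolding laplace_at_def rT
    by (intro exI[of _ "\<lambda>h. T (A (T h))"]) (simp add: Tadj)
  then show ?thesis by blast
qed

lemma laplace_at_local_min:
  fixes x :: "'a::euclidean_space"
  assumes lap: "laplace_at f g L x" and min: "\<forall>\<^sub>F y in nhds x. f x \<le> f y"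
  shows "L \<ge> 0"
proof -
  from lap obtain A where A: "linear A" "L = (\<Sum>i\<in>Basis. A i \<bullet> i)"
     "(\<lambda>h. f (x + h) - f x - g \<bullet> h - (A h \<bullet> h) / 2) \<in> o[at 0](\<lambda>h. (norm h)\<^sup>2)"
    unfolding laplace_at_def by blast
  have "A i \<bullet> i \<ge> 0" if i: "i \<in> Basis" for i
  proof (rule ccontr)
    assume "\<not> A i \<bullet> i \<ge> 0"
    define e where "e = - (A i \<bullet> i) / 4"
    then have e: "e > 0" using \<open>\<not> A i \<bullet> i \<ge> 0\<close> by simp
    from landau_o.smallD[OF A(3) e]
    obtain d where d: "d > 0" "\<And>h. h \<noteq> 0 \<Longrightarrow> norm h < d \<Longrightarrow> \<bar>f (x + h) - f x - g \<bullet> h - (A h \<bullet> h) / 2\<bar> \<le> e * (norm h)\<^sup>2"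
      unfolding eventually_at by (auto simp: dist_norm)
    from min obtain d' where d': "d' > 0" "\<And>y. dist y x < d' \<Longrightarrow> f x \<le> f y"
      unfolding eventually_nhds_metric by blast
    define t where "t = min d d' / 2"
    have t: "t > 0" "t < d" "t < d'" using d d' by (auto simp: t_def min_def)
    have n: "norm i = 1" using i by simp
    have i0: "i \<noteq> 0" using i by auto
    \<comment> \<open>Adding the expansions at \<open>t\<close> and \<open>-t\<close> along
      \<open>i\<close> cancels the gradient; with \<open>e\<close> a quarter of
      \<open>- (A i \<bullet> i)\<close> the error is too small to outweigh a negative second
      derivative.\<close>
    have "\<bar>f (x + t *\<^sub>R i) - f x - t * (g \<bullet> i) - t\<^sup>2 * (A i \<bullet> i) / 2\<bar> \<le> e * t\<^sup>2"
      using d(2)[of "t *\<^sub>R i"] t n i0 by (simp add: linear_cmul[OF A(1)] power2_eq_square)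
    moreover have "\<bar>f (x + (-t) *\<^sub>R i) - f x + t * (g \<bullet> i) - t\<^sup>2 * (A i \<bullet> i) / 2\<bar> \<le> e * t\<^sup>2"
      using d(2)[of "(-t) *\<^sub>R i"] t n i0 linear_cmul[OF A(1), of "-t" i] by (simp add: power2_eq_square)
    moreover have "f (x + t *\<^sub>R i) \<ge> f x" "f (x + (-t) *\<^sub>R i) \<ge> f x"
      using d'(2)[of "x + t *\<^sub>R i"] d'(2)[of "x + (-t) *\<^sub>R i"] t n by (auto simp: dist_norm)
    ultimately have "0 \<le> t\<^sup>2 * (A i \<bullet> i) + 2 * (e * t\<^sup>2)" by linarith
    also have "\<dots> = t\<^sup>2 * ((A i \<bullet> i) / 2)" by (simp add: e_def field_simps)
    finally have "(A i \<bullet> i) / 2 \<ge> 0" using t(1) by (metis zero_less_power mult_less_0_iff not_less not_less_iff_gr_or_eq)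
    then show False using \<open>\<not> A i \<bullet> i \<ge> 0\<close> by simp
  qed
  then show ?thesis unfolding A(2) by (rule sum_nonneg)
qed

section \<open>Chain and product rules for expansions\<close>

lemma laplace_at_real:
  fixes \<phi> :: "real \<Rightarrow> real"
  assumes "\<forall>\<^sub>F t in nhds s. (\<phi> has_real_derivative \<phi>' t) (at t)" "(\<phi>' has_real_derivative b) (at s)"
  shows "laplace_at \<phi> (\<phi>' s) b s"
proof -
  have "\<forall>\<^sub>F t in nhds s. (\<phi> has_derivative (\<lambda>h. \<phi>' t \<bullet> h)) (at t)"
    using assms(1) by (simp add: has_field_derivative_def)
  from laplace_at_derivative[OF this, of "(*) b"] assms(2) show ?thesis
    by (simp add: has_field_derivative_def)
qed

lemma laplace_at_real_remainder:
  fixes \<phi> :: "real \<Rightarrow> real"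
  assumes "laplace_at \<phi> a b s"
  shows "(\<lambda>t. \<phi> (s + t) - \<phi> s - a * t - b * t\<^sup>2 / 2) \<in> o[at 0](\<lambda>t. t\<^sup>2)"
proof -
  from assms obtain A where A: "linear A" "b = A 1"
    "(\<lambda>h. \<phi> (s + h) - \<phi> s - a * h - (A h * h) / 2) \<in> o[at 0](\<lambda>h. h\<^sup>2)"
    unfolding laplace_at_def by auto
  have "A h = b * h" for h using linear_cmul[OF A(1), of h 1] A(2) by simp
  then show ?thesis using A(3) by (simp add: power2_eq_square mult.assoc)
qed

text \<open>The increment \<open>\<Delta>\<close> of \<open>f\<close> is linear up to order two, so
  in the expansion of \<open>\<phi>\<close> its square may be replaced by the square of the linear
  part; this is where the term \<open>b * (g \<bullet> g)\<close> arises.\<close>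

lemma laplace_at_chain:
  fixes f :: "'a::euclidean_space \<Rightarrow> real"
  assumes f: "laplace_at f g L x" and \<phi>: "laplace_at \<phi> a b (f x)"
  shows "laplace_at (\<lambda>y. \<phi> (f y)) (a *\<^sub>R g) (a * L + b * (g \<bullet> g)) x"
proof -
  from f obtain A where A: "linear A" "L = (\<Sum>i\<in>Basis. A i \<bullet> i)"
     "(\<lambda>h. f (x + h) - f x - g \<bullet> h - (A h \<bullet> h) / 2) \<in> o[at 0](\<lambda>h. (norm h)\<^sup>2)"
    unfolding laplace_at_def by blast
  define \<Delta> where "\<Delta> h = f (x + h) - f x" for h
  define \<sigma> where "\<sigma> t = \<phi> (f x + t) - \<phi> (f x) - a * t - b * t\<^sup>2 / 2" for t
  obtain K where K: "\<And>h. norm (A h) \<le> norm h * K"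
    using bounded_linear.pos_bounded[of A] A(1) by (auto simp: linear_conv_bounded_linear)
  have "(\<lambda>h. (A h \<bullet> h) / 2) \<in> O[at 0](\<lambda>h. (norm h)\<^sup>2)"
  proof (rule bigoI[of _ "K / 2"], rule always_eventually, rule allI)
    fix h
    have "\<bar>A h \<bullet> h\<bar> \<le> norm (A h) * norm h" by (rule Cauchy_Schwarz_ineq2)
    also have "\<dots> \<le> norm h * K * norm h" using K by (intro mult_right_mono) auto
    finally show "norm ((A h \<bullet> h) / 2) \<le> K / 2 * norm ((norm h)\<^sup>2)"
      by (simp add: power2_eq_square ac_simps)
  qed
  from sum_in_bigo(1)[OF landau_o.small_imp_big[OF A(3)] this]
  have \<Delta>1: "(\<lambda>h. \<Delta> h - g \<bullet> h) \<in> O[at 0](\<lambda>h. (norm h)\<^sup>2)" by (simp add: \<Delta>_def)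
  have gh: "(\<lambda>h. g \<bullet> h) \<in> O[at 0](\<lambda>h. norm h)"
    by (rule bigoI[of _ "norm g"]) (auto simp: Cauchy_Schwarz_ineq2)
  have "\<forall>\<^sub>F h in at 0. norm h < (1::real)" for t :: 'a
    unfolding eventually_at by (intro exI[of _ 1]) auto
  then have lt1: "\<forall>\<^sub>F h::'a in at 0. norm h < 1" by blast
  have "(\<lambda>h::'a. (norm h)\<^sup>2) \<in> O[at 0](\<lambda>h. norm h)"
    by (rule bigoI[of _ 1], rule eventually_mono[OF lt1]) (auto simp: power2_eq_square mult_left_le)
  from landau_o.big_trans[OF \<Delta>1 this] have "(\<lambda>h. \<Delta> h - g \<bullet> h) \<in> O[at 0](\<lambda>h. norm h)" .
  from sum_in_bigo(1)[OF this gh] have \<Delta>: "\<Delta> \<in> O[at 0](\<lambda>h. norm h)" by simp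
  \<comment> \<open>The difference of the squares factors into a term of order two and one of order
    one, hence is of order three.\<close>
  from landau_o.big_mult[OF \<Delta>1 sum_in_bigo(1)[OF \<Delta> gh]]
  have "(\<lambda>h. (\<Delta> h - g \<bullet> h) * (\<Delta> h + g \<bullet> h)) \<in> O[at 0](\<lambda>h. (norm h)\<^sup>2 * norm h)" .
  also have "(\<lambda>h::'a. (norm h)\<^sup>2 * norm h) \<in> o[at 0](\<lambda>h. (norm h)\<^sup>2)"
  proof (rule smallo_le)
    fix e :: real assume e: "e > 0"
    have "\<forall>\<^sub>F h::'a in at 0. norm h < e"
      unfolding eventually_at using e by (intro exI[of _ e]) auto
    then show "\<forall>\<^sub>F h::'a in at 0. \<bar>(norm h)\<^sup>2 * norm h\<bar> \<le> e * \<bar>(norm h)\<^sup>2\<bar>"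
      by eventually_elim (auto simp: mult.commute intro!: mult_right_mono)
  qed
  finally have sq: "(\<lambda>h. (\<Delta> h)\<^sup>2 - (g \<bullet> h)\<^sup>2) \<in> o[at 0](\<lambda>h. (norm h)\<^sup>2)"
    by (simp add: power2_eq_square algebra_simps)
  obtain C where C: "C > 0" "\<forall>\<^sub>F h in at 0. norm (\<Delta> h) \<le> C * norm (norm h)"
    using \<Delta> by (elim landau_o.bigE)
  have \<Delta>0: "(\<Delta> \<longlongrightarrow> 0) (at 0)"
  proof (rule Lim_null_comparison)
    show "\<forall>\<^sub>F h in at 0. norm (\<Delta> h) \<le> C * norm h" using C(2) by simp
    show "((\<lambda>h. C * norm h) \<longlongrightarrow> 0) (at (0::'a))" by (auto intro!: tendsto_eq_intros)
  qed
  have \<sigma>: "(\<lambda>h. \<sigma> (\<Delta> h)) \<in> o[at 0](\<lambda>h. (norm h)\<^sup>2)"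
  proof (rule smallo_le)
    fix e :: real assume e: "e > 0"
    then have "e / C\<^sup>2 > 0" using C(1) by simp
    from landau_o.smallD[OF laplace_at_real_remainder[OF \<phi>] this]
    have "\<forall>\<^sub>F t in at 0. \<bar>\<sigma> t\<bar> \<le> (e / C\<^sup>2) * t\<^sup>2" by (simp add: \<sigma>_def)
    then have "\<forall>\<^sub>F t in nhds 0. \<bar>\<sigma> t\<bar> \<le> (e / C\<^sup>2) * t\<^sup>2"
      by (auto simp: eventually_at_filter \<sigma>_def elim!: eventually_mono)
    from eventually_compose_filterlim[OF this \<Delta>0] C(2)
    show "\<forall>\<^sub>F h in at 0. \<bar>\<sigma> (\<Delta> h)\<bar> \<le> e * \<bar>(norm h)\<^sup>2\<bar>"
    proof eventually_elim
      case (elim h)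
      have "(\<Delta> h)\<^sup>2 \<le> (C * norm h)\<^sup>2" using elim(2) power_mono[of "\<bar>\<Delta> h\<bar>" "C * norm h" 2] by simp
      then have "(e / C\<^sup>2) * (\<Delta> h)\<^sup>2 \<le> (e / C\<^sup>2) * (C * norm h)\<^sup>2"
        using e by (intro mult_left_mono) auto
      also have "\<dots> = e * (norm h)\<^sup>2" using C(1) by (simp add: power_mult_distrib)
      finally show ?case using elim(1) by simp
    qed
  qed
  have "(\<lambda>h. a * (f (x + h) - f x - g \<bullet> h - (A h \<bullet> h) / 2)) \<in> o[at 0](\<lambda>h. (norm h)\<^sup>2)"
    using A(3) by (cases "a = 0") auto
  moreover have "(\<lambda>h. b / 2 * ((\<Delta> h)\<^sup>2 - (g \<bullet> h)\<^sup>2)) \<in> o[at 0](\<lambda>h. (norm h)\<^sup>2)"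
    using sq by (cases "b = 0") auto
  ultimately have "(\<lambda>h. \<sigma> (\<Delta> h) + (a * (f (x + h) - f x - g \<bullet> h - (A h \<bullet> h) / 2) + b / 2 * ((\<Delta> h)\<^sup>2 - (g \<bullet> h)\<^sup>2))) \<in> o[at 0](\<lambda>h. (norm h)\<^sup>2)"
    by (intro sum_in_smallo(1)[OF \<sigma>] sum_in_smallo(1))
  also have "(\<lambda>h. \<sigma> (\<Delta> h) + (a * (f (x + h) - f x - g \<bullet> h - (A h \<bullet> h) / 2) + b / 2 * ((\<Delta> h)\<^sup>2 - (g \<bullet> h)\<^sup>2))) =
     (\<lambda>h. \<phi> (f (x + h)) - \<phi> (f x) - (a *\<^sub>R g) \<bullet> h - ((a *\<^sub>R A h + (b * (g \<bullet> h)) *\<^sub>R g) \<bullet> h) / 2)"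
    by (rule ext) (simp add: \<sigma>_def \<Delta>_def inner_add_left power2_eq_square field_simps)
  finally have 1: "(\<lambda>h. \<phi> (f (x + h)) - \<phi> (f x) - (a *\<^sub>R g) \<bullet> h - ((a *\<^sub>R A h + (b * (g \<bullet> h)) *\<^sub>R g) \<bullet> h) / 2) \<in> o[at 0](\<lambda>h. (norm h)\<^sup>2)" .
  have "(\<Sum>i\<in>Basis. (g \<bullet> i) * (g \<bullet> i)) = g \<bullet> g" by (rule euclidean_inner[symmetric])
  then have 2: "(\<Sum>i\<in>Basis. (a *\<^sub>R A i + (b * (g \<bullet> i)) *\<^sub>R g) \<bullet> i) = a * L + b * (g \<bullet> g)"
    by (simp add: inner_add_left sum.distrib A(2) sum_distrib_left[symmetric] mult.assoc)
  have "linear (\<lambda>h. a *\<^sub>R A h + (b * (g \<bullet> h)) *\<^sub>R g)"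
    by (intro linearI) (auto simp: linear_add[OF A(1)] linear_cmul[OF A(1)] inner_add_right algebra_simps)
  then show ?thesis unfolding laplace_at_def using 1 2 by (intro exI[of _ "\<lambda>h. a *\<^sub>R A h + (b * (g \<bullet> h)) *\<^sub>R g"]) simp
qed

text \<open>Polarisation: the product is a quarter of the difference of the squares of sum and
  difference, so the chain rule for the square suffices.\<close>

lemma laplace_at_mult:
  assumes "laplace_at f g L x" "laplace_at f' g' L' x"
  shows "laplace_at (\<lambda>y. f y * f' y) (f x *\<^sub>R g' + f' x *\<^sub>R g) (f x * L' + f' x * L + 2 * (g \<bullet> g')) x"
proof -
  have sq: "laplace_at (\<lambda>t::real. t * t) (2 * s) 2 s" for s
    using laplace_at_inner_self[of s] by simp
  note p = laplace_at_chain[OF laplace_at_add[OF assms] sq]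
    and m = laplace_at_chain[OF laplace_at_diff[OF assms] sq]
  have "laplace_at (\<lambda>y. f y * f' y)
     ((1/4) *\<^sub>R ((2 * (f x + f' x)) *\<^sub>R (g + g') - (2 * (f x - f' x)) *\<^sub>R (g - g')))
     ((1/4) * ((2 * (f x + f' x)) * (L + L') + 2 * ((g + g') \<bullet> (g + g')) - ((2 * (f x - f' x)) * (L - L') + 2 * ((g - g') \<bullet> (g - g'))))) x"
    using laplace_at_cmult[OF laplace_at_diff[OF p m], of "1/4"] by (simp add: algebra_simps)
  also have "(1/4) *\<^sub>R ((2 * (f x + f' x)) *\<^sub>R (g + g') - (2 * (f x - f' x)) *\<^sub>R (g - g')) = f x *\<^sub>R g' + f' x *\<^sub>R g"
    by (rule euclidean_eqI) (simp add: inner_add_left inner_diff_left field_simps)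
  also have "(1/4) * ((2 * (f x + f' x)) * (L + L') + 2 * ((g + g') \<bullet> (g + g')) - ((2 * (f x - f' x)) * (L - L') + 2 * ((g - g') \<bullet> (g - g')))) =
     f x * L' + f' x * L + 2 * (g \<bullet> g')"
    by (simp add: inner_add_left inner_add_right inner_diff_left inner_diff_right inner_commute field_simps)
  finally show ?thesis .
qed

lemma laplace_at_norm:
  fixes x :: "'a::euclidean_space"
  assumes "x \<noteq> 0"
  shows "laplace_at norm (x /\<^sub>R norm x) ((real DIM('a) - 1) / norm x) x"
proof -
  have pos: "x \<bullet> x > 0" using assms by simp
  have r: "sqrt (x \<bullet> x) = norm x" "x \<bullet> x = (norm x)\<^sup>2"
    by (simp_all add: norm_eq_sqrt_inner power2_norm_eq_inner)
  have "laplace_at sqrt (inverse (sqrt (x \<bullet> x)) / 2) (- (inverse (sqrt (x \<bullet> x)) ^ 3 / 4)) (x \<bullet> x)"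
  proof (rule laplace_at_real[where \<phi>' = "\<lambda>s. inverse (sqrt s) / 2"])
    have "\<forall>\<^sub>F s in nhds (x \<bullet> x). s > 0" using pos by (rule order_tendstoD(1)[OF filterlim_ident])
    then show "\<forall>\<^sub>F s in nhds (x \<bullet> x). (sqrt has_real_derivative inverse (sqrt s) / 2) (at s)"
      by eventually_elim (rule DERIV_real_sqrt)
    show "((\<lambda>s. inverse (sqrt s) / 2) has_real_derivative - (inverse (sqrt (x \<bullet> x)) ^ 3 / 4)) (at (x \<bullet> x))"
    proof -
      have "((\<lambda>s. inverse (sqrt s) / 2) has_real_derivative - (inverse (sqrt s) ^ 3 / 4)) (at s)" if "s > 0" for s
        using that by (auto intro!: derivative_eq_intros simp: power3_eq_cube)
      from this[OF pos] show ?thesis .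
    qed
  qed
  from laplace_at_chain[OF laplace_at_inner_self this]
  show ?thesis using assms
    by (simp add: norm_eq_sqrt_inner[symmetric] r inverse_eq_divide power3_eq_cube power2_eq_square field_simps)
qed

lemma laplace_at_radial:
  fixes x :: "'a::euclidean_space"
  assumes "x \<noteq> 0" "laplace_at \<phi> a b (norm x)"
  shows "\<exists>g. laplace_at (\<lambda>y. \<phi> (norm y)) g (b + (real DIM('a) - 1) / norm x * a) x"
  using laplace_at_chain[OF laplace_at_norm[OF assms(1)] assms(2)] assms(1)
  by (intro exI) (simp add: power2_norm_eq_inner[symmetric] power2_eq_square add.commute mult.commute)

text \<open>The differential inequality is asked for only at points where \<open>z\<close> is
  negative, so that negativity may be used to verify it. Subtracting a small multiple of the squared
  norm makes the Laplacian strictly negative, which excludes an interior minimum.\<close>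

lemma maximum_principle:
  fixes z :: "'a::euclidean_space \<Rightarrow> real"
  assumes K: "compact K" and z: "continuous_on K z"
    and lap: "\<And>x. x \<in> K \<Longrightarrow> z x \<ge> 0 \<or> x \<in> interior K \<and> (\<exists>g L. laplace_at z g L x \<and> L \<le> 0)"
    and x: "x \<in> K"
  shows "z x \<ge> 0"
proof (rule ccontr)
  assume neg: "\<not> z x \<ge> 0"
  obtain M where M: "M > 0" "\<And>y. y \<in> K \<Longrightarrow> norm y \<le> M"
    using compact_imp_bounded[OF K] by (meson bounded_pos)
  \<comment> \<open>Chosen so that the correction is at most \<open>- z x / 2\<close> on
    \<open>K\<close>; the minimiser of \<open>w\<close> is then still a point where \<open>z\<close>
    is negative.\<close>
  define e where "e = - z x / (2 * M\<^sup>2)"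
  have e: "e > 0" using neg M by (auto simp: e_def intro!: divide_neg_pos)
  define w where "w y = z y - e * (y \<bullet> y)" for y
  have "continuous_on K w" unfolding w_def by (intro continuous_intros z)
  then obtain y where y: "y \<in> K" "\<And>y'. y' \<in> K \<Longrightarrow> w y \<le> w y'"
    using continuous_attains_inf[OF K, of w] x by blast
  have "y \<bullet> y \<le> M\<^sup>2" using M(2)[OF y(1)] by (metis dot_square_norm norm_ge_zero power_mono)
  then have "e * (y \<bullet> y) \<le> - z x / 2" using M e by (simp add: e_def field_simps)
  moreover have "w y \<le> w x" using y x by blast
  moreover have "0 \<le> e * (x \<bullet> x)" using e by simp
  ultimately have "z y < 0" using neg unfolding w_def by linarith
  with lap[OF y(1)] obtain g L where *: "y \<in> interior K" "laplace_at z g L y" "L \<le> 0" by auto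
  have "laplace_at w (g - e *\<^sub>R 2 *\<^sub>R y) (L - e * (2 * real DIM('a))) y"
    unfolding w_def by (intro laplace_at_diff laplace_at_cmult laplace_at_inner_self *)
  moreover have "\<forall>\<^sub>F y' in nhds y. w y \<le> w y'"
    using eventually_nhds_in_open[OF open_interior *(1)]
    by eventually_elim (use y(2) interior_subset in blast)
  ultimately have "L - e * (2 * real DIM('a)) \<ge> 0" by (rule laplace_at_local_min)
  moreover have "e * (2 * real DIM('a)) > 0" using e by simp
  ultimately show False using *(3) by linarith
qed

section \<open>Moving planes in the unit ball\<close>

text \<open>Taking the squared norm as the variable keeps the formula valid at the origin, where the
  norm itself is not smooth.\<close>

lemma laplace_at_radial2:
  fixes x :: "'a::euclidean_space"
  assumes "laplace_at \<phi> a b (x \<bullet> x)"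
  shows "laplace_at (\<lambda>y. \<phi> (y \<bullet> y)) ((2 * a) *\<^sub>R x) (2 * real DIM('a) * a + 4 * (x \<bullet> x) * b) x"
  using laplace_at_chain[OF laplace_at_inner_self assms] by (simp add: algebra_simps)

lemma inner_self_le_1: "norm x \<le> 1 \<longleftrightarrow> x \<bullet> x \<le> 1" and inner_self_less_1: "norm x < 1 \<longleftrightarrow> x \<bullet> x < 1"
  and inner_self_eq_1: "norm x = 1 \<longleftrightarrow> x \<bullet> x = 1"
  by (auto simp: norm_eq_sqrt_inner)

text \<open>The bound stands in for a positive inner normal derivative, which \<open>u\<close> need
  not have. The barrier is a function of \<open>x \<bullet> x\<close> that vanishes on the sphere
  and is subharmonic in a shell; on the remaining inner ball the positive minimum of
  \<open>u\<close> takes over.\<close>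

lemma hopf_lower_bound:
  fixes u :: "'a::euclidean_space \<Rightarrow> real"
  assumes cont: "continuous_on (cball 0 1) u"
    and lap: "\<And>x. x \<in> ball 0 1 \<Longrightarrow> \<exists>g L. laplace_at u g L x \<and> L \<le> 0"
    and pos: "\<And>x. x \<in> ball 0 1 \<Longrightarrow> u x > 0"
    and bd: "\<And>x. norm x = 1 \<Longrightarrow> u x \<ge> 0"
  shows "\<exists>c>0. \<forall>x\<in>cball 0 1. u x \<ge> c * (1 - x \<bullet> x)"
proof -
  define N where "N = real DIM('a)"
  have N: "N \<ge> 1" by (simp add: N_def DIM_ge_Suc0 Suc_leI)
  \<comment> \<open>In the shell \<open>s > s0\<close> both \<open>N * (1 - s) \<le> 1 / 2\<close>
    and \<open>s \<ge> 1 / 2\<close> hold, which makes the Laplacian of the barrier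
    nonnegative.\<close>
  define s0 where "s0 = 1 - 1 / (2 * N)"
  have s0: "s0 < 1" "s0 \<ge> 1/2" using N by (auto simp: s0_def field_simps)
  let ?D = "cball (0::'a) (sqrt s0)"
  have D: "x \<in> ?D \<longleftrightarrow> x \<bullet> x \<le> s0" for x
    by (simp add: norm_eq_sqrt_inner)
  have D1: "?D \<subseteq> ball 0 1" using s0 D inner_self_less_1 by (auto simp del: mem_cball) fastforce
  have "continuous_on ?D u" by (rule continuous_on_subset[OF cont]) (use D1 in auto)
  then obtain y where y: "y \<in> ?D" "\<And>x. x \<in> ?D \<Longrightarrow> u y \<le> u x"
    using continuous_attains_inf[of ?D u] s0 by (auto simp: D)
  define m where "m = u y"
  have m: "m > 0" using pos y D1 by (auto simp: m_def)
  define c where "c = m / (1 + N)"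
  have c: "c > 0" "c * (1 + N) = m" using m N by (auto simp: c_def)
  define \<phi> where "\<phi> s = (1 - s) + N * (1 - s)\<^sup>2" for s :: real
  have \<phi>_lap: "laplace_at \<phi> (- 1 - 2 * N * (1 - s)) (2 * N) s" for s
    by (rule laplace_at_real[where \<phi>' = "\<lambda>s. - 1 - 2 * N * (1 - s)"])
       (auto simp: \<phi>_def[abs_def] algebra_simps intro!: derivative_eq_intros always_eventually)
  define z where "z x = u x - c * \<phi> (x \<bullet> x)" for x
  have zpos: "z x \<ge> 0" if x: "x \<in> cball 0 1" for x
  proof (rule maximum_principle[where K = "cball 0 1" and z = z])
    show "continuous_on (cball 0 1) z"
      unfolding z_def \<phi>_def by (intro continuous_intros cont)
    fix x :: 'a assume x: "x \<in> cball 0 1"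
    show "0 \<le> z x \<or> x \<in> interior (cball 0 1) \<and> (\<exists>g L. laplace_at z g L x \<and> L \<le> 0)"
    proof -
      consider "x \<bullet> x \<le> s0" | "norm x = 1" | "x \<bullet> x > s0" "norm x < 1" using x by force
      then show ?thesis
      proof cases
        case 1
        then have "u x \<ge> m" using y(2)[of x] D[of x] by (simp add: m_def del: mem_cball)
        moreover have "\<phi> (x \<bullet> x) \<le> 1 + N * 1"
          unfolding \<phi>_def using N s0 1 by (intro add_mono mult_left_mono power_le_one) auto
        then have "c * \<phi> (x \<bullet> x) \<le> m" using c by (metis mult.right_neutral mult_left_mono less_imp_le)
        ultimately show ?thesis by (simp add: z_def)
      next
        case 2
        then show ?thesis using bd[OF 2] by (simp add: z_def \<phi>_def inner_self_eq_1)
      next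
        case 3
        define s where "s = x \<bullet> x"
        have s: "s > s0" "s < 1" using 3 by (auto simp: s_def inner_self_less_1)
        obtain g L where L: "laplace_at u g L x" "L \<le> 0" using lap 3(2) by force
        have "laplace_at z (g - c *\<^sub>R ((2 * (- 1 - 2 * N * (1 - s))) *\<^sub>R x))
           (L - c * (2 * real DIM('a) * (- 1 - 2 * N * (1 - s)) + 4 * s * (2 * N))) x"
          unfolding z_def s_def by (intro laplace_at_diff laplace_at_cmult L laplace_at_radial2 \<phi>_lap)
        then have lapz: "\<exists>g. laplace_at z g (L - c * (2 * N * (- 1 - 2 * N * (1 - s)) + 4 * s * (2 * N))) x"
          unfolding N_def by blast
        have eq: "2 * N * (- 1 - 2 * N * (1 - s)) + 4 * s * (2 * N) = 2 * N * (4 * s - 1 - 2 * (N * (1 - s)))"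
          by (simp add: algebra_simps)
        have "N * (1 - s) \<le> 1 / 2"
          using s N by (simp add: s0_def field_simps)
        then have "2 * N * (4 * s - 1 - 2 * (N * (1 - s))) \<ge> 0"
          using s s0 N by (intro mult_nonneg_nonneg) auto
        then have "0 \<le> c * (2 * N * (4 * s - 1 - 2 * (N * (1 - s))))"
          by (rule mult_nonneg_nonneg[OF less_imp_le[OF c(1)]])
        then have "L - c * (2 * N * (- 1 - 2 * N * (1 - s)) + 4 * s * (2 * N)) \<le> 0"
          using L(2) unfolding eq by linarith
        with lapz have "\<exists>g L. laplace_at z g L x \<and> L \<le> 0" by blast
        moreover have "x \<in> interior (cball 0 1)" using 3(2) by (simp add: interior_cball)
        ultimately show ?thesis by blast
      qed
    qed
  qed (use x in auto)
  show ?thesis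
  proof (intro exI[of _ c] conjI ballI c(1))
    fix x :: 'a assume x: "x \<in> cball 0 1"
    have "1 - x \<bullet> x \<le> \<phi> (x \<bullet> x)" using N by (simp add: \<phi>_def)
    then have "c * (1 - x \<bullet> x) \<le> c * \<phi> (x \<bullet> x)" using c by (intro mult_left_mono) auto
    then show "c * (1 - x \<bullet> x) \<le> u x" using zpos[OF x] by (simp add: z_def)
  qed
qed

text \<open>The barrier has Laplacian at most \<open>-1\<close> only in a thin shell at the sphere and in a thin slab at
  the hyperplane, which is where the moving plane argument has no positivity yet; in exchange it is
  small relative to the distance to the sphere.\<close>

lemma shell_slab_barrier:
  fixes e :: "'a::euclidean_space"
  assumes e: "norm e = 1" and eps: "\<epsilon> > 0"
  shows "\<exists>\<rho> \<delta>. \<rho> < 1 \<and> 0 < \<delta> \<and> (\<forall>l. 0 \<le> l \<and> l \<le> 1 \<longrightarrow> (\<exists>\<phi>. continuous_on UNIV \<phi> \<and>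
     (\<forall>x. norm x \<le> 1 \<and> x \<bullet> e \<ge> l \<longrightarrow> 0 \<le> \<phi> x \<and> \<phi> x \<le> \<epsilon> * (1 - x \<bullet> x)) \<and>
     (\<forall>x. norm x \<le> 1 \<and> x \<bullet> e \<ge> l \<longrightarrow> (\<exists>g L. laplace_at \<phi> g L x \<and> L \<le> 0 \<and>
        (x \<bullet> x \<ge> \<rho> \<or> x \<bullet> e \<le> l + \<delta> \<longrightarrow> L \<le> -1)))))"
proof -
  \<comment> \<open>The barrier is the sum of two pieces, each at most \<open>\<epsilon> / 2\<close>
    times \<open>1 - x \<bullet> x\<close>: \<open>k\<close> sets the size of the shell piece,
    \<open>m\<close> that of the slab piece.\<close>
  obtain k :: nat where k: "real k > 2 / \<epsilon>" "k \<ge> 2"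
    by (metis reals_Archimedean2 max.strict_boundedE not_less of_nat_le_iff order_le_less_trans linorder_le_cases order.strict_trans2)
  \<comment> \<open>In the slab outside the shell, \<open>1 - s\<close> is only known to be at least
    \<open>1 / (2 * real k)\<close>, and the second derivative of \<open>\<psi>\<close> is at most
    \<open>- P / 4\<close>; this value of \<open>P\<close> makes the product of the two bounds equal
    to -1.\<close>
  define P where "P = 8 * real k"
  have P: "P > 0" using k by (simp add: P_def)
  obtain m :: nat where m: "real m > 2 * P / \<epsilon>" "m \<ge> 2"
    by (metis reals_Archimedean2 max.strict_boundedE not_less of_nat_le_iff order_le_less_trans linorder_le_cases order.strict_trans2)
  define \<rho> where "\<rho> = 1 - 1 / (2 * real k)"
  define \<delta> where "\<delta> = 1 / (2 * real m)"
  have \<rho>: "\<rho> < 1" "\<rho> \<ge> 1/2" using k by (auto simp: \<rho>_def field_simps)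
  have \<delta>: "\<delta> > 0" "\<delta> \<le> 1/2" using m by (auto simp: \<delta>_def field_simps)
  \<comment> \<open>Bernoulli's inequality: powers with exponent at most \<open>j\<close> stay above
    one half within \<open>1 / (2 * real j)\<close> of 1, which fixes the widths of shell and
    slab.\<close>
  have half: "t ^ n \<ge> 1 / 2" if "t \<ge> 1 - 1 / (2 * real j)" "n \<le> j" "j \<ge> 2" for t :: real and n j :: nat
  proof -
    have "1 + real n * (- (1 / (2 * real j))) \<le> (1 + - (1 / (2 * real j))) ^ n"
      using that by (intro Bernoulli_inequality) (simp add: field_simps)
    also have "\<dots> \<le> t ^ n" using that by (intro power_mono) (auto simp: field_simps)
    finally have "1 - real n / (2 * real j) \<le> t ^ n" by simp
    moreover have "real n / (2 * real j) \<le> 1 / 2" using that by (simp add: field_simps)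
    ultimately show ?thesis by linarith
  qed
  define a1 where "a1 s = - (s ^ (k - 1)) / real k" for s :: real
  define b1 where "b1 s = - (real (k - 1) * s ^ (k - 2)) / real k" for s :: real
  define \<phi>1 where "\<phi>1 s = (1 - s ^ k) / (real k)\<^sup>2" for s :: real
  have lap1: "laplace_at \<phi>1 (a1 s) (b1 s) s" for s
  proof (rule laplace_at_real[where \<phi>' = a1])
    have k0: "k \<noteq> 0" using k by simp
    show "\<forall>\<^sub>F t in nhds s. (\<phi>1 has_real_derivative a1 t) (at t)"
      unfolding \<phi>1_def a1_def using k
      by (intro always_eventually allI) (auto intro!: derivative_eq_intros simp: power2_eq_square field_simps)
    show "(a1 has_real_derivative b1 s) (at s)"
      unfolding b1_def a1_def using k
      by (auto intro!: derivative_eq_intros simp: field_simps numeral_2_eq_2)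
  qed
  define \<psi> where "\<psi> t = P * (1 - (1 - t) ^ m) / (real m)\<^sup>2" for t :: real
  define a2 where "a2 t = P * (1 - t) ^ (m - 1) / real m" for t :: real
  define b2 where "b2 t = - (P * (real (m - 1) * (1 - t) ^ (m - 2))) / real m" for t :: real
  have lap2: "laplace_at \<psi> (a2 s) (b2 s) s" for s
  proof (rule laplace_at_real[where \<phi>' = a2])
    show "\<forall>\<^sub>F t in nhds s. (\<psi> has_real_derivative a2 t) (at t)"
      unfolding \<psi>_def a2_def using m
      by (intro always_eventually allI) (auto intro!: derivative_eq_intros simp: power2_eq_square field_simps)
    show "(a2 has_real_derivative b2 s) (at s)"
      unfolding b2_def a2_def using m
      by (auto intro!: derivative_eq_intros simp: field_simps numeral_2_eq_2)
  qed
  show ?thesis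
  proof (rule exI[of _ \<rho>], rule exI[of _ \<delta>], intro conjI allI impI \<rho>(1) \<delta>(1))
    fix l :: real assume l: "0 \<le> l \<and> l \<le> 1"
    define \<phi> where "\<phi> x = \<phi>1 (x \<bullet> x) + (1 - x \<bullet> x) * \<psi> (x \<bullet> e - l)" for x
    have rng: "x \<bullet> x \<le> 1" "0 \<le> x \<bullet> x" "x \<bullet> e - l \<ge> 0" "x \<bullet> e - l \<le> 1" "x \<bullet> e \<ge> 0" if "norm x \<le> 1 \<and> x \<bullet> e \<ge> l" for x
    proof -
      show "x \<bullet> x \<le> 1" using that by (simp add: inner_self_le_1)
      have "x \<bullet> e \<le> norm x * norm e" by (rule norm_cauchy_schwarz)
      then show "x \<bullet> e - l \<le> 1" using that e l by simp
    qed (use that l in auto)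
    show "\<exists>\<phi>. continuous_on UNIV \<phi> \<and>
     (\<forall>x. norm x \<le> 1 \<and> x \<bullet> e \<ge> l \<longrightarrow> 0 \<le> \<phi> x \<and> \<phi> x \<le> \<epsilon> * (1 - x \<bullet> x)) \<and>
     (\<forall>x. norm x \<le> 1 \<and> x \<bullet> e \<ge> l \<longrightarrow> (\<exists>g L. laplace_at \<phi> g L x \<and> L \<le> 0 \<and>
        (x \<bullet> x \<ge> \<rho> \<or> x \<bullet> e \<le> l + \<delta> \<longrightarrow> L \<le> -1)))"
    proof (intro exI[of _ \<phi>] conjI allI impI)
      show "continuous_on UNIV \<phi>" unfolding \<phi>_def \<phi>1_def \<psi>_def using k m by (intro continuous_intros) auto
    next
      fix x :: 'a assume x: "norm x \<le> 1 \<and> x \<bullet> e \<ge> l"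
      note r = rng[OF x]
      define s where "s = x \<bullet> x"
      define t where "t = x \<bullet> e - l"
      have r': "0 \<le> s" "s \<le> 1" "0 \<le> t" "t \<le> 1" using r by (auto simp: s_def t_def)
      have sk: "s ^ k \<le> 1" "(1 - t) ^ m \<le> 1" "(1 - t) ^ m \<ge> 0" using r' by (auto intro!: power_le_one)
      have \<psi>: "0 \<le> \<psi> t" unfolding \<psi>_def using P sk by (intro divide_nonneg_nonneg mult_nonneg_nonneg) auto
      then show "0 \<le> \<phi> x"
        unfolding \<phi>_def s_def[symmetric] t_def[symmetric] \<phi>1_def using sk r' by (intro add_nonneg_nonneg mult_nonneg_nonneg) auto
      have "1 + real k * (s - 1) \<le> (1 + (s - 1)) ^ k" using r' by (intro Bernoulli_inequality) auto
      then have "1 - s ^ k \<le> real k * (1 - s)" by (simp add: algebra_simps)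
      then have "\<phi>1 s \<le> real k * (1 - s) / (real k)\<^sup>2" unfolding \<phi>1_def by (intro divide_right_mono) auto
      also have "\<dots> = (1 / real k) * (1 - s)" using k by (simp add: power2_eq_square)
      also have "\<dots> \<le> (\<epsilon> / 2) * (1 - s)" using k eps r' by (intro mult_right_mono) (auto simp: field_simps)
      finally have 1: "\<phi>1 s \<le> (\<epsilon> / 2) * (1 - s)" .
      have "P * (1 - (1 - t) ^ m) \<le> P * 1" using P sk by (intro mult_left_mono) auto
      then have "\<psi> t \<le> P / (real m)\<^sup>2" unfolding \<psi>_def by (simp add: divide_right_mono)
      also have "\<dots> \<le> P / (real m)" using m P by (intro divide_left_mono) (auto simp: power2_eq_square)
      also have "\<dots> \<le> \<epsilon> / 2" using m eps by (simp add: field_simps)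
      finally have "(1 - s) * \<psi> t \<le> (1 - s) * (\<epsilon> / 2)" using r' by (intro mult_left_mono) auto
      with 1 show "\<phi> x \<le> \<epsilon> * (1 - x \<bullet> x)"
        unfolding \<phi>_def s_def[symmetric] t_def[symmetric] by (simp add: algebra_simps)
    next
      fix x :: 'a assume x: "norm x \<le> 1 \<and> x \<bullet> e \<ge> l"
      note r = rng[OF x]
      define s where "s = x \<bullet> x"
      define t where "t = x \<bullet> e - l"
      have r': "0 \<le> s" "s \<le> 1" "0 \<le> t" "t \<le> 1" using r by (auto simp: s_def t_def)
      define N where "N = real DIM('a)"
      have N: "N \<ge> 1" by (simp add: N_def DIM_ge_Suc0 Suc_leI)
      have l1: "laplace_at (\<lambda>x. \<phi>1 (x \<bullet> x)) ((2 * a1 s) *\<^sub>R x) (2 * N * a1 s + 4 * s * b1 s) x"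
        unfolding s_def N_def by (intro laplace_at_radial2 lap1)
      have l2: "laplace_at (\<lambda>x. 1 - x \<bullet> x) (0 - 2 *\<^sub>R x) (0 - 2 * N) x"
        unfolding N_def by (intro laplace_at_diff laplace_at_const laplace_at_inner_self)
      have l3: "laplace_at (\<lambda>x. \<psi> (x \<bullet> e - l)) (a2 t *\<^sub>R (e - 0)) (a2 t * (0 - 0) + b2 t * ((e - 0) \<bullet> (e - 0))) x"
        unfolding t_def by (intro laplace_at_chain[where f = "\<lambda>x. x \<bullet> e - l"] laplace_at_diff laplace_at_const laplace_at_inner lap2)
      have ee: "e \<bullet> e = 1" using e by (simp add: inner_self_eq_1)
      define L1 where "L1 = 2 * N * a1 s + 4 * s * b1 s"
      \<comment> \<open>All three terms are nonpositive: \<open>\<psi>\<close> is nonnegative,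
        increasing and concave, and \<open>x \<bullet> e \<ge> l \<ge> 0\<close> gives the gradient
        cross term its sign.\<close>
      define L2 where "L2 = (1 - s) * b2 t - 2 * N * \<psi> t - 4 * a2 t * (x \<bullet> e)"
      have lap: "\<exists>g. laplace_at \<phi> g (L1 + L2) x"
        using laplace_at_add[OF l1 laplace_at_mult[OF l2 l3]]
        unfolding \<phi>_def by (auto simp: L1_def L2_def t_def[symmetric] s_def[symmetric] ee algebra_simps)
      have sk: "s ^ (k - 1) = s * s ^ (k - 2)" using k by (metis Suc_1 Suc_diff_Suc Suc_le_lessD power_Suc)
      then have L1: "L1 = - (s ^ (k - 1)) * ((2 * N + 4 * real (k - 1)) / real k)"
        unfolding L1_def a1_def b1_def sk using k by (simp add: field_simps)
      have q: "(2 * N + 4 * real (k - 1)) / real k \<ge> 2" using N k by (simp add: field_simps of_nat_diff)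
      have L1': "L1 \<le> - (s ^ (k - 1)) * 2"
        unfolding L1 using mult_left_mono[OF q, of "s ^ (k - 1)"] r' by (simp only: minus_mult_left[symmetric] neg_le_iff_le zero_le_power)
      have L1_0: "L1 \<le> 0" by (rule order_trans[OF L1']) (use r' in auto)
      have \<psi>: "0 \<le> \<psi> t" unfolding \<psi>_def using P r'
        by (intro divide_nonneg_nonneg mult_nonneg_nonneg) (auto intro!: power_le_one)
      have a2: "0 \<le> a2 t" unfolding a2_def using P r' by auto
      have "(1 - s) * b2 t \<le> 0" using r' P unfolding b2_def by (auto intro!: mult_nonneg_nonpos divide_nonpos_nonneg mult_nonneg_nonneg)
      moreover have "0 \<le> 2 * N * \<psi> t" "0 \<le> 4 * a2 t * (x \<bullet> e)" using \<psi> N a2 r by auto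
      ultimately have L2_0: "L2 \<le> 0" and L2: "L2 \<le> (1 - s) * b2 t" unfolding L2_def by linarith+
      have shell: "L1 \<le> -1" if "s \<ge> \<rho>"
        using half[of k s "k - 1"] that k L1' unfolding \<rho>_def by simp
      have slab: "L2 \<le> -1" if t: "t \<le> \<delta>" and s: "s \<le> \<rho>"
      proof -
        have "(1 - t) ^ (m - 2) \<ge> 1 / 2" using half[of m "1 - t" "m - 2"] t m unfolding \<delta>_def by simp
        then have "real (m - 1) * (1 - t) ^ (m - 2) \<ge> (real m / 2) * (1 / 2)"
          using m by (intro mult_mono) (auto simp: of_nat_diff)
        then have "P * (real (m - 1) * (1 - t) ^ (m - 2)) \<ge> P * ((real m / 2) * (1 / 2))"
          using P by (intro mult_left_mono) auto
        then have "- b2 t \<ge> P / 4" unfolding b2_def using m by (simp add: field_simps)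
        then have "(1 - s) * (- b2 t) \<ge> (1 / (2 * real k)) * (P / 4)"
          using s P r' by (intro mult_mono) (auto simp: \<rho>_def)
        also have "(1 / (2 * real k)) * (P / 4) = 1" using k by (simp add: P_def)
        finally show ?thesis using L2 by simp
      qed
      have "L1 + L2 \<le> -1" if "s \<ge> \<rho> \<or> t \<le> \<delta>"
        using that shell slab L1_0 L2_0 by (cases "s \<ge> \<rho>") auto
      then have "L1 + L2 \<le> 0 \<and> (x \<bullet> x \<ge> \<rho> \<or> x \<bullet> e \<le> l + \<delta> \<longrightarrow> L1 + L2 \<le> -1)"
        using L1_0 L2_0 by (simp add: s_def t_def algebra_simps)
      with lap show "\<exists>g L. laplace_at \<phi> g L x \<and> L \<le> 0 \<and> (x \<bullet> x \<ge> \<rho> \<or> x \<bullet> e \<le> l + \<delta> \<longrightarrow> L \<le> -1)"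
        by blast
    qed
  qed
qed


section \<open>Caps, reflections and domination\<close>

definition cap :: "'a::euclidean_space \<Rightarrow> real \<Rightarrow> 'a set" where
  "cap e l = {x. norm x \<le> 1 \<and> l \<le> x \<bullet> e}"

definition dominated :: "('a::euclidean_space \<Rightarrow> real) \<Rightarrow> 'a \<Rightarrow> real \<Rightarrow> bool" where
  "dominated u e l \<longleftrightarrow> (\<forall>x\<in>cap e l. u x \<le> u (reflect e l x))"

lemma compact_cap: "compact (cap e l)"
proof -
  have "cap e l = cball 0 1 \<inter> {x. l \<le> x \<bullet> e}" by (auto simp: cap_def)
  moreover have "closed {x. l \<le> x \<bullet> e}" by (intro closed_Collect_le continuous_intros)
  ultimately show ?thesis by (simp add: compact_Int_closed)
qed

lemma interior_capI:
  assumes "norm x < 1" "l < x \<bullet> e"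
  shows "x \<in> interior (cap e l)"
proof -
  have "open (ball 0 1 \<inter> {x. l < x \<bullet> e})"
    by (intro open_Int open_Collect_less continuous_intros) auto
  moreover have "ball 0 1 \<inter> {x. l < x \<bullet> e} \<subseteq> cap e l" by (auto simp: cap_def)
  moreover have "x \<in> ball 0 1 \<inter> {x. l < x \<bullet> e}" using assms by simp
  ultimately show ?thesis using interiorI by blast
qed

lemma reflect_inner_self:
  assumes "norm e = 1"
  shows "reflect e l x \<bullet> reflect e l x = x \<bullet> x - 4 * l * (x \<bullet> e - l)"
proof -
  have "e \<bullet> e = 1" using assms by (simp add: inner_self_eq_1)
  then show ?thesis
    by (simp add: reflect_def inner_add_left inner_add_right inner_commute[of e x] algebra_simps)
qed

lemma reflect_cap:
  assumes "norm e = 1" "0 \<le> l" "x \<in> cap e l"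
  shows "norm (reflect e l x) \<le> 1"
proof -
  have "0 \<le> 4 * l * (x \<bullet> e - l)" using assms by (auto simp: cap_def)
  moreover have "x \<bullet> x \<le> 1" using assms(3) by (simp add: cap_def inner_self_le_1)
  ultimately show ?thesis unfolding inner_self_le_1 reflect_inner_self[OF assms(1)] by linarith
qed

lemma continuous_on_reflect_cap:
  fixes u :: "'a::euclidean_space \<Rightarrow> real"
  assumes "norm e = 1" "0 \<le> l" and u: "continuous_on (cball 0 1) u"
  shows "continuous_on (cap e l) (\<lambda>x. u (reflect e l x))"
proof (rule continuous_on_compose2[OF u])
  show "continuous_on (cap e l) (reflect e l)"
    unfolding reflect_def by (intro continuous_intros)
qed (use reflect_cap[OF assms(1,2)] in auto)

text \<open>Bernoulli's inequality for an integer exponent above \<open>q\<close>; the defect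
  \<open>1 - t\<close> thus controls the defect of the power also when \<open>q < 1\<close>.\<close>

lemma one_minus_powr_le:
  fixes t q :: real
  assumes "0 \<le> t" "t \<le> 1" "q \<le> real n" "n \<ge> 1"
  shows "1 - t powr q \<le> real n * (1 - t)"
proof (cases "t = 0")
  case False
  have "1 + real n * (t - 1) \<le> (1 + (t - 1)) ^ n" using assms by (intro Bernoulli_inequality) auto
  also have "\<dots> = t powr real n" using False assms by (simp add: powr_realpow)
  also have "\<dots> \<le> t powr q" using assms by (intro powr_mono') auto
  finally show ?thesis by (simp add: algebra_simps)
qed (use assms in auto)

text \<open>The ball is scaled to the unit ball, \<open>\<mu>\<close> being the square of the
  original radius. The equations are stated through expansions, which reflections preserve.\<close>

locale normalized_solution =
  fixes \<mu> p q :: real and u v :: "'a::euclidean_space \<Rightarrow> real"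
  assumes params: "\<mu> > 0" "p > 0" "q > 0"
    and cont: "continuous_on (cball 0 1) u" "continuous_on (cball 0 1) v"
    and laplace_u: "norm x < 1 \<Longrightarrow> \<exists>g. laplace_at u g (- \<mu> * v x powr q) x"
    and laplace_v: "norm x < 1 \<Longrightarrow> \<exists>g. laplace_at v g (- \<mu> * u x powr p) x"
    and pos: "norm x < 1 \<Longrightarrow> u x > 0" "norm x < 1 \<Longrightarrow> v x > 0"
    and boundary: "norm x = 1 \<Longrightarrow> u x = 0" "norm x = 1 \<Longrightarrow> v x = 0"
begin

lemma swap: "normalized_solution \<mu> q p v u"
  using params cont laplace_u laplace_v pos boundary by unfold_locales auto

lemma nonneg: "norm x \<le> 1 \<Longrightarrow> u x \<ge> 0" "norm x \<le> 1 \<Longrightarrow> v x \<ge> 0"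
  using pos[of x] boundary[of x] by (cases "norm x = 1"; force)+

lemma lower_bound: "\<exists>c>0. \<forall>x\<in>cball 0 1. u x \<ge> c * (1 - x \<bullet> x)"
proof (rule hopf_lower_bound[OF cont(1)])
  fix x :: 'a assume "x \<in> ball 0 1"
  then have "norm x < 1" by simp
  with laplace_u[OF this] show "\<exists>g L. laplace_at u g L x \<and> L \<le> 0"
    using params by (meson mult_nonpos_nonneg neg_le_0_iff_le less_imp_le powr_ge_zero)
qed (use pos boundary in auto)

lemma source_bound: "\<exists>M>0. \<forall>x\<in>cball 0 1. \<mu> * v x powr q \<le> M"
proof -
  have "bounded (v ` cball 0 1)"
    using compact_continuous_image[OF cont(2)] by (simp add: compact_imp_bounded)
  then obtain B where B: "B > 0" "\<And>x. x \<in> cball 0 1 \<Longrightarrow> \<bar>v x\<bar> \<le> B" by (auto simp: bounded_pos)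
  show ?thesis
  proof (intro exI[of _ "\<mu> * B powr q"] conjI ballI)
    fix x :: 'a assume x: "x \<in> cball 0 1"
    then show "\<mu> * v x powr q \<le> \<mu> * B powr q"
      using params B(2)[OF x] nonneg(2)[of x] by (intro mult_left_mono powr_mono2) auto
  qed (use params B in auto)
qed

text \<open>Where \<open>u\<close> already lies below its reflection the claim is immediate, so the
  barrier has to act only at the other points, which lie neither on the sphere nor on the plane.
  \<open>M\<close> bounds the source, so \<open>(1 - t powr q) * M * \<phi>\<close> compensates the
  defect left by \<open>t\<close>.\<close>

lemma improve_domination:
  assumes e: "norm e = 1" and l: "0 \<le> l" and x: "x \<in> cap e l"
    and \<phi>: "continuous_on UNIV \<phi>" "\<And>x. x \<in> cap e l \<Longrightarrow> \<phi> x \<ge> 0"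
    and lap: "\<And>x. x \<in> cap e l \<Longrightarrow> u x \<le> u (reflect e l x) \<or> (\<exists>g L. laplace_at \<phi> g L x \<and> L \<le> -1)"
    and t: "0 \<le> t" "t \<le> 1" "\<And>x. x \<in> cap e l \<Longrightarrow> t * v x \<le> v (reflect e l x)"
    and M: "\<And>x. x \<in> cball 0 1 \<Longrightarrow> \<mu> * v x powr q \<le> M" "M > 0"
  shows "u x - (1 - t powr q) * M * \<phi> x \<le> u (reflect e l x)"
proof -
  define b where "b = 1 - t powr q"
  have b: "b \<ge> 0" using t params by (simp add: b_def powr_le1)
  define z where "z x = (u (reflect e l x) - u x) + (b * M) * \<phi> x" for x
  have "z x \<ge> 0"
  proof (rule maximum_principle[OF compact_cap _ _ x])
    have "cap e l \<subseteq> cball 0 1" by (auto simp: cap_def)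
    then show "continuous_on (cap e l) z" unfolding z_def
      by (intro continuous_intros continuous_on_reflect_cap[OF e l] cont
            continuous_on_subset[OF cont(1)] continuous_on_subset[OF \<phi>(1)]) auto
    fix x assume x: "x \<in> cap e l"
    show "z x \<ge> 0 \<or> x \<in> interior (cap e l) \<and> (\<exists>g L. laplace_at z g L x \<and> L \<le> 0)"
    proof (cases "u x \<le> u (reflect e l x)")
      case True
      then show ?thesis using b M(2) \<phi>(2)[OF x] by (simp add: z_def)
    next
      case False
      have nx: "norm x \<noteq> 1" using False boundary(1)[of x] nonneg(1)[OF reflect_cap[OF e l x]] by auto
      have xl: "x \<bullet> e \<noteq> l" using False by (auto simp: reflect_def)
      have n: "norm x < 1" "l < x \<bullet> e" using x nx xl by (auto simp: cap_def)
      then have int: "x \<in> interior (cap e l)" by (rule interior_capI)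
      have "0 \<le> 4 * l * (x \<bullet> e - l)" using n l by simp
      then have nr: "norm (reflect e l x) < 1"
        using n unfolding inner_self_less_1 reflect_inner_self[OF e] by linarith
      obtain g1 L where L: "laplace_at \<phi> g1 L x" "L \<le> -1" using lap[OF x] False by blast
      obtain g2 where g2: "laplace_at (\<lambda>x. u (reflect e l x)) g2 (- \<mu> * v (reflect e l x) powr q) x"
        using laplace_u[OF nr] laplace_at_reflect[OF _ e] by blast
      obtain g3 where g3: "laplace_at u g3 (- \<mu> * v x powr q) x" using laplace_u[OF n(1)] by blast
      have "laplace_at z ((g2 - g3) + (b * M) *\<^sub>R g1)
          ((- \<mu> * v (reflect e l x) powr q - - \<mu> * v x powr q) + b * M * L) x"
        unfolding z_def by (intro laplace_at_add laplace_at_diff laplace_at_cmult g2 g3 L)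
      moreover have "(- \<mu> * v (reflect e l x) powr q - - \<mu> * v x powr q) + b * M * L \<le> 0"
      proof -
        have "t powr q * v x powr q = (t * v x) powr q" using t pos(2)[OF n(1)] by (simp add: powr_mult)
        also have "\<dots> \<le> v (reflect e l x) powr q"
          using t(3)[OF x] t pos(2)[OF n(1)] params by (intro powr_mono2) auto
        finally have "\<mu> * (t powr q * v x powr q) \<le> \<mu> * v (reflect e l x) powr q"
          using params by (intro mult_left_mono) auto
        moreover have "b * (\<mu> * v x powr q) \<le> b * M" using M(1)[of x] n b by (intro mult_left_mono) auto
        moreover have "b * M * L \<le> b * M * (-1)" using L(2) b M(2) by (intro mult_left_mono) auto
        ultimately show ?thesis by (simp add: b_def algebra_simps)
      qed
      ultimately show ?thesis using int by blast
    qed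
  qed
  then show ?thesis by (simp add: z_def b_def)
qed

text \<open>The linear function vanishing on the hyperplane is harmonic, and by the identity
  \<open>reflect_inner_self\<close> it is dominated on the sphere by the lower bound for \<open>u\<close>; this replaces the
  strong maximum principle.\<close>

lemma dominated_linear:
  assumes e: "norm e = 1" and l: "0 \<le> l" and x: "x \<in> cap e l"
    and c: "c > 0" "\<And>x. x \<in> cball 0 1 \<Longrightarrow> u x \<ge> c * (1 - x \<bullet> x)"
    and dom: "dominated v e l"
  shows "u x + 4 * c * l * (x \<bullet> e - l) \<le> u (reflect e l x)"
proof -
  define z where "z x = (u (reflect e l x) - u x) - (4 * c * l) * (x \<bullet> e - l)" for x
  have "z x \<ge> 0"
  proof (rule maximum_principle[OF compact_cap _ _ x])
    have "cap e l \<subseteq> cball 0 1" by (auto simp: cap_def)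
    then show "continuous_on (cap e l) z" unfolding z_def
      by (intro continuous_intros continuous_on_reflect_cap[OF e l] cont
            continuous_on_subset[OF cont(1)]) auto
    fix x assume x: "x \<in> cap e l"
    consider "norm x = 1" | "x \<bullet> e = l" | "norm x < 1" "l < x \<bullet> e" using x by (force simp: cap_def)
    then show "z x \<ge> 0 \<or> x \<in> interior (cap e l) \<and> (\<exists>g L. laplace_at z g L x \<and> L \<le> 0)"
    proof cases
      case 1
      then have xx: "x \<bullet> x = 1" by (simp add: inner_self_eq_1)
      have "u (reflect e l x) \<ge> c * (4 * l * (x \<bullet> e - l))"
        using c(2)[of "reflect e l x"] reflect_cap[OF e l x] by (simp add: reflect_inner_self[OF e] xx)
      then show ?thesis using boundary(1)[OF 1] by (simp add: z_def algebra_simps)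
    next
      case 2
      then show ?thesis by (simp add: z_def reflect_def)
    next
      case 3
      then have int: "x \<in> interior (cap e l)" by (rule interior_capI)
      have "0 \<le> 4 * l * (x \<bullet> e - l)" using 3 l by simp
      then have nr: "norm (reflect e l x) < 1"
        using 3 unfolding inner_self_less_1 reflect_inner_self[OF e] by linarith
      obtain g2 where g2: "laplace_at (\<lambda>x. u (reflect e l x)) g2 (- \<mu> * v (reflect e l x) powr q) x"
        using laplace_u[OF nr] laplace_at_reflect[OF _ e] by blast
      obtain g3 where g3: "laplace_at u g3 (- \<mu> * v x powr q) x" using laplace_u[OF 3(1)] by blast
      have "laplace_at z ((g2 - g3) - (4 * c * l) *\<^sub>R (e - 0))
          ((- \<mu> * v (reflect e l x) powr q - - \<mu> * v x powr q) - 4 * c * l * (0 - 0)) x"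
        unfolding z_def
        by (intro laplace_at_diff laplace_at_cmult laplace_at_const laplace_at_inner g2 g3)
      moreover have "v x powr q \<le> v (reflect e l x) powr q"
        using dom x pos(2)[OF 3(1)] params by (intro powr_mono2) (auto simp: dominated_def)
      then have "(- \<mu> * v (reflect e l x) powr q - - \<mu> * v x powr q) - 4 * c * l * (0 - 0) \<le> 0"
        using params by simp
      ultimately show ?thesis using int by blast
    qed
  qed
  then show ?thesis by (simp add: z_def algebra_simps)
qed

end

context normalized_solution
begin

interpretation sw: normalized_solution \<mu> q p v u by (rule swap)

text \<open>Each round halves the defect: \<open>t\<close> runs through
  \<open>1 - (1/2) ^ j\<close>, and the limit gives full domination. The constant
  \<open>\<epsilon>\<close> depends on the solution alone, so it can be fixed before the plane and
  the barrier are chosen.\<close>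

lemma dominated_narrow:
  "\<exists>\<epsilon>>0. \<forall>e l \<phi>. norm e = 1 \<longrightarrow> 0 \<le> l \<longrightarrow> continuous_on UNIV \<phi> \<longrightarrow>
     (\<forall>x\<in>cap e l. 0 \<le> \<phi> x \<and> \<phi> x \<le> \<epsilon> * (1 - x \<bullet> x)) \<longrightarrow>
     (\<forall>x\<in>cap e l. u x \<le> u (reflect e l x) \<and> v x \<le> v (reflect e l x) \<or> (\<exists>g L. laplace_at \<phi> g L x \<and> L \<le> -1)) \<longrightarrow>
     dominated u e l \<and> dominated v e l"
proof -
  obtain c1 where c1: "c1 > 0" "\<And>x. x \<in> cball 0 1 \<Longrightarrow> u x \<ge> c1 * (1 - x \<bullet> x)" using lower_bound by blast
  obtain c2 where c2: "c2 > 0" "\<And>x. x \<in> cball 0 1 \<Longrightarrow> v x \<ge> c2 * (1 - x \<bullet> x)" using sw.lower_bound by blast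
  obtain M1 where M1: "M1 > 0" "\<And>x. x \<in> cball 0 1 \<Longrightarrow> \<mu> * v x powr q \<le> M1" using source_bound by blast
  obtain M2 where M2: "M2 > 0" "\<And>x. x \<in> cball 0 1 \<Longrightarrow> \<mu> * u x powr p \<le> M2" using sw.source_bound by blast
  obtain n :: nat where n: "p \<le> real n" "q \<le> real n" "n \<ge> 1"
  proof -
    obtain n :: nat where "max (max p q) 1 \<le> real n" using real_arch_simple by blast
    then show thesis by (intro that[of n]) auto
  qed
  \<comment> \<open>With this choice a defect \<open>(1/2) ^ j\<close> in one component costs the
    other at most the fraction \<open>(1/2) ^ Suc j\<close> of itself. The factor \<open>n\<close>
    comes from passing from powers to defects, \<open>M1\<close> and \<open>M2\<close> bound the
    sources, and \<open>c1\<close>, \<open>c2\<close> are the lower bounds relative to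
    \<open>1 - x \<bullet> x\<close>.\<close>
  define \<epsilon> where "\<epsilon> = min (c1 / (2 * real n * M1)) (c2 / (2 * real n * M2))"
  have \<epsilon>: "\<epsilon> > 0" using c1 c2 M1 M2 n by (simp add: \<epsilon>_def)
  have \<epsilon>1: "real n * M1 * \<epsilon> \<le> c1 / 2" and \<epsilon>2: "real n * M2 * \<epsilon> \<le> c2 / 2"
  proof -
    have "real n * M1 * \<epsilon> \<le> real n * M1 * (c1 / (2 * real n * M1))"
      unfolding \<epsilon>_def using M1 by (intro mult_left_mono) auto
    then show "real n * M1 * \<epsilon> \<le> c1 / 2" using M1 n by (simp add: field_simps)
    have "real n * M2 * \<epsilon> \<le> real n * M2 * (c2 / (2 * real n * M2))"
      unfolding \<epsilon>_def using M2 by (intro mult_left_mono) auto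
    then show "real n * M2 * \<epsilon> \<le> c2 / 2" using M2 n by (simp add: field_simps)
  qed
  have step: "w - b * M * f \<ge> (1 - (1/2) ^ Suc j) * w"
    if "c * d \<le> w" "f \<le> \<epsilon> * d" "b \<le> real n * (1/2) ^ j" "0 \<le> b" "real n * M * \<epsilon> \<le> c / 2" "0 \<le> d" "M > 0" "0 \<le> f" for w b M f c d :: real and j
  proof -
    have "b * M * f \<le> (real n * (1/2) ^ j) * M * (\<epsilon> * d)"
      using that by (intro mult_mono) auto
    also have "\<dots> = (real n * M * \<epsilon>) * ((1/2) ^ j * d)" by simp
    also have "\<dots> \<le> (c / 2) * ((1/2) ^ j * d)" using that by (intro mult_right_mono) auto
    also have "\<dots> = (1/2) ^ Suc j * (c * d)" by simp
    also have "\<dots> \<le> (1/2) ^ Suc j * w" using that by (intro mult_left_mono) auto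
    finally show ?thesis by (simp add: algebra_simps)
  qed
  show ?thesis
  proof (intro exI[of _ \<epsilon>] conjI \<epsilon> allI impI)
    fix e :: 'a and l \<phi>
    assume e: "norm e = 1" and l: "0 \<le> l" and \<phi>: "continuous_on UNIV \<phi>"
      and bd: "\<forall>x\<in>cap e l. 0 \<le> \<phi> x \<and> \<phi> x \<le> \<epsilon> * (1 - x \<bullet> x)"
      and lap: "\<forall>x\<in>cap e l. u x \<le> u (reflect e l x) \<and> v x \<le> v (reflect e l x) \<or> (\<exists>g L. laplace_at \<phi> g L x \<and> L \<le> -1)"
    have main: "\<forall>x\<in>cap e l. (1 - (1/2) ^ j) * u x \<le> u (reflect e l x) \<and> (1 - (1/2) ^ j) * v x \<le> v (reflect e l x)" for j
    proof (induction j)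
      case 0
      then show ?case using nonneg reflect_cap[OF e l] by simp
    next
      case (Suc j)
      define t where "t = 1 - (1/2::real) ^ j"
      have t: "0 \<le> t" "t \<le> 1" by (auto simp: t_def power_le_one)
      have b: "1 - t powr q \<le> real n * (1/2) ^ j" "1 - t powr p \<le> real n * (1/2) ^ j"
        using one_minus_powr_le[OF t n(2,3)] one_minus_powr_le[OF t n(1,3)] by (simp_all add: t_def)
      have b0: "0 \<le> 1 - t powr q" "0 \<le> 1 - t powr p" using t params by (auto simp: powr_le1)
      show ?case
      proof
        fix x assume x: "x \<in> cap e l"
        then have d: "0 \<le> 1 - x \<bullet> x" and xb: "x \<in> cball 0 1" by (auto simp: cap_def inner_self_le_1)
        have "u x - (1 - t powr q) * M1 * \<phi> x \<le> u (reflect e l x)"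
          by (rule improve_domination[OF e l x \<phi> _ _ t _ M1(2,1)]) (use bd lap Suc t_def in auto)
        moreover have "v x - (1 - t powr p) * M2 * \<phi> x \<le> v (reflect e l x)"
          by (rule sw.improve_domination[OF e l x \<phi> _ _ t _ M2(2,1)]) (use bd lap Suc t_def in auto)
        moreover have "(1 - (1/2) ^ Suc j) * u x \<le> u x - (1 - t powr q) * M1 * \<phi> x"
          by (rule step[OF c1(2)[OF xb] _ b(1) b0(1) \<epsilon>1 d]) (use bd x M1 in auto)
        moreover have "(1 - (1/2) ^ Suc j) * v x \<le> v x - (1 - t powr p) * M2 * \<phi> x"
          by (rule step[OF c2(2)[OF xb] _ b(2) b0(2) \<epsilon>2 d]) (use bd x M2 in auto)
        ultimately show "(1 - (1/2) ^ Suc j) * u x \<le> u (reflect e l x) \<and> (1 - (1/2) ^ Suc j) * v x \<le> v (reflect e l x)"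
          by linarith
      qed
    qed
    have lim: "(\<lambda>j. (1 - (1/2) ^ j) * w) \<longlonglongrightarrow> (1 - 0) * w" for w :: real
      by (intro tendsto_intros LIMSEQ_realpow_zero) auto
    have "dominated u e l"
      unfolding dominated_def using LIMSEQ_le_const2[OF lim] main by fastforce
    moreover have "dominated v e l"
      unfolding dominated_def using LIMSEQ_le_const2[OF lim] main by fastforce
    ultimately show "dominated u e l" "dominated v e l" by blast+
  qed
qed

end

section \<open>Moving the plane\<close>

lemma reflect_gap:
  fixes u :: "'a::euclidean_space \<Rightarrow> real"
  assumes u: "continuous_on (cball 0 1) u" and k: "k > 0"
  shows "\<exists>\<eta>>0. \<forall>e l l' x. norm e = 1 \<longrightarrow> \<bar>l - l'\<bar> \<le> \<eta> \<longrightarrow> norm (reflect e l x) \<le> 1 \<longrightarrow> norm (reflect e l' x) \<le> 1 \<longrightarrow>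
     \<bar>u (reflect e l x) - u (reflect e l' x)\<bar> \<le> k"
proof -
  have "uniformly_continuous_on (cball 0 1) u" by (rule compact_uniformly_continuous[OF u]) simp
  then obtain d where d: "d > 0" "\<And>x y. x \<in> cball 0 1 \<Longrightarrow> y \<in> cball 0 1 \<Longrightarrow> dist y x < d \<Longrightarrow> dist (u y) (u x) < k"
    unfolding uniformly_continuous_on_def using k by metis
  show ?thesis
  proof (intro exI[of _ "d/4"] conjI allI impI)
    fix e l l' and x :: 'a
    assume *: "norm e = 1" "\<bar>l - l'\<bar> \<le> d / 4" "norm (reflect e l x) \<le> 1" "norm (reflect e l' x) \<le> 1"
    have "reflect e l x - reflect e l' x = (2 * (l - l')) *\<^sub>R e" by (simp add: reflect_def algebra_simps)
    then have "dist (reflect e l x) (reflect e l' x) = 2 * \<bar>l - l'\<bar>"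
      using *(1) by (simp add: dist_norm abs_mult del: right_diff_distrib_numeral)
    moreover have "2 * \<bar>l - l'\<bar> \<le> d / 2" using *(2) by simp
    ultimately have "dist (reflect e l x) (reflect e l' x) < d" using d(1) by simp
    then show "\<bar>u (reflect e l x) - u (reflect e l' x)\<bar> \<le> k"
      using d(2)[of "reflect e l' x" "reflect e l x"] *(3,4) by (simp add: dist_real_def)
  qed (use d in auto)
qed

context normalized_solution
begin

interpretation sw: normalized_solution \<mu> q p v u by (rule swap)

text \<open>The step length \<open>\<eta>\<close> is uniform over all planes between
  \<open>l1\<close> and 1, so no infimum of admissible planes has to be examined. Points well beyond
  the plane keep their domination because the gap at \<open>l'\<close> is at least what a shift by
  \<open>\<eta>\<close> can destroy; the others are covered by the barrier.\<close>

lemma dominated_step: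
  assumes e: "norm e = 1" and l1: "0 < l1"
  shows "\<exists>\<eta>>0. \<forall>l l'. l1 \<le> l \<longrightarrow> l \<le> l' \<longrightarrow> l' \<le> 1 \<longrightarrow> l' - l \<le> \<eta> \<longrightarrow> dominated u e l' \<longrightarrow> dominated v e l' \<longrightarrow>
     dominated u e l \<and> dominated v e l"
proof -
  obtain c1 where c1: "c1 > 0" "\<And>x. x \<in> cball 0 1 \<Longrightarrow> u x \<ge> c1 * (1 - x \<bullet> x)" using lower_bound by blast
  obtain c2 where c2: "c2 > 0" "\<And>x. x \<in> cball 0 1 \<Longrightarrow> v x \<ge> c2 * (1 - x \<bullet> x)" using sw.lower_bound by blast
  obtain \<epsilon> where \<epsilon>: "\<epsilon> > 0" and narrow: "\<And>l \<phi>. 0 \<le> l \<Longrightarrow> continuous_on UNIV \<phi> \<Longrightarrow>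
     (\<And>x. x \<in> cap e l \<Longrightarrow> 0 \<le> \<phi> x \<and> \<phi> x \<le> \<epsilon> * (1 - x \<bullet> x)) \<Longrightarrow>
     (\<And>x. x \<in> cap e l \<Longrightarrow> u x \<le> u (reflect e l x) \<and> v x \<le> v (reflect e l x) \<or> (\<exists>g L. laplace_at \<phi> g L x \<and> L \<le> -1)) \<Longrightarrow>
     dominated u e l \<and> dominated v e l"
    using dominated_narrow e by metis
  obtain \<rho> \<delta> where \<delta>: "\<rho> < 1" "0 < \<delta>" and barrier: "\<And>l. 0 \<le> l \<Longrightarrow> l \<le> 1 \<Longrightarrow> (\<exists>\<phi>. continuous_on UNIV \<phi> \<and>
     (\<forall>x. norm x \<le> 1 \<and> x \<bullet> e \<ge> l \<longrightarrow> 0 \<le> \<phi> x \<and> \<phi> x \<le> \<epsilon> * (1 - x \<bullet> x)) \<and>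
     (\<forall>x. norm x \<le> 1 \<and> x \<bullet> e \<ge> l \<longrightarrow> (\<exists>g L. laplace_at \<phi> g L x \<and> L \<le> 0 \<and>
        (x \<bullet> x \<ge> \<rho> \<or> x \<bullet> e \<le> l + \<delta> \<longrightarrow> L \<le> -1))))"
    using shell_slab_barrier[OF e \<epsilon>] by blast
  \<comment> \<open>A lower bound for the gap that \<open>dominated_linear\<close> provides, for
    planes at or above \<open>l1\<close> and points at distance at least \<open>\<delta> / 2\<close>
    beyond them.\<close>
  define k where "k = 4 * min c1 c2 * l1 * (\<delta> / 2)"
  have k: "k > 0" using c1 c2 l1 \<delta> by (simp add: k_def)
  obtain \<eta>1 where \<eta>1: "\<eta>1 > 0" "\<And>l l' x. \<bar>l - l'\<bar> \<le> \<eta>1 \<Longrightarrow> norm (reflect e l x) \<le> 1 \<Longrightarrow> norm (reflect e l' x) \<le> 1 \<Longrightarrow>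
     \<bar>u (reflect e l x) - u (reflect e l' x)\<bar> \<le> k"
    using reflect_gap[OF cont(1) k] e by metis
  obtain \<eta>2 where \<eta>2: "\<eta>2 > 0" "\<And>l l' x. \<bar>l - l'\<bar> \<le> \<eta>2 \<Longrightarrow> norm (reflect e l x) \<le> 1 \<Longrightarrow> norm (reflect e l' x) \<le> 1 \<Longrightarrow>
     \<bar>v (reflect e l x) - v (reflect e l' x)\<bar> \<le> k"
    using reflect_gap[OF cont(2) k] e by metis
  define \<eta> where "\<eta> = min (\<delta> / 2) (min \<eta>1 \<eta>2)"
  show ?thesis
  proof (intro exI[of _ \<eta>] conjI allI impI)
    show "\<eta> > 0" using \<delta> \<eta>1 \<eta>2 by (simp add: \<eta>_def)
    fix l l' assume *: "l1 \<le> l" "l \<le> l'" "l' \<le> 1" "l' - l \<le> \<eta>" "dominated u e l'" "dominated v e l'"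
    have l: "0 \<le> l" "l \<le> 1" "0 \<le> l'" using * l1 by auto
    obtain \<phi> where \<phi>: "continuous_on UNIV \<phi>"
      "\<And>x. norm x \<le> 1 \<and> x \<bullet> e \<ge> l \<Longrightarrow> 0 \<le> \<phi> x \<and> \<phi> x \<le> \<epsilon> * (1 - x \<bullet> x)"
      "\<And>x. norm x \<le> 1 \<and> x \<bullet> e \<ge> l \<Longrightarrow> (\<exists>g L. laplace_at \<phi> g L x \<and> L \<le> 0 \<and>
        (x \<bullet> x \<ge> \<rho> \<or> x \<bullet> e \<le> l + \<delta> \<longrightarrow> L \<le> -1))"
      using barrier[OF l(1,2)] by auto
    have "dominated u e l \<and> dominated v e l"
    proof (rule narrow[OF l(1) \<phi>(1)])
      fix x assume x: "x \<in> cap e l"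
      then show "0 \<le> \<phi> x \<and> \<phi> x \<le> \<epsilon> * (1 - x \<bullet> x)" using \<phi>(2) by (simp add: cap_def)
      show "u x \<le> u (reflect e l x) \<and> v x \<le> v (reflect e l x) \<or> (\<exists>g L. laplace_at \<phi> g L x \<and> L \<le> -1)"
      proof (cases "x \<bullet> x \<ge> \<rho> \<or> x \<bullet> e \<le> l + \<delta>")
        case True
        then show ?thesis using \<phi>(3)[of x] x by (auto simp: cap_def)
      next
        case False
        then have d: "x \<bullet> e - l' \<ge> \<delta> / 2" using * by (simp add: \<eta>_def)
        then have x': "x \<in> cap e l'" using x \<delta> by (auto simp: cap_def)
        note r = reflect_cap[OF e l(1) x] and r' = reflect_cap[OF e l(3) x']
        have near: "\<bar>l - l'\<bar> \<le> \<eta>1" "\<bar>l - l'\<bar> \<le> \<eta>2" using * by (auto simp: \<eta>_def)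
        have "k \<le> 4 * c1 * l' * (x \<bullet> e - l')" "k \<le> 4 * c2 * l' * (x \<bullet> e - l')"
          unfolding k_def by (intro mult_mono; use c1(1) c2(1) l1 \<delta> *(1-4) d in simp)+
        then show ?thesis
          using \<eta>1(2)[OF near(1) r r'] \<eta>2(2)[OF near(2) r r']
            dominated_linear[OF e l(3) x' c1 *(6)] sw.dominated_linear[OF e l(3) x' c2 *(5)]
          by linarith
      qed
    qed
    then show "dominated u e l" "dominated v e l" by auto
  qed
qed

text \<open>The plane at 1 meets the ball only in a point that it fixes, and finitely many steps of
  uniform length lead from there to \<open>l\<close>. The length may degenerate as \<open>l\<close>
  tends to zero, so the plane through the centre is left to a limit.\<close>

lemma dominated_all:
  assumes e: "norm e = 1" and l: "0 < l" "l \<le> 1"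
  shows "dominated u e l \<and> dominated v e l"
proof -
  obtain \<eta> where \<eta>: "\<eta> > 0" and step: "\<And>l0 l'. l \<le> l0 \<Longrightarrow> l0 \<le> l' \<Longrightarrow> l' \<le> 1 \<Longrightarrow> l' - l0 \<le> \<eta> \<Longrightarrow>
     dominated u e l' \<and> dominated v e l' \<Longrightarrow> dominated u e l0 \<and> dominated v e l0"
    using dominated_step[OF e l(1)] by blast
  have "dominated w e 1" for w :: "'a \<Rightarrow> real"
    unfolding dominated_def
  proof
    fix x assume "x \<in> cap e 1"
    moreover have "x \<bullet> e \<le> norm x * norm e" by (rule norm_cauchy_schwarz)
    ultimately have "x \<bullet> e = 1" using e by (simp add: cap_def)
    then show "w x \<le> w (reflect e 1 x)" by (simp add: reflect_def)
  qed
  then have one: "dominated u e 1 \<and> dominated v e 1" by blast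
  have "\<forall>l'. l \<le> l' \<and> l' \<le> 1 \<and> 1 - l' \<le> real n * \<eta> \<longrightarrow> dominated u e l' \<and> dominated v e l'" for n
  proof (induction n)
    case 0
    then show ?case using one by (auto simp: order_antisym)
  next
    case (Suc n)
    show ?case
    proof (intro allI impI)
      fix l' assume l': "l \<le> l' \<and> l' \<le> 1 \<and> 1 - l' \<le> real (Suc n) * \<eta>"
      have "dominated u e (min 1 (l' + \<eta>)) \<and> dominated v e (min 1 (l' + \<eta>))"
        using Suc.IH l' \<eta> by (auto simp: min_def algebra_simps)
      then show "dominated u e l' \<and> dominated v e l'"
        by (intro step[of l' "min 1 (l' + \<eta>)"]) (use l' \<eta> in auto)
    qed
  qed
  moreover obtain n where "1 / \<eta> \<le> real n" using real_arch_simple by blast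
  then have "1 - l \<le> real n * \<eta>" using \<eta> l by (simp add: field_simps)
  ultimately show ?thesis using l by blast
qed

text \<open>The points are mirror images in the hyperplane through the origin normal to
  \<open>x - y\<close>. Domination for planes approaching it gives one inequality, and exchanging
  the points gives the other.\<close>

lemma radial:
  assumes "norm x = norm y" "norm x \<le> 1"
  shows "u x = u y"
proof -
  have "u x \<le> u y" if xy: "norm x = norm y" "norm x \<le> 1" "x \<noteq> y" for x y
  proof -
    define e where "e = (x - y) /\<^sub>R norm (x - y)"
    have n: "norm (x - y) > 0" using xy by simp
    have e: "norm e = 1" using n by (simp add: e_def)
    have "(x - y) \<bullet> (x - y) = 2 * ((x - y) \<bullet> x)"
      using xy(1) by (simp add: norm_eq inner_diff_left inner_diff_right inner_commute)
    then have "(x - y) \<bullet> x = (norm (x - y))\<^sup>2 / 2" by (simp add: power2_norm_eq_inner)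
    then have xe: "x \<bullet> e = norm (x - y) / 2"
      using n unfolding e_def inner_scaleR_right inner_commute[of x "x - y"]
      by (simp add: power2_eq_square inverse_eq_divide field_simps)
    have refl0: "reflect e 0 x = y" using n by (simp add: reflect_def xe) (simp add: e_def)
    have "(\<lambda>n. 1 / real (Suc n)) \<longlonglongrightarrow> 0" by (rule LIMSEQ_Suc[OF lim_1_over_n])
    then have lim0: "(\<lambda>n. (x \<bullet> e) * (1 / real (Suc n))) \<longlonglongrightarrow> (x \<bullet> e) * 0" by (rule tendsto_mult_left)
    define \<sigma> where "\<sigma> n = (x \<bullet> e) * (1 / real (Suc n))" for n
    have \<sigma>: "\<sigma> n > 0" "\<sigma> n \<le> x \<bullet> e" for n
      using n by (auto simp: \<sigma>_def xe field_simps)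
    have xe1: "x \<bullet> e \<le> 1" using norm_cauchy_schwarz[of x e] e xy by simp
    have mem: "x \<in> cap e (\<sigma> n)" for n using \<sigma> xy by (simp add: cap_def)
    have le: "u x \<le> u (reflect e (\<sigma> n) x)" for n
      using dominated_all[OF e \<sigma>(1)[of n]] \<sigma>(2)[of n] xe1 mem[of n] by (auto simp: dominated_def)
    have "(\<lambda>n. reflect e (\<sigma> n) x) \<longlonglongrightarrow> reflect e ((x \<bullet> e) * 0) x"
      unfolding reflect_def \<sigma>_def by (intro tendsto_intros lim0)
    then have "(\<lambda>n. reflect e (\<sigma> n) x) \<longlonglongrightarrow> y" by (simp add: refl0)
    then have "(\<lambda>n. u (reflect e (\<sigma> n) x)) \<longlonglongrightarrow> u y"
      using xy reflect_cap[OF e _ mem] \<sigma>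
      by (intro continuous_on_tendsto_compose[OF cont(1)]) (auto simp: less_imp_le)
    then show ?thesis using le by (intro LIMSEQ_le_const) auto
  qed
  from this[of x y] this[of y x] assms show ?thesis by (cases "x = y") auto
qed

text \<open>Reflection in the plane halfway between exchanges the two points, and
  \<open>dominated_linear\<close> has a strictly positive gap there.\<close>

lemma strictly_decreasing:
  assumes e: "norm e = 1" and st: "0 \<le> s" "s < t" "t \<le> 1"
  shows "u (t *\<^sub>R e) < u (s *\<^sub>R e)"
proof -
  obtain c where c: "c > 0" "\<And>x. x \<in> cball 0 1 \<Longrightarrow> u x \<ge> c * (1 - x \<bullet> x)" using lower_bound by blast
  define l where "l = (s + t) / 2"
  have l: "0 < l" "l \<le> 1" "l < t" using st by (auto simp: l_def)
  have ee: "e \<bullet> e = 1" using e by (simp add: inner_self_eq_1)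
  have "t *\<^sub>R e \<in> cap e l" using e ee l st by (simp add: cap_def)
  from dominated_linear[OF e less_imp_le[OF l(1)] this c] dominated_all[OF e l(1,2)]
  have "u (t *\<^sub>R e) + 4 * c * l * (t - l) \<le> u (reflect e l (t *\<^sub>R e))" using ee by simp
  moreover have "reflect e l (t *\<^sub>R e) = s *\<^sub>R e"
    using ee by (simp add: reflect_def l_def scaleR_add_left[symmetric] field_simps)
  moreover have "4 * c * l * (t - l) > 0" using c l by simp
  ultimately show ?thesis by simp
qed

end

section \<open>The radial integral operator\<close>

text \<open>With \<open>d = N - 1\<close> and \<open>W = ball_avg d f\<close>, the solution of \<open>\<Delta>u + f(|x|) = 0\<close> that is radial has
  \<open>\<nabla>u(x) = - W(|x|) x\<close>, so that \<open>radial_int d f\<close> inverts minus the radial Laplacian.\<close>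

definition ball_avg :: "nat \<Rightarrow> (real \<Rightarrow> real) \<Rightarrow> real \<Rightarrow> real" where
  "ball_avg d f s = integral {0..1} (\<lambda>t. t ^ d * f (s * t))"

definition radial_int :: "nat \<Rightarrow> (real \<Rightarrow> real) \<Rightarrow> real \<Rightarrow> real" where
  "radial_int d f r = integral {0..r} (\<lambda>s. s * ball_avg d f s)"

lemma mult_mem_interval: "0 \<le> s \<Longrightarrow> s \<le> T \<Longrightarrow> 0 \<le> t \<Longrightarrow> t \<le> 1 \<Longrightarrow> s * t \<in> {0..T::real}"
  using mult_left_le[of t s] by auto

lemma ball_avg_integrand:
  fixes f :: "real \<Rightarrow> real"
  assumes "continuous_on {0..T} f" "0 \<le> s" "s \<le> T"
  shows "continuous_on {0..1} (\<lambda>t. t ^ d * f (s * t))"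
proof (rule continuous_on_mult)
  show "continuous_on {0..1} (\<lambda>t. f (s * t))"
    by (rule continuous_on_compose2[OF assms(1)]) (use assms mult_mem_interval in \<open>auto intro!: continuous_intros\<close>)
qed (intro continuous_intros)

lemma continuous_on_ball_avg:
  assumes f: "continuous_on {0..T} f"
  shows "continuous_on {0..T} (ball_avg d f)"
proof -
  have "continuous_on ({0..T} \<times> cbox 0 (1::real)) (\<lambda>(s, t). t ^ d * f (s * t))"
    unfolding split_beta
  proof (rule continuous_on_mult)
    show "continuous_on ({0..T} \<times> cbox 0 1) (\<lambda>x. f (fst x * snd x))"
    proof (rule continuous_on_compose2[OF f])
      show "(\<lambda>x. fst x * snd x) ` ({0..T} \<times> cbox 0 1) \<subseteq> {0..T}"
        using mult_mem_interval by force
    qed (intro continuous_intros)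
  qed (intro continuous_intros)
  from integral_continuous_on_param[OF this] show ?thesis
    by (simp add: ball_avg_def[abs_def])
qed

lemma ball_avg_mono:
  assumes "continuous_on {0..s} f" "continuous_on {0..s} g" "0 \<le> s" "\<And>x. x \<in> {0..s} \<Longrightarrow> f x \<le> g x"
  shows "ball_avg d f s \<le> ball_avg d g s"
  unfolding ball_avg_def
  by (intro integral_le integrable_continuous_real ball_avg_integrand[OF assms(1)] ball_avg_integrand[OF assms(2)])
     (use assms mult_mem_interval[of s s] in \<open>auto intro!: mult_left_mono\<close>)

lemma ball_avg_const: "ball_avg d (\<lambda>_. m) s = m / (real d + 1)"
proof -
  have D: "((\<lambda>t. t ^ Suc d * (m / real (Suc d))) has_real_derivative t ^ d * m) (at t within {0..1})" for t
    using DERIV_cmult_right[OF DERIV_pow[of "Suc d" t "{0..1}"], of "m / real (Suc d)"] by simp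
  have "((\<lambda>t. t ^ d * m) has_integral (1 ^ Suc d * (m / real (Suc d)) - 0 ^ Suc d * (m / real (Suc d)))) {0..1::real}"
    by (rule fundamental_theorem_of_calculus)
       (use D in \<open>auto simp flip: has_real_derivative_iff_has_vector_derivative\<close>)
  from integral_unique[OF this] show ?thesis by (simp only: ball_avg_def) simp
qed

lemma ball_avg_add:
  assumes "continuous_on {0..s} f" "continuous_on {0..s} g" "0 \<le> s"
  shows "ball_avg d (\<lambda>x. f x + g x) s = ball_avg d f s + ball_avg d g s"
  unfolding ball_avg_def
  by (subst integral_add[symmetric])
     (use assms in \<open>auto intro!: integrable_continuous_real ball_avg_integrand simp: distrib_left\<close>)

lemma ball_avg_ge:
  assumes "continuous_on {0..s} f" "0 \<le> s" "\<And>x. x \<in> {0..s} \<Longrightarrow> m \<le> f x"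
  shows "m / (real d + 1) \<le> ball_avg d f s"
  using ball_avg_mono[of s "\<lambda>_. m" f d] assms by (simp add: ball_avg_const)

lemma ball_avg_le:
  assumes "continuous_on {0..s} f" "0 \<le> s" "\<And>x. x \<in> {0..s} \<Longrightarrow> f x \<le> m"
  shows "ball_avg d f s \<le> m / (real d + 1)"
  using ball_avg_mono[of s f "\<lambda>_. m" d] assms by (simp add: ball_avg_const)

lemma ball_avg_pos:
  assumes f: "continuous_on {0..s} f" "0 \<le> s" "\<And>x. x \<in> {0..s} \<Longrightarrow> 0 \<le> f x" and f0: "f 0 > 0"
  shows "0 < ball_avg d f s"
proof -
  have nn: "0 \<le> ball_avg d f s" using ball_avg_ge[OF f, of d] by simp
  have "ball_avg d f s \<noteq> 0"
  proof
    assume "ball_avg d f s = 0"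
    moreover have c: "continuous_on {0..1} (\<lambda>t. t ^ d * f (s * t))"
      by (rule ball_avg_integrand[OF f(1)]) (use f in auto)
    ultimately have z: "t ^ d * f (s * t) = 0" if "t \<in> {0..1}" for t
      using that f mult_mem_interval[of s s] unfolding ball_avg_def
      by (subst (asm) integral_eq_0_iff[OF c]) auto
    have "(\<lambda>n. f (s * (1 / real (Suc n)))) \<longlonglongrightarrow> f (s * 0)"
    proof (rule continuous_on_tendsto_compose[OF f(1)])
      show "(\<lambda>n. s * (1 / real (Suc n))) \<longlonglongrightarrow> s * 0"
        by (intro tendsto_intros LIMSEQ_Suc[OF lim_1_over_n])
      show "\<forall>\<^sub>F n in sequentially. s * (1 / real (Suc n)) \<in> {0..s}"
        using mult_mem_interval[of s s "1 / real (Suc n)" for n] f(2) by (intro always_eventually) auto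
    qed (use f in auto)
    moreover have "f (s * (1 / real (Suc n))) = 0" for n using z[of "1 / real (Suc n)"] by simp
    ultimately have "f 0 = 0" by (simp add: LIMSEQ_const_iff)
    then show False using f0 by simp
  qed
  then show ?thesis using nn by simp
qed

text \<open>This recovers the familiar weighted integral of the radial flux; the average over the
  unit interval avoids dividing by a power of \<open>s\<close> at the origin.\<close>

lemma ball_avg_integral:
  assumes f: "continuous_on {0..T} f" and s: "0 \<le> s" "s \<le> T"
  shows "s ^ Suc d * ball_avg d f s = integral {0..s} (\<lambda>t. t ^ d * f t)"
proof -
  have "((\<lambda>t. s *\<^sub>R ((s * t) ^ d * f (s * t))) has_integral integral {s * 0..s * 1} (\<lambda>t. t ^ d * f t)) {0..1}"
  proof (rule has_integral_substitution[where c = 0 and d = T])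
    show "(*) s ` {0..1} \<subseteq> {0..T}" using mult_mem_interval[OF s] by auto
    show "continuous_on {0..T} (\<lambda>t. t ^ d * f t)" by (intro continuous_intros f)
  qed (use s in \<open>auto intro!: derivative_eq_intros\<close>)
  then have "integral {0..1} (\<lambda>t. s *\<^sub>R ((s * t) ^ d * f (s * t))) = integral {s * 0..s * 1} (\<lambda>t. t ^ d * f t)"
    by (rule integral_unique)
  moreover have "(\<lambda>t. s *\<^sub>R ((s * t) ^ d * f (s * t))) = (\<lambda>t. s ^ Suc d * (t ^ d * f (s * t)))"
    by (auto simp: power_mult_distrib)
  ultimately show ?thesis by (simp only: ball_avg_def integral_mult_right mult_zero_right mult_1_right)
qed

lemma ball_avg_weighted_derivative:
  assumes f: "continuous_on {0..T} f" and s: "0 < s" "s < T"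
  shows "((\<lambda>r. r ^ Suc d * ball_avg d f r) has_real_derivative s ^ d * f s) (at s)"
proof -
  have "((\<lambda>r. integral {0..r} (\<lambda>t. t ^ d * f t)) has_real_derivative s ^ d * f s) (at s within {0..T})"
    by (rule integral_has_real_derivative) (use s in \<open>auto intro!: continuous_intros f\<close>)
  then have "((\<lambda>r. integral {0..r} (\<lambda>t. t ^ d * f t)) has_real_derivative s ^ d * f s) (at s)"
    using s by (simp add: at_within_Icc_at)
  then show ?thesis
    by (rule has_field_derivative_transform_within_open[of _ _ _ "{0<..<T}"])
       (use s ball_avg_integral[OF f] in auto)
qed

lemma ball_avg_derivative:
  assumes f: "continuous_on {0..T} f" and s: "0 < s" "s < T"
  shows "(ball_avg d f has_real_derivative (f s - (real d + 1) * ball_avg d f s) / s) (at s)"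
proof -
  have "((\<lambda>r. (r ^ Suc d * ball_avg d f r) / r ^ Suc d) has_real_derivative
      (s ^ d * f s * s ^ Suc d - (s ^ Suc d * ball_avg d f s) * (real (Suc d) * s ^ d)) / (s ^ Suc d * s ^ Suc d)) (at s)"
    using s DERIV_pow[of "Suc d" s UNIV] by (intro DERIV_divide ball_avg_weighted_derivative[OF f]) auto
  also have "(s ^ d * f s * s ^ Suc d - (s ^ Suc d * ball_avg d f s) * (real (Suc d) * s ^ d)) / (s ^ Suc d * s ^ Suc d)
     = (f s - (real d + 1) * ball_avg d f s) / s"
    using s by (simp add: field_simps)
  finally show ?thesis
    by (rule has_field_derivative_transform_within_open[of _ _ _ "{0<..}"]) (use s in auto)
qed

lemma radial_int_0 [simp]: "radial_int d f 0 = 0"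
  by (simp add: radial_int_def)

lemma radial_int_integrand:
  assumes "continuous_on {0..T} f"
  shows "continuous_on {0..T} (\<lambda>s. s * ball_avg d f s)"
  by (intro continuous_intros continuous_on_ball_avg assms)

lemma continuous_on_radial_int:
  assumes f: "continuous_on {0..T} f"
  shows "continuous_on {0..T} (radial_int d f)"
  unfolding radial_int_def[abs_def]
  by (intro indefinite_integral_continuous_1 integrable_continuous_real radial_int_integrand f)

lemma radial_int_derivative:
  assumes f: "continuous_on {0..T} f" and s: "0 < s" "s < T"
  shows "(radial_int d f has_real_derivative s * ball_avg d f s) (at s)"
proof -
  have "(radial_int d f has_real_derivative s * ball_avg d f s) (at s within {0..T})"
    unfolding radial_int_def[abs_def]
    by (rule integral_has_real_derivative) (use s in \<open>auto intro!: radial_int_integrand f\<close>)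
  then show ?thesis using s by (simp add: at_within_Icc_at)
qed

lemma radial_int_mono:
  assumes f: "continuous_on {0..r} f" "continuous_on {0..r} g" and le: "\<And>x. x \<in> {0..r} \<Longrightarrow> f x \<le> g x"
  shows "radial_int d f r \<le> radial_int d g r"
  unfolding radial_int_def
proof (intro integral_le integrable_continuous_real radial_int_integrand f)
  fix s assume s: "s \<in> {0..r}"
  then have "ball_avg d f s \<le> ball_avg d g s"
    by (intro ball_avg_mono continuous_on_subset[OF f(1)] continuous_on_subset[OF f(2)] le) auto
  then show "s * ball_avg d f s \<le> s * ball_avg d g s" using s by (intro mult_left_mono) auto
qed

lemma radial_int_add:
  assumes f: "continuous_on {0..r} f" "continuous_on {0..r} g"
  shows "radial_int d (\<lambda>x. f x + g x) r = radial_int d f r + radial_int d g r"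
proof -
  have "radial_int d f r + radial_int d g r = integral {0..r} (\<lambda>s. s * ball_avg d f s + s * ball_avg d g s)"
    unfolding radial_int_def
    by (intro integral_add[symmetric] integrable_continuous_real radial_int_integrand f)
  also have "\<dots> = radial_int d (\<lambda>x. f x + g x) r"
    unfolding radial_int_def
  proof (rule integral_cong)
    fix s assume "s \<in> {0..r}"
    then show "s * ball_avg d f s + s * ball_avg d g s = s * ball_avg d (\<lambda>x. f x + g x) s"
      by (subst ball_avg_add) (auto intro: continuous_on_subset[OF f(1)] continuous_on_subset[OF f(2)] simp: distrib_left)
  qed
  finally show ?thesis by simp
qed

lemma radial_int_const:
  assumes "0 \<le> r"
  shows "radial_int d (\<lambda>_. m) r = m * r\<^sup>2 / (2 * (real d + 1))"
proof -
  define k where "k = m / (real d + 1)"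
  have "((\<lambda>s. s * k) has_integral (r\<^sup>2 * k / 2 - 0\<^sup>2 * k / 2)) {0..r}"
    by (rule fundamental_theorem_of_calculus)
       (use assms in \<open>auto intro!: derivative_eq_intros simp flip: has_real_derivative_iff_has_vector_derivative\<close>)
  from integral_unique[OF this] show ?thesis
    by (simp only: radial_int_def ball_avg_const k_def[symmetric]) (simp add: k_def mult.commute)
qed

lemma radial_int_ge:
  assumes "continuous_on {0..r} f" "0 \<le> r" "\<And>x. x \<in> {0..r} \<Longrightarrow> m \<le> f x"
  shows "m * r\<^sup>2 / (2 * (real d + 1)) \<le> radial_int d f r"
  using radial_int_mono[of r "\<lambda>_. m" f d] assms by (simp add: radial_int_const)

lemma radial_int_le:
  assumes "continuous_on {0..r} f" "0 \<le> r" "\<And>x. x \<in> {0..r} \<Longrightarrow> f x \<le> m"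
  shows "radial_int d f r \<le> m * r\<^sup>2 / (2 * (real d + 1))"
  using radial_int_mono[of r f "\<lambda>_. m" d] assms by (simp add: radial_int_const)

lemma radial_int_increasing:
  assumes f: "continuous_on {0..t} f" and nn: "\<And>x. x \<in> {0..t} \<Longrightarrow> 0 \<le> f x" and st: "0 \<le> s" "s \<le> t"
  shows "radial_int d f s \<le> radial_int d f t"
proof (cases "s = t")
  case False
  have "radial_int d f s \<le> radial_int d f t"
  proof (rule DERIV_nonneg_imp_increasing_open[OF st(2)])
    fix x assume x: "s < x" "x < t"
    have "0 / (real d + 1) \<le> ball_avg d f x"
      by (rule ball_avg_ge) (use x st nn in \<open>auto intro: continuous_on_subset[OF f]\<close>)
    then have "0 \<le> x * ball_avg d f x" using x st by simp
    then show "\<exists>y. (radial_int d f has_real_derivative y) (at x) \<and> 0 \<le> y"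
      using radial_int_derivative[OF f, of x d] x st by force
  qed (use st in \<open>auto intro: continuous_on_subset[OF continuous_on_radial_int[OF f]]\<close>)
  then show ?thesis .
qed simp

lemma radial_int_strict_increasing:
  assumes f: "continuous_on {0..t} f" and nn: "\<And>x. x \<in> {0..t} \<Longrightarrow> 0 \<le> f x" and f0: "f 0 > 0" and st: "0 \<le> s" "s < t"
  shows "radial_int d f s < radial_int d f t"
proof (rule DERIV_pos_imp_increasing_open[OF st(2)])
  fix x assume x: "s < x" "x < t"
  have "0 < ball_avg d f x"
    by (rule ball_avg_pos) (use x st nn f0 in \<open>auto intro: continuous_on_subset[OF f]\<close>)
  then have "0 < x * ball_avg d f x" using x st by simp
  then show "\<exists>y. (radial_int d f has_real_derivative y) (at x) \<and> y > 0"
    using radial_int_derivative[OF f, of x d] x st by force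
qed (use st in \<open>auto intro: continuous_on_subset[OF continuous_on_radial_int[OF f]]\<close>)

text \<open>Since \<open>g\<close> is only a pointwise limit, integrability is part of the
  conclusion; dominated convergence is applied to the inner average and to the outer integral.
  Continuity of limiting solutions is derived from the second claim.\<close>

lemma radial_int_convergent:
  assumes f: "\<And>n. continuous_on {0..r} (f n)" and bd: "\<And>n x. x \<in> {0..r} \<Longrightarrow> \<bar>f n x\<bar> \<le> M"
    and lim: "\<And>x. x \<in> {0..r} \<Longrightarrow> (\<lambda>n. f n x) \<longlonglongrightarrow> g x"
  shows "(\<lambda>n. radial_int d (f n) r) \<longlonglongrightarrow> radial_int d g r"
    and "(\<lambda>s. s * ball_avg d g s) integrable_on {0..r}"
proof -
  have avg: "(\<lambda>n. ball_avg d (f n) s) \<longlonglongrightarrow> ball_avg d g s" if s: "s \<in> {0..r}" for s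
    unfolding ball_avg_def
  proof (rule dominated_convergence(2)[where h = "\<lambda>_. M"])
    fix n show "(\<lambda>t. t ^ d * f n (s * t)) integrable_on {0..1}"
      by (intro integrable_continuous_real ball_avg_integrand[OF f]) (use s in auto)
  next
    fix n and t :: real assume t: "t \<in> {0..1}"
    have "\<bar>t ^ d\<bar> * \<bar>f n (s * t)\<bar> \<le> 1 * M"
      using t s bd mult_mem_interval[of s r t] by (intro mult_mono) (auto simp: power_le_one power_abs)
    then show "norm (t ^ d * f n (s * t)) \<le> M" by (simp add: abs_mult)
    show "(\<lambda>n. t ^ d * f n (s * t)) \<longlonglongrightarrow> t ^ d * g (s * t)"
      using t s mult_mem_interval[of s r t] by (intro tendsto_intros lim) auto
  qed auto
  have avg_le: "\<bar>ball_avg d (f n) s\<bar> \<le> M / (real d + 1)" if s: "s \<in> {0..r}" for n s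
  proof -
    have "continuous_on {0..s} (f n)" using s by (auto intro: continuous_on_subset[OF f])
    moreover have "-M \<le> f n x" "f n x \<le> M" if "x \<in> {0..s}" for x using bd[of x n] s that by auto
    ultimately have "(-M) / (real d + 1) \<le> ball_avg d (f n) s" "ball_avg d (f n) s \<le> M / (real d + 1)"
      using s by (intro ball_avg_ge ball_avg_le; simp)+
    then show ?thesis by auto
  qed
  have bd': "norm (s * ball_avg d (f n) s) \<le> r * (M / (real d + 1))" if s: "s \<in> {0..r}" for n s
  proof -
    have "\<bar>s\<bar> * \<bar>ball_avg d (f n) s\<bar> \<le> r * (M / (real d + 1))"
      using s avg_le[OF s] by (intro mult_mono) auto
    then show ?thesis by (simp add: abs_mult)
  qed
  note dc = dominated_convergence[of "\<lambda>n s. s * ball_avg d (f n) s" "{0..r}" "\<lambda>_. r * (M / (real d + 1))" "\<lambda>s. s * ball_avg d g s"]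
  show "(\<lambda>n. radial_int d (f n) r) \<longlonglongrightarrow> radial_int d g r"
    unfolding radial_int_def
    by (rule dc(2)) (use bd' in \<open>auto intro!: integrable_continuous_real radial_int_integrand f tendsto_intros avg\<close>)
  show "(\<lambda>s. s * ball_avg d g s) integrable_on {0..r}"
    by (rule dc(1)) (use bd' in \<open>auto intro!: integrable_continuous_real radial_int_integrand f tendsto_intros avg\<close>)
qed

section \<open>Powers of the positive part\<close>

definition ppow :: "real \<Rightarrow> real \<Rightarrow> real" where
  "ppow q t = max t 0 powr q"

lemma ppow_nonneg [simp]: "0 \<le> ppow q t"
  by (simp add: ppow_def)

lemma ppow_mono: "q > 0 \<Longrightarrow> s \<le> t \<Longrightarrow> ppow q s \<le> ppow q t"
  unfolding ppow_def by (intro powr_mono2) auto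

lemma ppow_nonneg_eq: "0 \<le> t \<Longrightarrow> ppow q t = t powr q"
  by (simp add: ppow_def max_def)

lemma ppow_pos: "t > 0 \<Longrightarrow> ppow q t > 0"
  by (simp add: ppow_def)

lemma continuous_on_ppow [continuous_intros]:
  "q > 0 \<Longrightarrow> continuous_on S f \<Longrightarrow> continuous_on S (\<lambda>x. ppow q (f x))"
  unfolding ppow_def by (intro continuous_on_powr' continuous_intros) auto

text \<open>Only \<open>x\<close> is kept away from zero. If \<open>y\<close> is below
  \<open>m / 2\<close>, then \<open>x\<close> and \<open>y\<close> differ by at least
  \<open>m / 2\<close> and a bound on the values suffices, so the estimate can compare a positive
  solution with one whose sign is unknown.\<close>

lemma ppow_lipschitz:
  assumes q: "q > 0" and m: "m > 0"
  shows "\<exists>L>0. \<forall>x y. m \<le> x \<longrightarrow> x \<le> M \<longrightarrow> y \<le> M \<longrightarrow> \<bar>ppow q x - ppow q y\<bar> \<le> L * \<bar>x - y\<bar>"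
proof -
  have "continuous_on {m/2..M} (\<lambda>t. q * t powr (q - 1))" using m by (intro continuous_intros) auto
  then have "bounded ((\<lambda>t. q * t powr (q - 1)) ` {m/2..M})"
    by (intro compact_imp_bounded compact_continuous_image) auto
  then obtain B where B: "B > 0" "\<And>t. m/2 \<le> t \<Longrightarrow> t \<le> M \<Longrightarrow> \<bar>q * t powr (q - 1)\<bar> \<le> B"
    by (force simp: bounded_pos)
  define L where "L = B + 2 * ppow q M / m"
  have pM: "ppow q M \<ge> 0" by simp
  have L: "L > 0" "B \<le> L" "2 * ppow q M / m \<le> L"
    using B(1) m pM by (auto simp: L_def intro!: add_pos_nonneg)
  show ?thesis
  proof (intro exI[of _ L] conjI L allI impI)
    fix x y assume x: "m \<le> x" "x \<le> M" and y: "y \<le> M"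
    show "\<bar>ppow q x - ppow q y\<bar> \<le> L * \<bar>x - y\<bar>"
    proof (cases "y \<ge> m / 2")
      case True
      have "norm (x powr q - y powr q) \<le> B * norm (x - y)"
      proof (rule field_differentiable_bound[where S="{m/2..M}" and f' = "\<lambda>t. q * t powr (q - 1)"])
        fix t assume t: "t \<in> {m/2..M}"
        then show "((\<lambda>t. t powr q) has_real_derivative q * t powr (q - 1)) (at t within {m/2..M})"
          using m by (auto intro!: derivative_eq_intros has_field_derivative_at_within[OF has_real_derivative_powr])
        show "norm (q * t powr (q - 1)) \<le> B" using B t by auto
      qed (use x y m True in auto)
      also have "B * norm (x - y) \<le> L * norm (x - y)" using L by (intro mult_right_mono) auto
      finally show ?thesis using x m True by (simp add: ppow_nonneg_eq)
    next
      case False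
      then have d: "\<bar>x - y\<bar> \<ge> m / 2" using x by linarith
      have "ppow q x \<le> ppow q M" "ppow q y \<le> ppow q M" using q x y by (auto intro!: ppow_mono)
      then have "\<bar>ppow q x - ppow q y\<bar> \<le> ppow q M"
        using ppow_nonneg[of q x] ppow_nonneg[of q y] by linarith
      also have "\<dots> = 2 * ppow q M / m * (m / 2)" using m by simp
      also have "\<dots> \<le> L * \<bar>x - y\<bar>" using L d m by (intro mult_mono) auto
      finally show ?thesis .
    qed
  qed
qed

section \<open>Radial solutions\<close>

lemma first_zero:
  fixes f :: "real \<Rightarrow> real"
  assumes f: "continuous_on {0..x} f" and f0: "f 0 > 0" and x: "0 \<le> x" "f x \<le> 0"
  obtains r where "0 < r" "r \<le> x" "f r = 0" "\<And>s. 0 \<le> s \<Longrightarrow> s < r \<Longrightarrow> f s > 0"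
proof -
  define S where "S = {0..x} \<inter> f -` {0}"
  have "closed S" unfolding S_def by (intro continuous_closed_preimage[OF f]) auto
  moreover have "bounded S" unfolding S_def by (rule bounded_subset[of "{0..x}"]) auto
  ultimately have "compact S" by (simp add: compact_eq_bounded_closed)
  moreover have "S \<noteq> {}" using IVT2'[of f x 0 0] f f0 x by (auto simp: S_def)
  ultimately obtain r where r: "r \<in> S" "\<And>s. s \<in> S \<Longrightarrow> r \<le> s"
    using compact_attains_inf[of S] by blast
  show thesis
  proof (rule that[of r])
    show "0 < r" using r(1) f0 by (cases "r = 0") (auto simp: S_def)
    fix s assume s: "0 \<le> s" "s < r"
    show "f s > 0"
    proof (rule ccontr)
      assume "\<not> f s > 0"
      moreover have "continuous_on {0..s} f" using s r(1) by (auto simp: S_def intro: continuous_on_subset[OF f])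
      ultimately obtain t where "0 \<le> t" "t \<le> s" "f t = 0" using IVT2'[of f s 0 0] f0 s by auto
      then show False using r(2)[of t] s r(1) by (auto simp: S_def)
    qed
  qed (use r(1) in \<open>auto simp: S_def\<close>)
qed

text \<open>Integral form of the radial system with zero slope at the origin. It absorbs the
  singular coefficient \<open>d / r\<close>, and the positive parts allow continuation beyond a
  zero.\<close>

definition radial_sol :: "nat \<Rightarrow> real \<Rightarrow> real \<Rightarrow> real \<Rightarrow> (real \<Rightarrow> real) \<Rightarrow> (real \<Rightarrow> real) \<Rightarrow> bool" where
  "radial_sol d p q T U V \<longleftrightarrow> continuous_on {0..T} U \<and> continuous_on {0..T} V \<and>
    (\<forall>r\<in>{0..T}. U r = U 0 - radial_int d (\<lambda>s. ppow q (V s)) r \<and> V r = V 0 - radial_int d (\<lambda>s. ppow p (U s)) r)"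

lemma radial_sol_swap: "radial_sol d p q T U V \<Longrightarrow> radial_sol d q p T V U"
  unfolding radial_sol_def by blast

lemma radial_sol_eq: "radial_sol d p q T U V \<Longrightarrow> 0 \<le> r \<Longrightarrow> r \<le> T \<Longrightarrow> U r = U 0 - radial_int d (\<lambda>s. ppow q (V s)) r"
  unfolding radial_sol_def by (meson atLeastAtMost_iff)

lemma continuous_on_radial_sol:
  assumes "radial_sol d p q T U V" "T' \<le> T"
  shows "continuous_on {0..T'} U" "continuous_on {0..T'} V"
proof -
  have "{0..T'} \<subseteq> {0..T}" using assms by auto
  then show "continuous_on {0..T'} U" "continuous_on {0..T'} V"
    using assms unfolding radial_sol_def by (blast intro: continuous_on_subset)+
qed

lemma radial_solI:
  assumes "continuous_on {0..T} U" "continuous_on {0..T} V"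
    "\<And>r. 0 \<le> r \<Longrightarrow> r \<le> T \<Longrightarrow> U r = U 0 - radial_int d (\<lambda>s. ppow q (V s)) r"
    "\<And>r. 0 \<le> r \<Longrightarrow> r \<le> T \<Longrightarrow> V r = V 0 - radial_int d (\<lambda>s. ppow p (U s)) r"
  shows "radial_sol d p q T U V"
  unfolding radial_sol_def using assms by (meson atLeastAtMost_iff)

lemma radial_sol_subset:
  assumes "radial_sol d p q T U V" "T' \<le> T"
  shows "radial_sol d p q T' U V"
  by (rule radial_solI[OF continuous_on_radial_sol[OF assms]])
     (rule radial_sol_eq[OF assms(1)] radial_sol_eq[OF radial_sol_swap[OF assms(1)]]; use assms(2) in linarith)+

lemma radial_sol_continuous:
  assumes "radial_sol d p q T U V" "q > 0"
  shows "continuous_on {0..T} (\<lambda>s. ppow q (V s))"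
  by (intro continuous_on_ppow continuous_on_radial_sol[OF assms(1)] assms order_refl)

lemma radial_sol_derivative:
  assumes s: "radial_sol d p q T U V" and q: "q > 0" and r: "0 < r" "r < T"
  shows "(U has_real_derivative - (r * ball_avg d (\<lambda>s. ppow q (V s)) r)) (at r)"
proof -
  have "((\<lambda>r. U 0 - radial_int d (\<lambda>s. ppow q (V s)) r) has_real_derivative 0 - (r * ball_avg d (\<lambda>s. ppow q (V s)) r)) (at r)"
    by (intro DERIV_diff DERIV_const radial_int_derivative[OF radial_sol_continuous[OF s q] r])
  then have "((\<lambda>r. U 0 - radial_int d (\<lambda>s. ppow q (V s)) r) has_real_derivative - (r * ball_avg d (\<lambda>s. ppow q (V s)) r)) (at r)"
    by simp
  then show ?thesis
  proof (rule has_field_derivative_transform_within_open[of _ _ _ "{0<..<T}"])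
    fix x assume "x \<in> {0<..<T}"
    then show "U 0 - radial_int d (\<lambda>s. ppow q (V s)) x = U x"
      by (intro radial_sol_eq[OF s, symmetric]) auto
  qed (use r in auto)
qed

lemma radial_sol_antimono:
  assumes s: "radial_sol d p q T U V" and q: "q > 0" and r: "0 \<le> r" "r \<le> r'" "r' \<le> T"
  shows "U r' \<le> U r"
  using radial_int_increasing[of r' "\<lambda>s. ppow q (V s)" r d] r
    continuous_on_subset[OF radial_sol_continuous[OF s q], of "{0..r'}"]
    radial_sol_eq[OF s, of r] radial_sol_eq[OF s, of r']
  by simp

lemma radial_sol_strict_antimono:
  assumes s: "radial_sol d p q T U V" and q: "q > 0" and r: "0 \<le> r" "r < r'" "r' \<le> T" and V: "V 0 > 0"
  shows "U r' < U r"
  using radial_int_strict_increasing[of r' "\<lambda>s. ppow q (V s)" r d] r V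
    continuous_on_subset[OF radial_sol_continuous[OF s q], of "{0..r'}"]
    radial_sol_eq[OF s, of r] radial_sol_eq[OF s, of r']
  by (simp add: ppow_pos)

text \<open>A larger \<open>V\<close> makes \<open>U\<close> smaller, which in turn makes
  \<open>V\<close> decrease more slowly, so the initial gap in \<open>V\<close> never shrinks and a
  first contact is impossible.\<close>

lemma radial_sol_comparison:
  assumes s1: "radial_sol d p q T U1 V1" and s2: "radial_sol d p q T U2 V2" and pq: "p > 0" "q > 0"
    and U0: "U1 0 = U2 0" and V0: "V2 0 < V1 0" and r: "0 \<le> r" "r \<le> T"
  shows "V2 r < V1 r \<and> U1 r \<le> U2 r"
proof -
  have U: "U1 t \<le> U2 t" if t: "0 \<le> t" "t \<le> T" "\<And>s. 0 \<le> s \<Longrightarrow> s \<le> t \<Longrightarrow> V2 s \<le> V1 s" for t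
  proof -
    have "radial_int d (\<lambda>s. ppow q (V2 s)) t \<le> radial_int d (\<lambda>s. ppow q (V1 s)) t"
      using t pq by (intro radial_int_mono continuous_on_subset[OF radial_sol_continuous[OF s1]]
          continuous_on_subset[OF radial_sol_continuous[OF s2]] ppow_mono) auto
    then show ?thesis using radial_sol_eq[OF s1 t(1,2)] radial_sol_eq[OF s2 t(1,2)] U0 by simp
  qed
  have V: "V2 r < V1 r" if r: "0 \<le> r" "r \<le> T" for r
  proof (rule ccontr)
    assume neg: "\<not> V2 r < V1 r"
    have "continuous_on {0..r} (\<lambda>t. V1 t - V2 t)"
      using r by (intro continuous_intros continuous_on_radial_sol[OF s1] continuous_on_radial_sol[OF s2]) auto
    then obtain t where t: "0 < t" "t \<le> r" "V1 t - V2 t = 0" "\<And>s. 0 \<le> s \<Longrightarrow> s < t \<Longrightarrow> V1 s - V2 s > 0"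
      using first_zero[of r "\<lambda>t. V1 t - V2 t"] V0 neg r by auto
    have le: "V2 s \<le> V1 s" if "0 \<le> s" "s \<le> t" for s
      using t(3) t(4)[of s] that by (cases "s = t") auto
    have "radial_int d (\<lambda>s. ppow p (U1 s)) t \<le> radial_int d (\<lambda>s. ppow p (U2 s)) t"
    proof (rule radial_int_mono)
      fix s assume "s \<in> {0..t}"
      then show "ppow p (U1 s) \<le> ppow p (U2 s)" using t r le pq by (intro ppow_mono U) auto
    qed (use t r pq in \<open>auto intro: continuous_on_subset[OF radial_sol_continuous[OF radial_sol_swap[OF s1]]]
          continuous_on_subset[OF radial_sol_continuous[OF radial_sol_swap[OF s2]]]\<close>)
    moreover have "0 \<le> t" "t \<le> T" using t r by auto
    ultimately show False
      using radial_sol_eq[OF radial_sol_swap[OF s1], of t] radial_sol_eq[OF radial_sol_swap[OF s2], of t] V0 t(3)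
      by linarith
  qed
  show ?thesis using V[OF r] U[OF r] V r by (meson less_imp_le order_trans)
qed

section \<open>Uniqueness for the initial value problem\<close>

lemma radial_int_diff_le:
  assumes f: "continuous_on {0..r} f" and g: "continuous_on {0..r} g" and h: "continuous_on {0..r} h"
    and le: "\<And>x. x \<in> {0..r} \<Longrightarrow> \<bar>f x - g x\<bar> \<le> h x"
  shows "\<bar>radial_int d f r - radial_int d g r\<bar> \<le> radial_int d h r"
proof -
  have "radial_int d f r \<le> radial_int d (\<lambda>x. g x + h x) r"
    by (rule radial_int_mono[OF f continuous_on_add[OF g h]]) (use le in force)
  moreover have "radial_int d g r \<le> radial_int d (\<lambda>x. f x + h x) r"
    by (rule radial_int_mono[OF g continuous_on_add[OF f h]]) (use le in force)
  ultimately show ?thesis using radial_int_add[OF g h, of d] radial_int_add[OF f h, of d] by linarith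
qed

lemma radial_int_exp_le:
  assumes l: "l > 0" and C: "C \<ge> 0" and r: "0 \<le> r"
  shows "radial_int d (\<lambda>s. C * exp (l * s)) r \<le> r * C / l * exp (l * r)"
proof -
  have "radial_int d (\<lambda>s. C * exp (l * s)) r \<le> integral {0..r} (\<lambda>s. r * C * exp (l * s))"
    unfolding radial_int_def
  proof (intro integral_le integrable_continuous_real)
    show "continuous_on {0..r} (\<lambda>s. s * ball_avg d (\<lambda>s. C * exp (l * s)) s)"
      by (intro radial_int_integrand continuous_intros)
    show "continuous_on {0..r} (\<lambda>s. r * C * exp (l * s))" by (intro continuous_intros)
    fix s assume s: "s \<in> {0..r}"
    have "ball_avg d (\<lambda>s. C * exp (l * s)) s \<le> C * exp (l * s) / (real d + 1)"
      using s l C by (intro ball_avg_le continuous_intros) (auto intro!: mult_left_mono)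
    also have "\<dots> \<le> C * exp (l * s)" using C by (simp add: field_simps)
    finally have "s * ball_avg d (\<lambda>s. C * exp (l * s)) s \<le> s * (C * exp (l * s))" using s by (intro mult_left_mono) auto
    also have "\<dots> \<le> r * (C * exp (l * s))" using s C by (intro mult_right_mono) auto
    finally show "s * ball_avg d (\<lambda>s. C * exp (l * s)) s \<le> r * C * exp (l * s)" by simp
  qed
  also have "((\<lambda>s. r * C * exp (l * s)) has_integral (r * C / l * exp (l * r) - r * C / l * exp (l * 0))) {0..r}"
    by (rule fundamental_theorem_of_calculus)
       (use r l in \<open>auto intro!: derivative_eq_intros simp flip: has_real_derivative_iff_has_vector_derivative\<close>)
  from integral_unique[OF this]
  have "integral {0..r} (\<lambda>s. r * C * exp (l * s)) \<le> r * C / l * exp (l * r)" using r C l by simp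
  finally show ?thesis .
qed

text \<open>A contraction argument in the supremum norm weighted by \<open>exp (- (l * r))\<close>.
  By monotonicity, positivity of the first solution at \<open>T\<close> bounds it away from zero on
  the whole interval, which is what the Lipschitz estimate asks for.\<close>

lemma radial_sol_unique:
  assumes s1: "radial_sol d p q T U1 V1" and s2: "radial_sol d p q T U2 V2" and pq: "p > 0" "q > 0"
    and init: "U1 0 = U2 0" "V1 0 = V2 0" and pos: "U1 T > 0" "V1 T > 0" and T: "0 \<le> T" and r: "r \<in> {0..T}"
  shows "U1 r = U2 r \<and> V1 r = V2 r"
proof -
  note anti = radial_sol_antimono[OF s1 pq(2)] radial_sol_antimono[OF radial_sol_swap[OF s1] pq(1)]
    radial_sol_antimono[OF s2 pq(2)] radial_sol_antimono[OF radial_sol_swap[OF s2] pq(1)]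
  obtain L1 where L1: "L1 > 0" "\<And>x y. V1 T \<le> x \<Longrightarrow> x \<le> V1 0 \<Longrightarrow> y \<le> V1 0 \<Longrightarrow> \<bar>ppow q x - ppow q y\<bar> \<le> L1 * \<bar>x - y\<bar>"
    using ppow_lipschitz[OF pq(2) pos(2)] by blast
  obtain L2 where L2: "L2 > 0" "\<And>x y. U1 T \<le> x \<Longrightarrow> x \<le> U1 0 \<Longrightarrow> y \<le> U1 0 \<Longrightarrow> \<bar>ppow p x - ppow p y\<bar> \<le> L2 * \<bar>x - y\<bar>"
    using ppow_lipschitz[OF pq(1) pos(1)] by blast
  define L where "L = max L1 L2"
  have L: "L > 0" "L1 \<le> L" "L2 \<le> L" using L1 L2 by (auto simp: L_def)
  \<comment> \<open>The weight makes the integral operator contract by a factor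
    \<open>T * L / l\<close>, which is at most one half.\<close>
  define l where "l = 2 * T * L + 1"
  have l: "l > 0" using T L by (simp add: l_def add_nonneg_pos)
  define D where "D r = max \<bar>U1 r - U2 r\<bar> \<bar>V1 r - V2 r\<bar>" for r
  have "continuous_on {0..T} (\<lambda>r. D r * exp (- (l * r)))"
    unfolding D_def
    by (intro continuous_intros continuous_on_radial_sol[OF s1] continuous_on_radial_sol[OF s2] order_refl)
  then obtain x where x: "x \<in> {0..T}" "\<And>y. y \<in> {0..T} \<Longrightarrow> D y * exp (- (l * y)) \<le> D x * exp (- (l * x))"
    using continuous_attains_sup[of "{0..T}" "\<lambda>r. D r * exp (- (l * r))"] T by auto
  define A where "A = D x * exp (- (l * x))"
  have D0: "0 \<le> D r" for r by (simp add: D_def)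
  have A0: "0 \<le> A" using D0 by (simp add: A_def)
  have DA: "D y \<le> A * exp (l * y)" if "y \<in> {0..T}" for y
    using x(2)[OF that] unfolding A_def[symmetric] by (simp add: exp_minus field_simps)
  have half: "\<bar>radial_int d f x - radial_int d g x\<bar> \<le> A * exp (l * x) / 2"
    if "continuous_on {0..T} f" "continuous_on {0..T} g" "\<And>y. y \<in> {0..T} \<Longrightarrow> \<bar>f y - g y\<bar> \<le> L * D y" for f g
  proof -
    have "\<bar>radial_int d f x - radial_int d g x\<bar> \<le> radial_int d (\<lambda>s. (L * A) * exp (l * s)) x"
    proof (rule radial_int_diff_le)
      fix y assume "y \<in> {0..x}"
      then have y: "y \<in> {0..T}" using x by auto
      have "L * D y \<le> L * (A * exp (l * y))" using L DA[OF y] by (intro mult_left_mono) auto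
      then show "\<bar>f y - g y\<bar> \<le> L * A * exp (l * y)" using that(3)[OF y] by (simp add: mult.assoc)
    qed (use x that in \<open>auto intro: continuous_on_subset intro!: continuous_intros\<close>)
    also have "\<dots> \<le> x * (L * A) / l * exp (l * x)"
      using l L A0 x by (intro radial_int_exp_le) auto
    also have "\<dots> = (x * L / l) * (A * exp (l * x))" by simp
    also have "\<dots> \<le> (1 / 2) * (A * exp (l * x))"
    proof (rule mult_right_mono)
      have "2 * (x * L) \<le> 2 * (T * L)" using x L by simp
      then show "x * L / l \<le> 1 / 2" using l by (simp add: l_def field_simps)
    qed (use A0 in auto)
    finally show ?thesis by simp
  qed
  have xT: "0 \<le> x" "x \<le> T" using x by auto
  have "\<bar>U1 x - U2 x\<bar> \<le> A * exp (l * x) / 2"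
  proof -
    have "\<bar>radial_int d (\<lambda>s. ppow q (V1 s)) x - radial_int d (\<lambda>s. ppow q (V2 s)) x\<bar> \<le> A * exp (l * x) / 2"
    proof (rule half)
      fix y assume y: "y \<in> {0..T}"
      have "\<bar>ppow q (V1 y) - ppow q (V2 y)\<bar> \<le> L1 * \<bar>V1 y - V2 y\<bar>"
        using y init anti(2)[of y T] anti(2)[of 0 y] anti(4)[of 0 y] by (intro L1(2)) auto
      also have "\<dots> \<le> L * D y" using L1(1) L by (intro mult_mono) (auto simp: D_def)
      finally show "\<bar>ppow q (V1 y) - ppow q (V2 y)\<bar> \<le> L * D y" .
    qed (use s1 s2 pq radial_sol_continuous in auto)
    then show ?thesis using radial_sol_eq[OF s1 xT] radial_sol_eq[OF s2 xT] init by linarith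
  qed
  moreover have "\<bar>V1 x - V2 x\<bar> \<le> A * exp (l * x) / 2"
  proof -
    have "\<bar>radial_int d (\<lambda>s. ppow p (U1 s)) x - radial_int d (\<lambda>s. ppow p (U2 s)) x\<bar> \<le> A * exp (l * x) / 2"
    proof (rule half)
      fix y assume y: "y \<in> {0..T}"
      have "\<bar>ppow p (U1 y) - ppow p (U2 y)\<bar> \<le> L2 * \<bar>U1 y - U2 y\<bar>"
        using y init anti(1)[of y T] anti(1)[of 0 y] anti(3)[of 0 y] by (intro L2(2)) auto
      also have "\<dots> \<le> L * D y" using L2(1) L by (intro mult_mono) (auto simp: D_def)
      finally show "\<bar>ppow p (U1 y) - ppow p (U2 y)\<bar> \<le> L * D y" .
    qed (use s1 s2 pq radial_sol_continuous radial_sol_swap in blast)+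
    then show ?thesis using radial_sol_eq[OF radial_sol_swap[OF s1] xT] radial_sol_eq[OF radial_sol_swap[OF s2] xT] init by linarith
  qed
  ultimately have "D x \<le> A * exp (l * x) / 2" by (simp add: D_def)
  then have "D x * exp (- (l * x)) \<le> A * exp (l * x) / 2 * exp (- (l * x))" by (rule mult_right_mono) simp
  also have "\<dots> = A / 2" by (simp add: exp_minus)
  finally have "A \<le> A / 2" by (simp add: A_def)
  then have "A = 0" using A0 by simp
  then have "D r \<le> 0" using DA[OF r] by simp
  then show ?thesis by (simp add: D_def)
qed

text \<open>Serves both limits taken later: the monotone iteration at a fixed initial value, and a
  monotone sequence of initial values. The limit inherits continuity from its integral equation
  rather than from the mode of convergence.\<close>

lemma radial_relation_limit:
  assumes q: "q > 0" and V: "\<And>n. continuous_on {0..T} (V n)" "\<And>n s. s \<in> {0..T} \<Longrightarrow> V n s \<le> M"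
    and lim: "\<And>s. s \<in> {0..T} \<Longrightarrow> (\<lambda>n. V n s) \<longlonglongrightarrow> V' s"
    and U: "\<And>n r. r \<in> {0..T} \<Longrightarrow> U n r = a n - radial_int d (\<lambda>s. ppow q (V n s)) r"
    and limU: "\<And>r. r \<in> {0..T} \<Longrightarrow> (\<lambda>n. U n r) \<longlonglongrightarrow> U' r" and a: "a \<longlonglongrightarrow> a'"
  shows "\<And>r. r \<in> {0..T} \<Longrightarrow> U' r = a' - radial_int d (\<lambda>s. ppow q (V' s)) r"
    and "continuous_on {0..T} U'"
proof -
  have cont: "isCont (ppow q) x" for x
    using continuous_on_ppow[OF q continuous_on_id, of UNIV] by (simp add: continuous_on_eq_continuous_at)
  have bd: "\<bar>ppow q (V n s)\<bar> \<le> ppow q M" if "s \<in> {0..T}" for n s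
    using ppow_mono[OF q V(2)[OF that]] by simp
  have limp: "(\<lambda>n. ppow q (V n s)) \<longlonglongrightarrow> ppow q (V' s)" if "s \<in> {0..T}" for s
    by (rule isCont_tendsto_compose[OF cont lim[OF that]])
  note conv = radial_int_convergent[of _ "\<lambda>n s. ppow q (V n s)" "ppow q M" "\<lambda>s. ppow q (V' s)" d]
  show eq: "U' r = a' - radial_int d (\<lambda>s. ppow q (V' s)) r" if r: "r \<in> {0..T}" for r
  proof -
    have "(\<lambda>n. radial_int d (\<lambda>s. ppow q (V n s)) r) \<longlonglongrightarrow> radial_int d (\<lambda>s. ppow q (V' s)) r"
      by (rule conv(1)) (use r q bd limp in \<open>auto intro!: continuous_on_ppow continuous_on_subset[OF V(1)]\<close>)
    then have "(\<lambda>n. a n - radial_int d (\<lambda>s. ppow q (V n s)) r) \<longlonglongrightarrow> a' - radial_int d (\<lambda>s. ppow q (V' s)) r"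
      by (intro tendsto_diff a)
    then have "(\<lambda>n. U n r) \<longlonglongrightarrow> a' - radial_int d (\<lambda>s. ppow q (V' s)) r"
      using U[OF r] by simp
    then show ?thesis using limU[OF r] LIMSEQ_unique by blast
  qed
  have "(\<lambda>s. s * ball_avg d (\<lambda>s. ppow q (V' s)) s) integrable_on {0..T}"
    by (rule conv(2)) (use q bd limp V(1) in \<open>auto intro!: continuous_on_ppow\<close>)
  then have "continuous_on {0..T} (radial_int d (\<lambda>s. ppow q (V' s)))"
    unfolding radial_int_def[abs_def] by (rule indefinite_integral_continuous_1)
  then have "continuous_on {0..T} (\<lambda>r. a' - radial_int d (\<lambda>s. ppow q (V' s)) r)"
    by (intro continuous_intros)
  then show "continuous_on {0..T} U'" by (rule continuous_on_eq) (use eq in auto)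
qed

section \<open>Nonexistence of entire solutions\<close>

text \<open>A derivative below \<open>- c / r\<close> pulls \<open>U\<close> down logarithmically,
  hence to zero at a finite radius.\<close>

lemma no_log_decay:
  fixes U :: "real \<Rightarrow> real"
  assumes D: "\<And>r. r > 0 \<Longrightarrow> (U has_real_derivative - P r) (at r)" and pos: "\<And>r. r > 0 \<Longrightarrow> U r > 0"
    and P: "\<And>r. r \<ge> a \<Longrightarrow> c \<le> r * P r" and ca: "c > 0" "a > 0"
  shows False
proof -
  \<comment> \<open>The radius at which the logarithmic upper bound for \<open>U\<close> reaches
    zero.\<close>
  define b where "b = a * exp (U a / c)"
  have b: "a \<le> b" using pos[OF ca(2)] ca by (simp add: b_def)
  have "U b + c * ln b \<le> U a + c * ln a"
  proof (rule DERIV_nonpos_imp_nonincreasing[OF b])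
    fix r assume r: "a \<le> r" "r \<le> b"
    have "((\<lambda>r. U r + c * ln r) has_real_derivative - P r + c * (1 / r)) (at r)"
      using r ca by (intro DERIV_add DERIV_cmult D DERIV_ln_divide) auto
    moreover have "- P r + c * (1 / r) \<le> 0" using P[OF r(1)] r ca by (simp add: field_simps)
    ultimately show "\<exists>y. ((\<lambda>r. U r + c * ln r) has_real_derivative y) (at r) \<and> y \<le> 0" by blast
  qed
  moreover have "c * ln b = c * ln a + U a" using ca by (simp add: b_def ln_mult field_simps)
  ultimately have "U b \<le> 0" by simp
  then show False using pos[of b] b ca by simp
qed

text \<open>An entire positive solution satisfies \<open>r |U'| \<le> (N - 2) U\<close>. Since \<open>r\<^sup>2 V\<^sup>q / N \<le> r |U'|\<close>, this
  yields \<open>r\<^sup>2 V\<^sup>q \<le> N (N - 2) U\<close> at every \<open>r\<close>, which together with the symmetric bound gives both the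
  sharp decay and, in the Pohozaev identity, the sign contradiction in the subcritical range.\<close>

locale entire_solution =
  fixes d :: nat and p q :: real and U V :: "real \<Rightarrow> real"
  assumes params: "p > 0" "q > 0"
    and sol: "\<And>T. radial_sol d p q T U V"
    and pos: "\<And>r. r \<ge> 0 \<Longrightarrow> U r > 0" "\<And>r. r \<ge> 0 \<Longrightarrow> V r > 0"
begin

lemma swap: "entire_solution d q p V U"
  using params radial_sol_swap[OF sol] pos by unfold_locales auto

definition "W r = ball_avg d (\<lambda>s. ppow q (V s)) r"

lemma cont: "continuous_on {0..T} (\<lambda>s. ppow q (V s))"
  by (rule radial_sol_continuous[OF sol params(2)])

lemma antimono: "0 \<le> r \<Longrightarrow> r \<le> s \<Longrightarrow> V s \<le> V r"
  using radial_sol_antimono[OF radial_sol_swap[OF sol] params(1), of r s s] by simp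

lemma U_deriv: "r > 0 \<Longrightarrow> (U has_real_derivative - (r * W r)) (at r)"
  using radial_sol_derivative[OF sol params(2), of r "r + 1"] by (simp add: W_def)

lemma W_deriv: "r > 0 \<Longrightarrow> ((\<lambda>r. r ^ Suc d * W r) has_real_derivative r ^ d * V r powr q) (at r)"
  using ball_avg_weighted_derivative[OF cont[of "r + 1"], of r d] pos(2)[of r]
  by (simp add: W_def ppow_nonneg_eq del: power_Suc)

lemma W_deriv2: "r > 0 \<Longrightarrow> (W has_real_derivative (V r powr q - (real d + 1) * W r) / r) (at r)"
  using ball_avg_derivative[OF cont[of "r + 1"], of r d] pos(2)[of r]
  by (simp add: W_def[abs_def] ppow_nonneg_eq)

lemma W_pos: "r \<ge> 0 \<Longrightarrow> W r > 0"
  unfolding W_def using pos by (intro ball_avg_pos cont) (auto simp: ppow_pos)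

lemma W_ge: "r \<ge> 0 \<Longrightarrow> V r powr q / (real d + 1) \<le> W r"
  unfolding W_def
proof (rule ball_avg_ge[OF cont])
  fix x assume r: "r \<ge> 0" and x: "x \<in> {0..r}"
  then show "V r powr q \<le> ppow q (V x)"
    using ppow_mono[OF params(2) antimono[of x r]] pos(2)[of r] by (simp add: ppow_nonneg_eq)
qed auto

text \<open>Here \<open>d = N - 1\<close>, so dimensions one and two are excluded. For
  \<open>d \<le> 1\<close> the nondecreasing quantity \<open>r ^ Suc d * W r\<close> keeps
  \<open>r * (r * W r)\<close> bounded below, and \<open>U\<close> would decay at least
  logarithmically.\<close>

lemma dimension_ge: "d \<ge> 2"
proof (rule ccontr)
  assume "\<not> d \<ge> 2"
  then have d: "d \<le> 1" by simp
  show False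
  proof (rule no_log_decay[where U = U and P = "\<lambda>r. r * W r" and a = 1 and c = "W 1"])
    fix r :: real assume r: "1 \<le> r"
    have "1 ^ Suc d * W 1 \<le> r ^ Suc d * W r"
    proof (rule DERIV_nonneg_imp_nondecreasing[OF r])
      fix x assume "1 \<le> x" "x \<le> r"
      then show "\<exists>y. ((\<lambda>r. r ^ Suc d * W r) has_real_derivative y) (at x) \<and> 0 \<le> y"
        using W_deriv[of x] by (intro exI[of _ "x ^ d * V x powr q"]) auto
    qed
    also have "r ^ Suc d \<le> r ^ 2" using r d by (intro power_increasing) auto
    then have "r ^ Suc d * W r \<le> r ^ 2 * W r" using W_pos[of r] r by (intro mult_right_mono) auto
    finally show "W 1 \<le> r * (r * W r)" by (simp add: power2_eq_square)
  qed (use W_pos[of 1] pos U_deriv in auto)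
qed

text \<open>The difference \<open>G\<close> of the two sides has derivative
  \<open>- (r * V r powr q)\<close>, so once negative it stays below a negative constant; then
  \<open>U\<close> would again decay logarithmically and lose positivity.\<close>

lemma slope_bound:
  assumes r: "r > 0"
  shows "r * (r * W r) \<le> (real d - 1) * U r"
proof (rule ccontr)
  assume neg: "\<not> r * (r * W r) \<le> (real d - 1) * U r"
  define G where "G r = (real d - 1) * U r - r * (r * W r)" for r
  have d: "real d - 1 \<ge> 0" using dimension_ge by simp
  have G: "G s \<le> G r" if "r \<le> s" for s
  proof (rule DERIV_nonpos_imp_nonincreasing[OF that])
    fix x assume x: "r \<le> x" "x \<le> s"
    then have x0: "x > 0" using r by simp
    have "(G has_real_derivative - (x * V x powr q)) (at x)"
      unfolding G_def[abs_def] using x0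
      by (auto intro!: derivative_eq_intros U_deriv W_deriv2 simp: field_simps)
    then show "\<exists>y. (G has_real_derivative y) (at x) \<and> y \<le> 0"
      using x0 by (intro exI[of _ "- (x * V x powr q)"]) auto
  qed
  show False
  proof (rule no_log_decay[where U = U and P = "\<lambda>r. r * W r" and a = r and c = "- G r"])
    fix s assume s: "r \<le> s"
    have "0 \<le> (real d - 1) * U s" using d pos(1)[of s] r s by simp
    then show "- G r \<le> s * (s * W s)" using G[OF s] by (simp add: G_def)
  qed (use neg r pos U_deriv in \<open>auto simp: G_def\<close>)
qed

lemma log_bound:
  assumes r: "r > 0"
  shows "2 * ln r + q * ln (V r) \<le> ln ((real d + 1) * (real d - 1)) + ln (U r)"
proof -
  have d: "real d - 1 > 0" using dimension_ge by simp
  have "r * r * (V r powr q / (real d + 1)) \<le> r * r * W r" using W_ge[of r] r by (intro mult_left_mono) auto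
  also have "\<dots> \<le> (real d - 1) * U r" using slope_bound[OF r] by (simp add: mult.assoc)
  finally have "r * r * V r powr q \<le> (real d + 1) * (real d - 1) * U r" by (simp add: field_simps)
  moreover have "0 < r * r * V r powr q" using r pos(2)[of r] by simp
  ultimately have "ln (r * r * V r powr q) \<le> ln ((real d + 1) * (real d - 1) * U r)" by simp
  then show ?thesis using r pos[of r] d by (simp add: ln_mult ln_powr)
qed

end

context entire_solution
begin

interpretation sw: entire_solution d q p V U by (rule swap)

text \<open>Weighting the two logarithmic bounds by \<open>p + 1\<close> and \<open>q + 1\<close>
  makes the coefficients of \<open>ln (U r)\<close> and \<open>ln (V r)\<close> equal, both being
  \<open>p * q - 1\<close>.\<close>

lemma product_log_bound:
  assumes r: "r > 0"
  shows "2 * (p + q + 2) * ln r + (p * q - 1) * ln (U r * V r) \<le> (p + q + 2) * ln ((real d + 1) * (real d - 1))"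
proof -
  define K where "K = ln ((real d + 1) * (real d - 1))"
  have "(p + 1) * (2 * ln r + q * ln (V r)) \<le> (p + 1) * (K + ln (U r))"
    using log_bound[OF r] params by (intro mult_left_mono) (auto simp: K_def)
  moreover have "(q + 1) * (2 * ln r + p * ln (U r)) \<le> (q + 1) * (K + ln (V r))"
    using sw.log_bound[OF r] params by (intro mult_left_mono) (auto simp: K_def)
  moreover have "ln (U r * V r) = ln (U r) + ln (V r)" using pos[of r] r by (simp add: ln_mult)
  ultimately show ?thesis unfolding K_def[symmetric] by (simp add: algebra_simps)
qed

text \<open>Below the hyperbola the Pohozaev functional \<open>E\<close> increases strictly from
  zero, so beyond radius one it is at least a positive constant; the slope bounds turn this into a
  lower bound for the product of \<open>U\<close> and \<open>V\<close>.\<close>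

lemma pohozaev:
  assumes sub: "(real d + 1) / (p + 1) + (real d + 1) / (q + 1) > real d - 1"
  shows "\<exists>k>0. \<forall>r\<ge>1. k \<le> r ^ (d - 1) * (U r * V r)"
proof -
  define S where "S = 1 / (p + 1) + 1 / (q + 1)"
  define n where "n = real d - 1"
  have n: "n > 0" using dimension_ge by (simp add: n_def)
  have S: "S > 0" using params by (simp add: S_def add_pos_pos)
  have sub': "n < (n + 2) * S" using sub by (simp add: S_def n_def distrib_left add.commute)
  \<comment> \<open>The number \<open>n = N - 2\<close> is split in proportion to
    \<open>1 / (q + 1)\<close> and \<open>1 / (p + 1)\<close>. As \<open>n + 2 = N\<close>, the
    hypothesis \<open>sub\<close> puts \<open>a\<close> strictly below \<open>N / (q + 1)\<close>
    and \<open>b\<close> strictly below \<open>N / (p + 1)\<close>.\<close>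
  define a where "a = n / S / (q + 1)"
  define b where "b = n / S / (p + 1)"
  have ab: "a \<ge> 0" "b \<ge> 0" using n S params by (auto simp: a_def b_def)
  have sum: "a + b = n"
  proof -
    have "a + b = n / S * S" unfolding a_def b_def S_def by (simp add: distrib_left)
    then show ?thesis using S by simp
  qed
  have nS: "n / S < n + 2" using sub' S by (simp add: field_simps)
  have a: "a < (n + 2) / (q + 1)" unfolding a_def using nS params by (intro divide_strict_right_mono) auto
  have b: "b < (n + 2) / (p + 1)" unfolding b_def using nS params by (intro divide_strict_right_mono) auto
  define F where "F r = V r * V r powr q / (q + 1) + U r * U r powr p / (p + 1)" for r
  \<comment> \<open>With \<open>U' = - r W\<close> and the analogous formula for \<open>V'\<close>
    this is \<open>r^N (U' V' + F) + r^(N-1) (a U' V + b U V')\<close>.\<close>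
  define E where "E r = (r ^ Suc d * W r) * (r * (r * sw.W r)) + r ^ Suc d * F r
     - a * ((r ^ Suc d * W r) * V r) - b * (U r * (r ^ Suc d * sw.W r))" for r
  define E' where "E' r = r ^ d * (((n + 2) / (q + 1) - a) * (V r * V r powr q) + ((n + 2) / (p + 1) - b) * (U r * U r powr p))" for r
  have powr_deriv: "((\<lambda>r. f r * f r powr t) has_real_derivative (t + 1) * f r powr t * f') (at r)"
    if "(f has_real_derivative f') (at r)" "f r > 0" for f :: "real \<Rightarrow> real" and f' t r
    using that by (auto intro!: derivative_eq_intros simp: powr_diff field_simps)
  have F_deriv: "(F has_real_derivative V r powr q * (- (r * sw.W r)) + U r powr p * (- (r * W r))) (at r)" if r: "r > 0" for r
  proof -
    have "(F has_real_derivative ((q + 1) * V r powr q * (- (r * sw.W r))) / (q + 1) + ((p + 1) * U r powr p * (- (r * W r))) / (p + 1)) (at r)"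
      unfolding F_def[abs_def] using r pos
      by (intro DERIV_add DERIV_cdivide powr_deriv U_deriv sw.U_deriv) auto
    then show ?thesis using params by simp
  qed
  have E_deriv: "(E has_real_derivative E' r) (at r)" if r: "r > 0" for r
  proof -
    have 1: "((\<lambda>r. r * (r * sw.W r)) has_real_derivative (1 - real d) * (r * sw.W r) + r * U r powr p) (at r)"
      using r by (auto intro!: derivative_eq_intros sw.W_deriv2 simp: field_simps)
    have 2: "((\<lambda>r. r ^ Suc d) has_real_derivative (real d + 1) * r ^ d) (at r)"
      using DERIV_pow[of "Suc d" r UNIV] by (simp add: add.commute)
    have "(E has_real_derivative
      (r ^ d * V r powr q * (r * (r * sw.W r)) + ((1 - real d) * (r * sw.W r) + r * U r powr p) * (r ^ Suc d * W r))
      + ((real d + 1) * r ^ d * F r + (V r powr q * (- (r * sw.W r)) + U r powr p * (- (r * W r))) * r ^ Suc d)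
      - a * (r ^ d * V r powr q * V r + - (r * sw.W r) * (r ^ Suc d * W r))
      - b * (- (r * W r) * (r ^ Suc d * sw.W r) + r ^ d * U r powr p * U r)) (at r)" (is "(E has_real_derivative ?D) _")
      unfolding E_def[abs_def] using r
      by (intro DERIV_add DERIV_diff DERIV_cmult DERIV_mult 1 2 W_deriv sw.W_deriv U_deriv sw.U_deriv F_deriv)
    \<comment> \<open>The mixed gradient terms carry the coefficient \<open>a + b - n\<close>, which
      is zero by the choice of \<open>a\<close> and \<open>b\<close>.\<close>
    moreover have "?D = E' r + (a + b - n) * (r ^ Suc d * W r * (r * sw.W r))"
      unfolding E'_def F_def n_def by (simp add: field_simps)
    ultimately show ?thesis by (simp add: sum)
  qed
  have E'_pos: "E' r > 0" if "r > 0" for r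
    unfolding E'_def using that a b pos[of r] by (intro mult_pos_pos add_pos_pos) auto
  have E_cont: "continuous_on {0..1} E"
  proof -
    have cW: "continuous_on {0..1} W" "continuous_on {0..1} sw.W"
      unfolding W_def[abs_def] sw.W_def[abs_def] by (intro continuous_on_ball_avg cont sw.cont)+
    have cU: "continuous_on {0..1} U" "continuous_on {0..1} V"
      using continuous_on_radial_sol[OF sol order_refl] by blast+
    have cP: "continuous_on {0..1} (\<lambda>r. U r powr p)" "continuous_on {0..1} (\<lambda>r. V r powr q)"
      using pos by (intro continuous_on_powr cU continuous_on_const; force)+
    show ?thesis unfolding E_def[abs_def] F_def[abs_def] using params
      by (intro continuous_intros cW cU cP) auto
  qed
  have "E 0 < E 1"
    by (rule DERIV_pos_imp_increasing_open) (use E_deriv E'_pos E_cont in auto)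
  then have E1: "E 1 > 0" by (simp add: E_def)
  have E_mono: "E 1 \<le> E r" if "r \<ge> 1" for r
  proof (rule DERIV_nonneg_imp_nondecreasing[OF that])
    fix x :: real assume "1 \<le> x"
    then show "\<exists>y. (E has_real_derivative y) (at x) \<and> 0 \<le> y"
      using E_deriv[of x] E'_pos[of x] by (intro exI[of _ "E' x"]) auto
  qed
  \<comment> \<open>The first summand comes from the slope bounds in the gradient term, the other
    two from \<open>V1\<close> and \<open>U1\<close> below, applied to the two parts of
    \<open>F\<close>.\<close>
  define K where "K = n * n + (n + 2) * n / (q + 1) + (n + 2) * n / (p + 1)"
  have K: "K > 0" unfolding K_def using n params by (intro add_pos_pos) auto
  have E_le: "E r \<le> K * (r ^ (d - 1) * (U r * V r))" if r: "r \<ge> 1" for r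
  proof -
    have r0: "r > 0" using r by simp
    have rd: "r ^ Suc d = r ^ (d - 1) * r\<^sup>2" using dimension_ge by (simp add: power_add[symmetric])
    have W1: "r * (r * W r) \<le> n * U r" and W2: "r * (r * sw.W r) \<le> n * V r"
      using slope_bound[OF r0] sw.slope_bound[OF r0] by (auto simp: n_def)
    have V1: "r\<^sup>2 * V r powr q \<le> (n + 2) * n * U r"
    proof -
      have "r * (r * (V r powr q / (real d + 1))) \<le> r * (r * W r)"
        using W_ge[of r] r0 by (intro mult_left_mono) auto
      then have "r * (r * (V r powr q / (real d + 1))) \<le> n * U r" using W1 by simp
      then show ?thesis by (simp add: n_def power2_eq_square field_simps)
    qed
    have U1: "r\<^sup>2 * U r powr p \<le> (n + 2) * n * V r"
    proof -
      have "r * (r * (U r powr p / (real d + 1))) \<le> r * (r * sw.W r)"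
        using sw.W_ge[of r] r0 by (intro mult_left_mono) auto
      then have "r * (r * (U r powr p / (real d + 1))) \<le> n * V r" using W2 by simp
      then show ?thesis by (simp add: n_def power2_eq_square field_simps)
    qed
    have "(r * (r * W r)) * (r * (r * sw.W r)) \<le> (n * U r) * (n * V r)"
      using W_pos[of r] sw.W_pos[of r] r0 n pos[of r] by (intro mult_mono[OF W1 W2]) auto
    moreover have "(r\<^sup>2 * V r powr q) * V r / (q + 1) \<le> ((n + 2) * n * U r) * V r / (q + 1)"
      using V1 pos[of r] r0 params by (intro divide_right_mono mult_right_mono) auto
    moreover have "(r\<^sup>2 * U r powr p) * U r / (p + 1) \<le> ((n + 2) * n * V r) * U r / (p + 1)"
      using U1 pos[of r] r0 params by (intro divide_right_mono mult_right_mono) auto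
    ultimately have "(r * (r * W r)) * (r * (r * sw.W r)) + r\<^sup>2 * F r \<le> K * (U r * V r)"
      unfolding F_def K_def by (simp add: algebra_simps add_divide_distrib)
    then have le: "r ^ (d - 1) * ((r * (r * W r)) * (r * (r * sw.W r)) + r\<^sup>2 * F r) \<le> r ^ (d - 1) * (K * (U r * V r))"
      using r0 by (intro mult_left_mono) auto
    have "E r \<le> (r ^ Suc d * W r) * (r * (r * sw.W r)) + r ^ Suc d * F r"
    proof -
      have "0 \<le> a * ((r ^ Suc d * W r) * V r)" "0 \<le> b * (U r * (r ^ Suc d * sw.W r))"
        using ab pos[of r] W_pos[of r] sw.W_pos[of r] r0 by (intro mult_nonneg_nonneg; simp)+
      then show ?thesis unfolding E_def by linarith
    qed
    also have "\<dots> = r ^ (d - 1) * ((r * (r * W r)) * (r * (r * sw.W r)) + r\<^sup>2 * F r)"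
      unfolding rd by (simp add: power2_eq_square algebra_simps)
    finally show ?thesis using le by (simp add: algebra_simps)
  qed
  show ?thesis
  proof (intro exI[of _ "E 1 / K"] conjI allI impI)
    fix r :: real assume r: "r \<ge> 1"
    show "E 1 / K \<le> r ^ (d - 1) * (U r * V r)"
      using order_trans[OF E_mono[OF r] E_le[OF r]] K by (simp add: field_simps)
  qed (use E1 K in auto)
qed

end

text \<open>Both cases end with a positive multiple of \<open>ln r\<close> being bounded. For
  \<open>p * q < 1\<close> the product of \<open>U\<close> and \<open>V\<close> is bounded above by
  its initial value; for \<open>p * q > 1\<close> the decay from \<open>product_log_bound\<close>
  meets the Pohozaev bound from below.\<close>

theorem no_entire_solution:
  assumes sub: "(real d + 1) / (p + 1) + (real d + 1) / (q + 1) > real d - 1" and pq: "p * q \<noteq> 1"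
  shows "\<not> entire_solution d p q U V"
proof
  assume "entire_solution d p q U V"
  then interpret entire_solution d p q U V .
  interpret sw: entire_solution d q p V U by (rule swap)
  define C where "C = (p + q + 2) * ln ((real d + 1) * (real d - 1))"
  define s where "s = p + q + 2"
  have s: "s > 0" using params by (simp add: s_def)
  have bound: "2 * s * ln r + (p * q - 1) * ln (U r * V r) \<le> C" if "r > 0" for r
    using product_log_bound[OF that] by (simp add: C_def s_def)
  obtain e c where e: "e > 0" and le: "\<And>r. r \<ge> 1 \<Longrightarrow> e * ln r + c \<le> C"
  proof (cases "p * q < 1")
    case True
    have "2 * s * ln r + (p * q - 1) * ln (U 0 * V 0) \<le> C" if r: "r \<ge> 1" for r
    proof -
      have "U r * V r \<le> U 0 * V 0"
        using antimono[of 0 r] sw.antimono[of 0 r] pos[of r] pos[of 0] r by (intro mult_mono) auto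
      moreover have "0 < U r * V r" using pos[of r] r by simp
      ultimately have "ln (U r * V r) \<le> ln (U 0 * V 0)" by simp
      then have "(p * q - 1) * ln (U 0 * V 0) \<le> (p * q - 1) * ln (U r * V r)"
        using True by (intro mult_left_mono_neg) auto
      then show ?thesis using bound[of r] r by simp
    qed
    then show thesis using that[of "2 * s" "(p * q - 1) * ln (U 0 * V 0)"] s by simp
  next
    case False
    then have pq1: "p * q - 1 > 0" using pq by simp
    obtain k where k: "k > 0" "\<And>r. r \<ge> 1 \<Longrightarrow> k \<le> r ^ (d - 1) * (U r * V r)" using pohozaev[OF sub] by blast
    have d: "real (d - 1) = real d - 1" using dimension_ge by simp
    have "(2 * s - (p * q - 1) * (real d - 1)) * ln r + (p * q - 1) * ln k \<le> C" if r: "r \<ge> 1" for r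
    proof -
      have "0 < U r * V r" using pos[of r] r by simp
      have "ln k \<le> ln (r ^ (d - 1) * (U r * V r))" using k(2)[OF r] k(1) by simp
      also have "\<dots> = (real d - 1) * ln r + ln (U r * V r)"
        using r pos[of r] d by (simp add: ln_mult ln_realpow)
      finally have "(p * q - 1) * ln k \<le> (p * q - 1) * ((real d - 1) * ln r + ln (U r * V r))"
        using pq1 by (intro mult_left_mono) auto
      then show ?thesis using bound[of r] r by (simp add: algebra_simps)
    qed
    \<comment> \<open>This is \<open>sub\<close> cleared of denominators, since
      \<open>(p + 1) * (q + 1) = (p * q - 1) + s\<close>.\<close>
    moreover have "2 * s - (p * q - 1) * (real d - 1) > 0"
    proof -
      have "(real d - 1) * ((p + 1) * (q + 1)) < ((real d + 1) / (p + 1) + (real d + 1) / (q + 1)) * ((p + 1) * (q + 1))"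
        using sub params by (intro mult_strict_right_mono) auto
      also have "\<dots> = (real d + 1) * s"
      proof -
        have "(m / x + m / y) * (x * y) = m * (x + y)" if "x > 0" "y > 0" for m x y :: real
          using that by (simp add: field_simps)
        from this[of "p + 1" "q + 1" "real d + 1"] params show ?thesis by (simp add: s_def algebra_simps)
      qed
      finally show ?thesis by (simp add: s_def algebra_simps)
    qed
    ultimately show thesis using that by blast
  qed
  define r where "r = exp (max 0 ((C - c) / e + 1))"
  have "r \<ge> 1" by (simp add: r_def)
  moreover have "e * ln r \<ge> e * ((C - c) / e + 1)" unfolding r_def using e by (intro mult_left_mono) auto
  moreover have "e * ((C - c) / e + 1) = C - c + e" using e by (simp add: field_simps)
  ultimately show False using le[of r] e by linarith
qed

section \<open>Shooting\<close>

text \<open>Taking positive parts makes both nonlinearities nondecreasing, so that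
  \<open>V \<mapsto> b - (-\<Delta>)\<^sup>-\<^sup>1 (1 - (-\<Delta>)\<^sup>-\<^sup>1 V\<^sup>q)\<^sup>p\<close> is monotone: iterating from the constant \<open>b\<close> yields a solution
  on the whole half line that may change sign, without any Lipschitz condition.\<close>

locale shooting =
  fixes d :: nat and p q :: real
  assumes params: "p > 0" "q > 0"
begin

primrec iterV :: "real \<Rightarrow> nat \<Rightarrow> real \<Rightarrow> real" where
  "iterV b 0 = (\<lambda>r. b)"
| "iterV b (Suc n) = (\<lambda>r. b - radial_int d (\<lambda>s. ppow p (1 - radial_int d (\<lambda>t. ppow q (iterV b n t)) s)) r)"

definition "iterU b n r = 1 - radial_int d (\<lambda>t. ppow q (iterV b n t)) r"

lemma iterV_Suc: "iterV b (Suc n) r = b - radial_int d (\<lambda>s. ppow p (iterU b n s)) r"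
  by (simp add: iterU_def)

declare iterV.simps(2) [simp del]

lemma cont_iterV: "continuous_on {0..T} (iterV b n)"
  and cont_iterU: "continuous_on {0..T} (iterU b n)"
proof -
  have "continuous_on {0..T} (iterV b n) \<and> continuous_on {0..T} (iterU b n)"
  proof (induction n)
    case 0
    then show ?case unfolding iterU_def[abs_def] iterV.simps(1)
      by (intro conjI continuous_intros continuous_on_radial_int continuous_on_ppow params)
  next
    case (Suc n)
    have V: "continuous_on {0..T} (iterV b (Suc n))"
      unfolding iterV_Suc[abs_def] using Suc
      by (intro continuous_intros continuous_on_radial_int continuous_on_ppow params) auto
    then show ?case unfolding iterU_def[abs_def]
      by (intro conjI continuous_intros continuous_on_radial_int continuous_on_ppow params)
  qed
  then show "continuous_on {0..T} (iterV b n)" "continuous_on {0..T} (iterU b n)" by auto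
qed

text \<open>Passing from \<open>V\<close> to \<open>U\<close> and back reverses the order twice.
  Independent indices and initial values let one lemma give both monotonicity in \<open>b\<close>
  and monotonicity in \<open>n\<close>.\<close>

lemma iter_step:
  assumes "b' \<le> b" "\<And>s. 0 \<le> s \<Longrightarrow> iterV b' m s \<le> iterV b n s" "0 \<le> r"
  shows "iterU b n r \<le> iterU b' m r" "iterV b' (Suc m) r \<le> iterV b (Suc n) r"
proof -
  have U: "iterU b n r \<le> iterU b' m r" if "0 \<le> r" for r
    unfolding iterU_def using that assms params
    by (intro diff_left_mono radial_int_mono continuous_on_ppow cont_iterV ppow_mono) auto
  then show "iterU b n r \<le> iterU b' m r" using assms by simp
  show "iterV b' (Suc m) r \<le> iterV b (Suc n) r"
    unfolding iterV_Suc using U assms params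
    by (intro diff_mono radial_int_mono continuous_on_ppow cont_iterU ppow_mono) auto
qed

lemma iter_mono:
  assumes "b' \<le> b" "0 \<le> r"
  shows "iterV b' n r \<le> iterV b n r" "iterU b n r \<le> iterU b' n r"
proof -
  have V: "iterV b' n r \<le> iterV b n r" if "0 \<le> r" for r
    using that
  proof (induction n arbitrary: r)
    case (Suc n)
    then show ?case using iter_step(2)[OF assms(1), of n n] by blast
  qed (use assms in simp)
  then show "iterV b' n r \<le> iterV b n r" "iterU b n r \<le> iterU b' n r"
    using assms iter_step(1)[OF assms(1), of n n] by auto
qed

lemma radial_int_nonneg: "continuous_on {0..r} f \<Longrightarrow> (\<And>s. 0 \<le> s \<Longrightarrow> f s \<ge> 0) \<Longrightarrow> 0 \<le> r \<Longrightarrow> 0 \<le> radial_int d f r"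
  using radial_int_ge[of r f 0 d] by simp

lemma iter_le: "0 \<le> r \<Longrightarrow> iterV b n r \<le> b" "0 \<le> r \<Longrightarrow> iterU b n r \<le> 1"
proof -
  show U: "iterU b n r \<le> 1" if "0 \<le> r" for n r
    using that params unfolding iterU_def
    by (simp add: radial_int_nonneg continuous_on_ppow cont_iterV)
  show "iterV b n r \<le> b" if "0 \<le> r"
    using that params by (cases n) (simp_all add: iterV_Suc radial_int_nonneg continuous_on_ppow cont_iterU)
qed

lemma iter_decseq:
  assumes "0 \<le> r"
  shows "iterV b (Suc n) r \<le> iterV b n r" "iterU b n r \<le> iterU b (Suc n) r"
proof -
  have V: "iterV b (Suc n) r \<le> iterV b n r" if "0 \<le> r" for r
    using that
  proof (induction n arbitrary: r)
    case (Suc n)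
    then show ?case using iter_step(2)[OF order_refl, of b "Suc n" n] by blast
  qed (use iter_le in simp)
  then show "iterV b (Suc n) r \<le> iterV b n r" "iterU b n r \<le> iterU b (Suc n) r"
    using assms iter_step(1)[OF order_refl, of b "Suc n" n] by auto
qed

lemma iter_ge:
  assumes "0 \<le> r"
  shows "1 - ppow q b * r\<^sup>2 / (2 * (real d + 1)) \<le> iterU b n r" "b - r\<^sup>2 / (2 * (real d + 1)) \<le> iterV b n r"
proof -
  show "1 - ppow q b * r\<^sup>2 / (2 * (real d + 1)) \<le> iterU b n r"
    unfolding iterU_def using assms params iter_le
    by (intro diff_left_mono radial_int_le continuous_on_ppow cont_iterV ppow_mono) auto
  show "b - r\<^sup>2 / (2 * (real d + 1)) \<le> iterV b n r"
  proof (cases n)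
    case (Suc m)
    have "radial_int d (\<lambda>s. ppow p (iterU b m s)) r \<le> ppow p 1 * r\<^sup>2 / (2 * (real d + 1))"
      using assms params iter_le by (intro radial_int_le continuous_on_ppow cont_iterU ppow_mono) auto
    then show ?thesis by (simp add: Suc iterV_Suc ppow_nonneg_eq)
  qed simp
qed

section \<open>The shooting solutions and their limits\<close>

definition "shootV b r = lim (\<lambda>n. iterV b n r)"
definition "shootU b r = lim (\<lambda>n. iterU b n r)"

lemma shoot_lim:
  assumes "0 \<le> r"
  shows "(\<lambda>n. iterV b n r) \<longlonglongrightarrow> shootV b r" "(\<lambda>n. iterU b n r) \<longlonglongrightarrow> shootU b r"
proof -
  have "decseq (\<lambda>n. iterV b n r)" using iter_decseq[OF assms] by (intro decseq_SucI)
  then have "convergent (\<lambda>n. iterV b n r)"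
    by (rule decseq_convergent[of _ "b - r\<^sup>2 / (2 * (real d + 1))"]) (use iter_ge[OF assms] in \<open>auto simp: convergent_def\<close>)
  then show "(\<lambda>n. iterV b n r) \<longlonglongrightarrow> shootV b r" unfolding shootV_def by (simp add: convergent_LIMSEQ_iff)
  have "incseq (\<lambda>n. iterU b n r)" using iter_decseq[OF assms] by (intro incseq_SucI)
  then have "convergent (\<lambda>n. iterU b n r)"
    by (rule incseq_convergent[of _ 1]) (use iter_le[OF assms] in \<open>auto simp: convergent_def\<close>)
  then show "(\<lambda>n. iterU b n r) \<longlonglongrightarrow> shootU b r" unfolding shootU_def by (simp add: convergent_LIMSEQ_iff)
qed

lemma shoot_bounds:
  assumes "0 \<le> r"
  shows "shootV b r \<le> b" "shootU b r \<le> 1" "b - r\<^sup>2 / (2 * (real d + 1)) \<le> shootV b r"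
    "1 - ppow q b * r\<^sup>2 / (2 * (real d + 1)) \<le> shootU b r"
  using shoot_lim[OF assms] iter_le[OF assms] iter_ge[OF assms]
  by (blast intro: LIMSEQ_le_const2 LIMSEQ_le_const)+

lemma shoot_mono:
  assumes "b' \<le> b" "0 \<le> r"
  shows "shootV b' r \<le> shootV b r" "shootU b r \<le> shootU b' r"
  using shoot_lim[OF assms(2)] iter_mono[OF assms] by (blast intro: LIMSEQ_le)+

lemma shoot_sol:
  "radial_sol d p q T (shootU b) (shootV b)" "shootU b 0 = 1" "shootV b 0 = b"
proof -
  have U0: "shootU b 0 = 1"
    using shoot_lim(2)[of 0 b] by (simp add: iterU_def LIMSEQ_const_iff)
  have "iterV b n 0 = b" for n by (cases n) (simp_all add: iterV_Suc)
  then have V0: "shootV b 0 = b"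
    using shoot_lim(1)[of 0 b] by (simp add: LIMSEQ_const_iff)
  note U = radial_relation_limit[where T = T and V = "iterV b" and M = b and U = "iterU b" and a = "\<lambda>_. 1" and a' = 1
      and V' = "shootV b" and U' = "shootU b" and d = d, OF params(2)]
  note V = radial_relation_limit[where T = T and V = "iterU b" and M = 1 and U = "\<lambda>n. iterV b (Suc n)" and a = "\<lambda>_. b" and a' = b
      and V' = "shootU b" and U' = "shootV b" and d = d, OF params(1)]
  have 1: "\<And>n s. s \<in> {0..T} \<Longrightarrow> iterV b n s \<le> b" "\<And>n s. s \<in> {0..T} \<Longrightarrow> iterU b n s \<le> 1"
    "\<And>s. s \<in> {0..T} \<Longrightarrow> (\<lambda>n. iterV b n s) \<longlonglongrightarrow> shootV b s"
    "\<And>s. s \<in> {0..T} \<Longrightarrow> (\<lambda>n. iterV b (Suc n) s) \<longlonglongrightarrow> shootV b s"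
    "\<And>s. s \<in> {0..T} \<Longrightarrow> (\<lambda>n. iterU b n s) \<longlonglongrightarrow> shootU b s"
    using iter_le shoot_lim LIMSEQ_Suc[OF shoot_lim(1)] by auto
  note U' = U[OF cont_iterV 1(1,3) iterU_def 1(5) tendsto_const]
  note V' = V[OF cont_iterU 1(2,5) iterV_Suc 1(4) tendsto_const]
  show "radial_sol d p q T (shootU b) (shootV b)"
    by (rule radial_solI) (use U' V' U0 V0 in auto)
  show "shootU b 0 = 1" "shootV b 0 = b" by (rule U0 V0)+
qed

lemma shoot_limit:
  assumes b: "monoseq b" "b \<longlonglongrightarrow> b'"
  shows "\<exists>U V. (\<forall>T. radial_sol d p q T U V) \<and> U 0 = 1 \<and> V 0 = b' \<and>
    (\<forall>r\<ge>0. (\<lambda>n. shootU (b n) r) \<longlonglongrightarrow> U r \<and> (\<lambda>n. shootV (b n) r) \<longlonglongrightarrow> V r)"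
proof -
  obtain B where B: "\<And>n. \<bar>b n\<bar> \<le> B"
    using convergent_imp_Bseq[of b] b(2) unfolding convergent_def Bseq_def by (metis real_norm_def)
  have conv: "convergent (\<lambda>n. shootU (b n) r) \<and> convergent (\<lambda>n. shootV (b n) r)" if r: "r \<ge> 0" for r
  proof
    define k where "k = r\<^sup>2 / (2 * (real d + 1))"
    have k: "k \<ge> 0" by (simp add: k_def)
    have "monoseq (\<lambda>n. shootU (b n) r)" "monoseq (\<lambda>n. shootV (b n) r)"
      using b(1) shoot_mono[OF _ r] unfolding monoseq_def by blast+
    moreover have "\<bar>shootU (b n) r\<bar> \<le> 1 + ppow q B * k" for n
    proof -
      have "b n \<le> B" using B[of n] by simp
      then have "ppow q (b n) * k \<le> ppow q B * k" using k params by (intro mult_right_mono ppow_mono) auto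
      moreover have "1 - ppow q (b n) * k \<le> shootU (b n) r" "shootU (b n) r \<le> 1"
        using shoot_bounds[OF r, of "b n"] by (simp_all add: k_def)
      moreover have "0 \<le> ppow q (b n) * k" using k by simp
      ultimately show ?thesis by linarith
    qed
    then have "Bseq (\<lambda>n. shootU (b n) r)" by (intro BseqI') auto
    moreover have "\<bar>shootV (b n) r\<bar> \<le> B + k" for n
      using shoot_bounds[OF r, of "b n"] B[of n] k by (simp add: k_def)
    then have "Bseq (\<lambda>n. shootV (b n) r)" by (intro BseqI') auto
    ultimately show "convergent (\<lambda>n. shootU (b n) r)" "convergent (\<lambda>n. shootV (b n) r)"
      by (auto intro: Bseq_monoseq_convergent)
  qed
  define U where "U r = lim (\<lambda>n. shootU (b n) r)" for r
  define V where "V r = lim (\<lambda>n. shootV (b n) r)" for r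
  have limU: "(\<lambda>n. shootU (b n) r) \<longlonglongrightarrow> U r" and limV: "(\<lambda>n. shootV (b n) r) \<longlonglongrightarrow> V r" if "r \<ge> 0" for r
    using conv[OF that] by (simp_all add: U_def V_def convergent_LIMSEQ_iff)
  have U0: "U 0 = 1" using limU[of 0] by (simp add: shoot_sol LIMSEQ_const_iff)
  have "b \<longlonglongrightarrow> V 0" using limV[of 0] by (simp add: shoot_sol)
  then have V0: "V 0 = b'" using b(2) LIMSEQ_unique by blast
  have sol: "radial_sol d p q T U V" for T
  proof -
    have 1: "\<And>n s. s \<in> {0..T} \<Longrightarrow> shootV (b n) s \<le> B" "\<And>n s. s \<in> {0..T} \<Longrightarrow> shootU (b n) s \<le> 1"
      "\<And>s. s \<in> {0..T} \<Longrightarrow> (\<lambda>n. shootV (b n) s) \<longlonglongrightarrow> V s"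
      "\<And>s. s \<in> {0..T} \<Longrightarrow> (\<lambda>n. shootU (b n) s) \<longlonglongrightarrow> U s"
      "\<And>n s. s \<in> {0..T} \<Longrightarrow> shootU (b n) s = 1 - radial_int d (\<lambda>r. ppow q (shootV (b n) r)) s"
      "\<And>n s. s \<in> {0..T} \<Longrightarrow> shootV (b n) s = b n - radial_int d (\<lambda>r. ppow p (shootU (b n) r)) s"
    proof -
      fix n s assume s: "s \<in> {0..T}"
      show "shootV (b n) s \<le> B" using shoot_bounds(1)[of s "b n"] B[of n] s by auto
      show "shootU (b n) s \<le> 1" using shoot_bounds(2)[of s "b n"] s by auto
      show "shootU (b n) s = 1 - radial_int d (\<lambda>r. ppow q (shootV (b n) r)) s"
        using radial_sol_eq[OF shoot_sol(1), of s T "b n"] s unfolding shoot_sol by simp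
      show "shootV (b n) s = b n - radial_int d (\<lambda>r. ppow p (shootU (b n) r)) s"
        using radial_sol_eq[OF radial_sol_swap[OF shoot_sol(1)], of s T "b n"] s unfolding shoot_sol by simp
    qed (use limU limV in auto)
    note c = continuous_on_radial_sol[OF shoot_sol(1) order_refl]
    note U' = radial_relation_limit[where T = T and V = "\<lambda>n. shootV (b n)" and U = "\<lambda>n. shootU (b n)" and a = "\<lambda>_. 1" and d = d, OF params(2) c(2) 1(1,3,5,4) tendsto_const]
    note V' = radial_relation_limit[where T = T and V = "\<lambda>n. shootU (b n)" and U = "\<lambda>n. shootV (b n)" and a = b and d = d, OF params(1) c(1) 1(2,4,6,3) b(2)]
    show ?thesis
    proof (rule radial_solI)
      show "continuous_on {0..T} U" by (rule U'(2)) auto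
      show "continuous_on {0..T} V" by (rule V'(2)) auto
      fix r assume "0 \<le> r" "r \<le> T"
      then have r: "r \<in> {0..T}" by simp
      show "U r = U 0 - radial_int d (\<lambda>s. ppow q (V s)) r"
        unfolding U0 by (rule U'(1)) (use r in auto)
      show "V r = V 0 - radial_int d (\<lambda>s. ppow p (U s)) r"
        unfolding V0 by (rule V'(1)) (use r in auto)
    qed
  qed
  show ?thesis using sol U0 V0 limU limV by blast
qed

text \<open>The set of initial values \<open>b\<close> for which \<open>U\<close> vanishes while \<open>V\<close> is still nonnegative is an up-set;
  at its infimum both components have to vanish simultaneously.\<close>

definition "U_first = {b. 0 < b \<and> (\<exists>r\<ge>0. shootU b r \<le> 0 \<and> 0 \<le> shootV b r)}"

lemma U_first_upclosed: "b \<in> U_first \<Longrightarrow> b \<le> b' \<Longrightarrow> b' \<in> U_first"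
  unfolding U_first_def using shoot_mono by (fastforce intro: order_trans)

lemma shootV_antimono: "0 \<le> r \<Longrightarrow> r \<le> s \<Longrightarrow> shootV b s \<le> shootV b r"
  using radial_sol_antimono[OF radial_sol_swap[OF shoot_sol(1)] params(1), of r s s] by simp

lemma shootU_antimono: "0 \<le> r \<Longrightarrow> r \<le> s \<Longrightarrow> shootU b s \<le> shootU b r"
  using radial_sol_antimono[OF shoot_sol(1) params(2), of r s s] by simp

text \<open>On the unit interval \<open>V\<close> loses at most one half, so a large
  \<open>b\<close> keeps it above \<open>b / 2\<close>; this forces \<open>U\<close> to vanish by
  radius one.\<close>

lemma U_firstI:
  assumes b: "1 \<le> b" "2 * (real d + 1) \<le> (b / 2) powr q"
  shows "b \<in> U_first"
proof -
  have V: "b / 2 \<le> shootV b r" if "0 \<le> r" "r \<le> 1" for r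
  proof -
    have "r\<^sup>2 / (2 * (real d + 1)) \<le> 1 / 2"
      using that power_le_one[of r 2] by (simp add: field_simps)
    then show ?thesis using shoot_bounds(3)[OF that(1), of b] b by linarith
  qed
  have "ppow q (b / 2) * 1\<^sup>2 / (2 * (real d + 1)) \<le> radial_int d (\<lambda>s. ppow q (shootV b s)) 1"
    by (rule radial_int_ge[OF radial_sol_continuous[OF shoot_sol(1) params(2)]])
       (use V params in \<open>auto intro!: ppow_mono\<close>)
  moreover have "1 \<le> ppow q (b / 2) * 1\<^sup>2 / (2 * (real d + 1))"
    using b by (simp add: ppow_nonneg_eq field_simps)
  ultimately have "shootU b 1 \<le> 0"
    using radial_sol_eq[OF shoot_sol(1), of 1 1 b] unfolding shoot_sol(2) by linarith
  moreover have "0 \<le> shootV b 1" using V[of 1] b by simp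
  ultimately show ?thesis unfolding U_first_def using b by (auto intro!: exI[of _ 1])
qed

text \<open>For small \<open>b\<close> the roles are reversed: \<open>U\<close> is at least one half
  up to radius one, where \<open>V\<close> is already negative, and \<open>V\<close> does not
  increase again.\<close>

lemma not_U_firstI:
  assumes b: "b \<le> 1" "b < (1/2) powr p / (2 * (real d + 1))"
  shows "b \<notin> U_first"
proof
  assume "b \<in> U_first"
  then obtain r where r: "0 < b" "r \<ge> 0" "shootU b r \<le> 0" "0 \<le> shootV b r" by (auto simp: U_first_def)
  have U: "1 / 2 \<le> shootU b s" if "0 \<le> s" "s \<le> 1" for s
  proof -
    have "ppow q b * s\<^sup>2 \<le> 1 * 1"
      using that r(1) b params by (intro mult_mono) (auto simp: ppow_nonneg_eq powr_le1 power_le_one)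
    then have "ppow q b * s\<^sup>2 / (2 * (real d + 1)) \<le> 1 / 2" by (simp add: field_simps)
    then show ?thesis using shoot_bounds(4)[OF that(1), of b] by linarith
  qed
  have "ppow p (1 / 2) * 1\<^sup>2 / (2 * (real d + 1)) \<le> radial_int d (\<lambda>s. ppow p (shootU b s)) 1"
    by (rule radial_int_ge[OF radial_sol_continuous[OF radial_sol_swap[OF shoot_sol(1)] params(1)]])
       (use U params in \<open>auto intro!: ppow_mono\<close>)
  then have V: "shootV b 1 < 0"
    using b radial_sol_eq[OF radial_sol_swap[OF shoot_sol(1)], of 1 1 b] by (simp add: shoot_sol ppow_nonneg_eq)
  show False
  proof (cases "r \<le> 1")
    case True then show ?thesis using U[of r] r by simp
  next
    case False then show ?thesis using shootV_antimono[of 1 r b] V r by simp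
  qed
qed

lemma positive_right:
  fixes f :: "real \<Rightarrow> real"
  assumes f: "\<And>T. continuous_on {0..T} f" and x: "0 \<le> x" "f x > 0"
  obtains r where "x < r" "f r > 0"
proof -
  have "(\<lambda>n. f (x + 1 / real (Suc n))) \<longlonglongrightarrow> f (x + 0)"
  proof (rule continuous_on_tendsto_compose[OF f[of "x + 1"]])
    show "(\<lambda>n. x + 1 / real (Suc n)) \<longlonglongrightarrow> x + 0"
      by (intro tendsto_intros LIMSEQ_Suc[OF lim_1_over_n])
    show "\<forall>\<^sub>F n in sequentially. x + 1 / real (Suc n) \<in> {0..x + 1}"
      using x by (intro always_eventually) auto
  qed (use x in auto)
  then have "\<forall>\<^sub>F n in sequentially. 0 < f (x + 1 / real (Suc n))"
    using x(2) by (intro order_tendstoD(1)) auto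
  then obtain n where "0 < f (x + 1 / real (Suc n))" by (auto simp: eventually_sequentially)
  then show thesis by (intro that[of "x + 1 / real (Suc n)"]) auto
qed

text \<open>The critical value is approached from both sides because each side excludes one
  alternative: from below no member of the sequence lies in \<open>U_first\<close>, from above every
  member does. Up to the first zero the two limits coincide by uniqueness.\<close>

theorem dirichlet_solution:
  assumes sub: "(real d + 1) / (p + 1) + (real d + 1) / (q + 1) > real d - 1" and pq: "p * q \<noteq> 1"
  shows "\<exists>R U V. 0 < R \<and> radial_sol d p q R U V \<and> U R = 0 \<and> V R = 0 \<and> (\<forall>r. 0 \<le> r \<and> r < R \<longrightarrow> 0 < U r \<and> 0 < V r)"
proof -
  define \<beta> where "\<beta> = Inf U_first"
  define h where "h = (1/2) powr p / (2 * (real d + 1))"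
  have h: "h > 0" by (simp add: h_def)
  define b0 where "b0 = min 1 (h / 2)"
  have "b0 < h" using h by (simp add: b0_def min_def)
  then have b0: "b0 > 0" "b0 \<le> 1" "b0 < (1/2) powr p / (2 * (real d + 1))"
    using h unfolding h_def[symmetric] by (simp_all add: b0_def)
  have lb: "b0 \<le> b" if "b \<in> U_first" for b
    using U_first_upclosed[OF that, of b0] not_U_firstI[OF b0(2,3)] by fastforce
  define b1 where "b1 = 2 * (2 * (real d + 1)) powr (1 / q)"
  have "1 \<le> (2 * (real d + 1)) powr (1 / q)" using params by (intro ge_one_powr_ge_zero) auto
  then have "b1 \<in> U_first" using params by (intro U_firstI) (auto simp: b1_def powr_powr)
  then have ne: "U_first \<noteq> {}" by blast
  have bdd: "bdd_below U_first" using lb by (rule bdd_belowI)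
  have \<beta>: "\<beta> > 0" using cInf_greatest[OF ne lb] b0 by (simp add: \<beta>_def)
  have above: "b \<in> U_first" if "\<beta> < b" for b
    using cInf_lessD[OF ne, of b] that U_first_upclosed by (force simp: \<beta>_def)
  have below: "b \<notin> U_first" if "b < \<beta>" for b
    using cInf_lower[OF _ bdd, of b] that by (force simp: \<beta>_def)
  have inv_lim: "(\<lambda>n. 1 / real (Suc n)) \<longlonglongrightarrow> 0" by (rule LIMSEQ_Suc[OF lim_1_over_n])
  have inv_mono: "1 / real (Suc n) \<le> 1 / real (Suc m)" if "m \<le> n" for m n using that by (simp add: field_simps)
  define b where "b n = \<beta> + 1 / real (Suc n)" for n
  \<comment> \<open>The double successor makes \<open>c 0 = \<beta> / 2\<close>, so every
    \<open>c n\<close> is a positive initial value.\<close>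
  define c where "c n = \<beta> - \<beta> * (1 / real (Suc (Suc n)))" for n
  have b: "monoseq b" "b \<longlonglongrightarrow> \<beta>" "b n \<in> U_first" for n
  proof -
    show "monoseq b" unfolding monoseq_def b_def using inv_mono by auto
    show "b \<longlonglongrightarrow> \<beta>" unfolding b_def using tendsto_add[OF tendsto_const inv_lim, of \<beta>] by simp
    show "b n \<in> U_first" by (rule above) (simp add: b_def)
  qed
  have c: "monoseq c" "c \<longlonglongrightarrow> \<beta>" "c n \<notin> U_first" "c n > 0" for n
  proof -
    have "c m \<le> c n" if "m \<le> n" for m n
      using mult_left_mono[OF inv_mono[of "Suc m" "Suc n"], of \<beta>] that \<beta> by (simp add: c_def)
    then show "monoseq c" unfolding monoseq_def by blast
    show "c \<longlonglongrightarrow> \<beta>" unfolding c_def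
      using tendsto_diff[OF tendsto_const tendsto_mult_left[OF LIMSEQ_Suc[OF inv_lim], of \<beta>], of \<beta>] by simp
    show "c n \<notin> U_first" by (rule below) (use \<beta> in \<open>simp add: c_def\<close>)
    show "c n > 0" using \<beta> by (simp add: c_def field_simps add_pos_nonneg)
  qed
  obtain U V where s1: "\<And>T. radial_sol d p q T U V" "U 0 = 1" "V 0 = \<beta>"
    and lim1: "\<And>r. r \<ge> 0 \<Longrightarrow> (\<lambda>n. shootU (b n) r) \<longlonglongrightarrow> U r" "\<And>r. r \<ge> 0 \<Longrightarrow> (\<lambda>n. shootV (b n) r) \<longlonglongrightarrow> V r"
    using shoot_limit[OF b(1,2)] by blast
  obtain U' V' where s2: "\<And>T. radial_sol d p q T U' V'" "U' 0 = 1" "V' 0 = \<beta>"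
    and lim2: "\<And>r. r \<ge> 0 \<Longrightarrow> (\<lambda>n. shootU (c n) r) \<longlonglongrightarrow> U' r" "\<And>r. r \<ge> 0 \<Longrightarrow> (\<lambda>n. shootV (c n) r) \<longlonglongrightarrow> V' r"
    using shoot_limit[OF c(1,2)] by blast
  note c1 = continuous_on_radial_sol[OF s1(1) order_refl] and c2 = continuous_on_radial_sol[OF s2(1) order_refl]
  have "\<exists>x\<ge>0. min (U x) (V x) \<le> 0"
  proof (rule ccontr)
    assume "\<not> ?thesis"
    then have "U r > 0 \<and> V r > 0" if "r \<ge> 0" for r using that by (fastforce simp: not_le)
    then have "entire_solution d p q U V"
      using params s1(1) by unfold_locales auto
    then show False using no_entire_solution[OF sub pq] by blast
  qed
  then obtain x where x: "x \<ge> 0" "min (U x) (V x) \<le> 0" by blast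
  obtain R where R: "0 < R" "min (U R) (V R) = 0" and Rpos: "\<And>s. 0 \<le> s \<Longrightarrow> s < R \<Longrightarrow> min (U s) (V s) > 0"
  proof (rule first_zero[where f = "\<lambda>r. min (U r) (V r)" and x = x])
    show "continuous_on {0..x} (\<lambda>r. min (U r) (V r))" by (intro continuous_intros c1)
  qed (use x s1 \<beta> in auto)
  \<comment> \<open>\<open>radial_sol_unique\<close> applies on \<open>[0, s]\<close> for each
    \<open>s < R\<close>, where both components are still positive; continuity carries the equality
    to \<open>R\<close>.\<close>
  have eq: "U' r = U r \<and> V' r = V r" if "0 \<le> r" "r \<le> R" for r
  proof -
    have "U s = U' s \<and> V s = V' s" if "0 \<le> s" "s < R" for s
      using radial_sol_unique[OF s1(1) s2(1) params, of s s] Rpos[of s] that s1 s2 by simp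
    then have "U s - U' s = 0" "V s - V' s = 0" if "s \<in> {0..<R}" for s using that by auto
    moreover have "continuous_on (closure {0..<R}) (\<lambda>s. U s - U' s)" "continuous_on (closure {0..<R}) (\<lambda>s. V s - V' s)"
      using R(1) by (auto intro!: continuous_intros c1 c2)
    moreover have "r \<in> closure {0..<R}" using that R(1) by simp
    ultimately have "U r - U' r = 0" "V r - V' r = 0"
      using continuous_constant_on_closure[of "{0..<R}" "\<lambda>s. U s - U' s" 0 r]
        continuous_constant_on_closure[of "{0..<R}" "\<lambda>s. V s - V' s" 0 r] by blast+
    then show ?thesis by simp
  qed
  have "U R = 0 \<and> V R = 0"
  proof (rule ccontr)
    assume "\<not> ?thesis"
    then consider "U R = 0" "V R > 0" | "V R = 0" "U R > 0" using R(2) by (auto simp: min_def split: if_splits)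
    then show False
    proof cases
      \<comment> \<open>If \<open>U\<close> vanished alone, then slightly beyond \<open>R\<close>
        approximations from below would have \<open>U < 0 < V\<close>, which puts them into
        \<open>U_first\<close>.\<close>
      case 1
      then have "V' R > 0" "U' R = 0" using eq[of R] R(1) by auto
      then obtain r where r: "R < r" "V' r > 0" using positive_right[of V' R] c2 R(1) by auto
      have "U' r < U' R"
        using radial_sol_strict_antimono[OF s2(1) params(2), of R r r] r R(1) s2(3) \<beta> by simp
      then have "U' r < 0" using \<open>U' R = 0\<close> by simp
      then have "\<forall>\<^sub>F n in sequentially. shootU (c n) r < 0 \<and> shootV (c n) r > 0"
        using order_tendstoD(2)[OF lim2(1)] order_tendstoD(1)[OF lim2(2)] r R(1) by (intro eventually_conj) auto
      then obtain n where "shootU (c n) r < 0" "shootV (c n) r > 0" by (auto simp: eventually_sequentially)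
      then have "c n \<in> U_first" using c(4)[of n] r R(1) unfolding U_first_def
        by (intro CollectI conjI exI[of _ r]) auto
      then show False using c(3) by blast
    next
      \<comment> \<open>If \<open>V\<close> vanished alone, approximations from above would have
        \<open>V < 0 < U\<close> at some radius; as both components decrease, \<open>U\<close> could
        then never vanish while \<open>V\<close> is nonnegative, contrary to membership in
        \<open>U_first\<close>.\<close>
      case 2
      then obtain r where r: "R < r" "U r > 0" using positive_right[of U R] c1 R(1) by auto
      have "V r < V R"
        using radial_sol_strict_antimono[OF radial_sol_swap[OF s1(1)] params(1), of R r r] r R(1) s1(2) by simp
      then have "V r < 0" using 2 by simp
      then have "\<forall>\<^sub>F n in sequentially. shootV (b n) r < 0 \<and> shootU (b n) r > 0"
        using order_tendstoD(2)[OF lim1(2)] order_tendstoD(1)[OF lim1(1)] r R(1) by (intro eventually_conj) auto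
      then obtain n where n: "shootV (b n) r < 0" "shootU (b n) r > 0" by (auto simp: eventually_sequentially)
      obtain s where s: "s \<ge> 0" "shootU (b n) s \<le> 0" "0 \<le> shootV (b n) s" using b(3)[of n] by (auto simp: U_first_def)
      show False
      proof (cases "s \<le> r")
        case True then show ?thesis using shootU_antimono[of s r "b n"] s n by simp
      next
        case False then show ?thesis using shootV_antimono[of r s "b n"] s n r R(1) by simp
      qed
    qed
  qed
  then show ?thesis using s1(1) R(1) Rpos by (intro exI[of _ R] exI[of _ U] exI[of _ V]) auto
qed

end

section \<open>Solutions in the ball\<close>

lemma has_continuous_partials_onI:
  assumes D: "\<And>i x. i \<in> Basis \<Longrightarrow> x \<in> S \<Longrightarrow> ((\<lambda>t. f (x + t *\<^sub>R i)) has_real_derivative D i x) (at 0)"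
    and c: "\<And>i. i \<in> Basis \<Longrightarrow> continuous_on S (D i)"
  shows "f has_continuous_partials_on S" and "\<And>i x. i \<in> Basis \<Longrightarrow> x \<in> S \<Longrightarrow> partial i f x = D i x"
proof -
  show eq: "partial i f x = D i x" if "i \<in> Basis" "x \<in> S" for i x
    unfolding partial_def by (rule DERIV_imp_deriv[OF D[OF that]])
  have "continuous_on S (partial i f)" if "i \<in> Basis" for i
    by (rule continuous_on_eq[OF c[OF that]]) (use eq that in auto)
  moreover have "(\<lambda>t. f (x + t *\<^sub>R i)) differentiable (at 0)" if "i \<in> Basis" "x \<in> S" for i x
    using D[OF that] real_differentiable_def by blast
  ultimately show "f has_continuous_partials_on S" by (simp add: has_continuous_partials_on_def)
qed

lemma has_real_derivative_line_cong:
  fixes x :: "'a::euclidean_space"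
  assumes S: "open S" "x \<in> S" and eq: "\<And>y. y \<in> S \<Longrightarrow> f y = g y"
    and D: "((\<lambda>t. g (x + t *\<^sub>R i)) has_real_derivative D) (at 0)"
  shows "((\<lambda>t. f (x + t *\<^sub>R i)) has_real_derivative D) (at 0)"
proof -
  have "open ((\<lambda>t. x + t *\<^sub>R i) -` S)"
    by (intro open_vimage S continuous_intros)
  then show ?thesis
    by (rule has_field_derivative_transform_within_open[OF D]) (use S eq in auto)
qed

lemma C2_onI:
  fixes f :: "'a::euclidean_space \<Rightarrow> real"
  assumes S: "open S"
    and D: "\<And>i x. i \<in> Basis \<Longrightarrow> x \<in> S \<Longrightarrow> ((\<lambda>t. f (x + t *\<^sub>R i)) has_real_derivative D i x) (at 0)"
    and H: "\<And>i j x. i \<in> Basis \<Longrightarrow> j \<in> Basis \<Longrightarrow> x \<in> S \<Longrightarrow> ((\<lambda>t. D i (x + t *\<^sub>R j)) has_real_derivative H i j x) (at 0)"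
    and c: "continuous_on S f" "\<And>i. i \<in> Basis \<Longrightarrow> continuous_on S (D i)"
      "\<And>i j. i \<in> Basis \<Longrightarrow> j \<in> Basis \<Longrightarrow> continuous_on S (H i j)"
  shows "f C2_on S" and "\<And>x. x \<in> S \<Longrightarrow> laplacian f x = (\<Sum>i\<in>Basis. H i i x)"
proof -
  note 1 = has_continuous_partials_onI[OF D c(2)]
  have P: "((\<lambda>t. partial i f (x + t *\<^sub>R j)) has_real_derivative H i j x) (at 0)"
    if "i \<in> Basis" "j \<in> Basis" "x \<in> S" for i j x
    using that 1(2) by (intro has_real_derivative_line_cong[OF S that(3) _ H]) auto
  have 2: "partial i f has_continuous_partials_on S" "\<And>j x. j \<in> Basis \<Longrightarrow> x \<in> S \<Longrightarrow> partial j (partial i f) x = H i j x"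
    if "i \<in> Basis" for i
    using has_continuous_partials_onI[of S "partial i f" "H i"] P c(3) that by auto
  show "f C2_on S" unfolding C2_on_def using c(1) 1(1) 2(1) by auto
  show "laplacian f x = (\<Sum>i\<in>Basis. H i i x)" if "x \<in> S" for x
    unfolding laplacian_def using 2(2) that by (intro sum.cong) auto
qed

lemma norm_line_derivative:
  fixes y :: "'a::euclidean_space"
  assumes "y \<noteq> 0"
  shows "((\<lambda>t. norm (y + t *\<^sub>R i)) has_real_derivative (y \<bullet> i) / norm y) (at 0)"
proof -
  have pos: "y \<bullet> y > 0" using assms by simp
  have eq: "norm (y + t *\<^sub>R i) = sqrt (y \<bullet> y + 2 * t * (y \<bullet> i) + t\<^sup>2 * (i \<bullet> i))" for t
  proof -
    have "(y + t *\<^sub>R i) \<bullet> (y + t *\<^sub>R i) = y \<bullet> y + 2 * t * (y \<bullet> i) + t\<^sup>2 * (i \<bullet> i)"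
      by (simp add: inner_add_left inner_add_right inner_commute[of i y] power2_eq_square algebra_simps)
    then show ?thesis unfolding norm_eq_sqrt_inner[of "y + t *\<^sub>R i"] by (rule arg_cong)
  qed
  have "((\<lambda>t. y \<bullet> y + 2 * t * (y \<bullet> i) + t\<^sup>2 * (i \<bullet> i)) has_real_derivative 2 * (y \<bullet> i)) (at 0)"
    by (auto intro!: derivative_eq_intros)
  moreover have "(sqrt has_real_derivative inverse (sqrt (y \<bullet> y)) / 2) (at (y \<bullet> y + 2 * 0 * (y \<bullet> i) + 0\<^sup>2 * (i \<bullet> i)))"
    using DERIV_real_sqrt[OF pos] by simp
  ultimately have "((\<lambda>t. sqrt (y \<bullet> y + 2 * t * (y \<bullet> i) + t\<^sup>2 * (i \<bullet> i))) has_real_derivative inverse (sqrt (y \<bullet> y)) / 2 * (2 * (y \<bullet> i))) (at 0)"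
    by (rule DERIV_chain2[rotated])
  moreover have "inverse (sqrt (y \<bullet> y)) / 2 * (2 * (y \<bullet> i)) = (y \<bullet> i) / norm y"
    unfolding norm_eq_sqrt_inner[of y] by (simp add: inverse_eq_divide)
  ultimately show ?thesis unfolding eq by (simp only:)
qed

text \<open>\<open>D\<close> and \<open>H\<close> are the first and second partial derivatives, with
  \<open>h r\<close> equal to \<open>r\<close> times the derivative of \<open>W\<close>. The angular
  factor in \<open>H\<close> need not have a limit at the centre; the vanishing of \<open>h\<close>
  there makes \<open>H\<close> continuous.\<close>

lemma radial_C2_on:
  fixes c :: "'a::euclidean_space"
  assumes f: "continuous_on {0..R} f" and d: "DIM('a) = Suc d"
    and U: "\<And>r. 0 \<le> r \<Longrightarrow> r \<le> R \<Longrightarrow> U r = a - radial_int d f r"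
  shows "(\<lambda>x. U (norm (x - c))) C2_on ball c R"
    and "\<And>x. x \<in> ball c R \<Longrightarrow> laplacian (\<lambda>x. U (norm (x - c))) x = - f (norm (x - c))"
proof -
  define W where "W = ball_avg d f"
  define h where "h r = f r - (real d + 1) * W r" for r
  define D where "D i x = - (W (norm (x - c)) * ((x - c) \<bullet> i))" for i x :: 'a
  \<comment> \<open>At the centre the quotient is zero by the convention for division, so
    \<open>H i j c\<close> is \<open>- (W 0 * (j \<bullet> i))\<close>, the value that the
    difference quotient gives.\<close>
  define H where "H i j x = - (h (norm (x - c)) * (((x - c) \<bullet> i) * ((x - c) \<bullet> j) / (norm (x - c))\<^sup>2) + W (norm (x - c)) * (j \<bullet> i))" for i j x :: 'a
  have ball: "norm (x - c) < R" "0 \<le> norm (x - c)" if "x \<in> ball c R" for x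
    using that by (auto simp: dist_norm norm_minus_commute)
  have contW: "continuous_on {0..R} W" unfolding W_def by (rule continuous_on_ball_avg[OF f])
  have h0: "h 0 = 0"
  proof -
    have "W 0 = ball_avg d (\<lambda>_. f 0) 0" unfolding W_def ball_avg_def by simp
    then show ?thesis by (simp add: h_def ball_avg_const)
  qed
  have contU: "continuous_on {0..R} U"
    by (rule continuous_on_eq[of _ "\<lambda>r. a - radial_int d f r"])
       (use U in \<open>auto intro!: continuous_intros continuous_on_radial_int f\<close>)
  have comp: "continuous_on (ball c R) (\<lambda>x. g (norm (x - c)))" if "continuous_on {0..R} g" for g :: "real \<Rightarrow> real"
  proof (rule continuous_on_compose2[OF that])
    show "(\<lambda>x. norm (x - c)) ` ball c R \<subseteq> {0..R}" using ball by fastforce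
  qed (intro continuous_intros)
  have U_deriv: "(U has_real_derivative - (r * W r)) (at r)" if r: "0 < r" "r < R" for r
  proof -
    have "((\<lambda>r. a - radial_int d f r) has_real_derivative - (r * W r)) (at r)"
      using DERIV_diff[OF DERIV_const radial_int_derivative[OF f r], of a d] by (simp add: W_def)
    then show ?thesis
      by (rule has_field_derivative_transform_within_open[of _ _ _ "{0<..<R}"]) (use U r in auto)
  qed
  have W_deriv: "(W has_real_derivative h r / r) (at r)" if r: "0 < r" "r < R" for r
    using ball_avg_derivative[OF f r, of d] by (simp add: W_def h_def)
  have first: "((\<lambda>t. U (norm (x + t *\<^sub>R i - c))) has_real_derivative D i x) (at 0)"
    if i: "i \<in> Basis" and x: "x \<in> ball c R" for i x
  proof (cases "x = c")
    case False
    define y where "y = x - c"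
    have y: "y \<noteq> 0" "norm y < R" using False ball[OF x] by (auto simp: y_def)
    have "((\<lambda>t. U (norm (y + t *\<^sub>R i))) has_real_derivative - (norm y * W (norm y)) * ((y \<bullet> i) / norm y)) (at 0)"
      by (rule DERIV_chain2[OF _ norm_line_derivative[OF y(1)]]) (use U_deriv y in simp)
    moreover have eq: "x + t *\<^sub>R i - c = y + t *\<^sub>R i" for t by (simp add: y_def)
    ultimately show ?thesis using y unfolding eq by (simp add: D_def y_def[symmetric])
  next
    case True
    have R: "R > 0" using x zero_le_dist[of c x] unfolding mem_ball by linarith
    have n: "norm i = 1" using i by simp
    obtain M where M: "\<And>r. r \<in> {0..R} \<Longrightarrow> \<bar>f r\<bar> \<le> M"
      using compact_imp_bounded[OF compact_continuous_image[OF f]] unfolding bounded_iff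
      by (metis compact_Icc imageI real_norm_def)
    \<comment> \<open>Through the centre the function along a line is
      \<open>U \<bar>t\<bar>\<close>; the quadratic bound on its increment makes its derivative at
      zero vanish.\<close>
    have est: "\<bar>U \<bar>t\<bar> - U 0\<bar> \<le> M * t\<^sup>2" if t: "\<bar>t\<bar> < R" for t
    proof -
      have c: "continuous_on {0..\<bar>t\<bar>} f" using t by (auto intro: continuous_on_subset[OF f])
      have "- M \<le> f x" "f x \<le> M" if "x \<in> {0..\<bar>t\<bar>}" for x using M[of x] t that by auto
      then have "(-M) * \<bar>t\<bar>\<^sup>2 / (2 * (real d + 1)) \<le> radial_int d f \<bar>t\<bar>" "radial_int d f \<bar>t\<bar> \<le> M * \<bar>t\<bar>\<^sup>2 / (2 * (real d + 1))"
        by (intro radial_int_ge radial_int_le c; simp)+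
      then have "\<bar>radial_int d f \<bar>t\<bar>\<bar> \<le> M * t\<^sup>2 / (2 * (real d + 1))" by (simp add: abs_le_iff)
      also have "\<dots> \<le> M * t\<^sup>2 / 1" using M[of 0] R by (intro divide_left_mono) auto
      finally show ?thesis using U[of "\<bar>t\<bar>"] U[of 0] t R by simp
    qed
    have "((\<lambda>t. U \<bar>t\<bar>) has_real_derivative 0) (at 0)"
      unfolding DERIV_def
    proof (rule Lim_null_comparison)
      show "\<forall>\<^sub>F t in at 0. norm ((U \<bar>0 + t\<bar> - U \<bar>0\<bar>) / t) \<le> M * \<bar>t\<bar>"
        unfolding eventually_at
      proof (intro exI[of _ R] conjI ballI impI R)
        fix t :: real assume "t \<noteq> 0 \<and> dist t 0 < R"
        then show "norm ((U \<bar>0 + t\<bar> - U \<bar>0\<bar>) / t) \<le> M * \<bar>t\<bar>"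
          using est[of t] by (simp add: dist_real_def divide_le_eq power2_eq_square mult.assoc)
      qed
      show "((\<lambda>t. M * \<bar>t\<bar>) \<longlongrightarrow> 0) (at (0::real))" by (auto intro!: tendsto_eq_intros)
    qed
    then show ?thesis using True n by (simp add: D_def)
  qed
  have second: "((\<lambda>t. D i (x + t *\<^sub>R j)) has_real_derivative H i j x) (at 0)"
    if i: "i \<in> Basis" "j \<in> Basis" and x: "x \<in> ball c R" for i j x
  proof (cases "x = c")
    case False
    define y where "y = x - c"
    have y: "y \<noteq> 0" "norm y < R" using False ball[OF x] by (auto simp: y_def)
    have 1: "((\<lambda>t. W (norm (y + t *\<^sub>R j))) has_real_derivative (h (norm y) / norm y) * ((y \<bullet> j) / norm y)) (at 0)"
      by (rule DERIV_chain2[OF _ norm_line_derivative[OF y(1)]]) (use W_deriv y in simp)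
    have 2: "((\<lambda>t. (y + t *\<^sub>R j) \<bullet> i) has_real_derivative j \<bullet> i) (at 0)"
      by (auto intro!: derivative_eq_intros simp: inner_add_left)
    have "((\<lambda>t. - (W (norm (y + t *\<^sub>R j)) * ((y + t *\<^sub>R j) \<bullet> i))) has_real_derivative
       - ((h (norm y) / norm y) * ((y \<bullet> j) / norm y) * ((y + 0 *\<^sub>R j) \<bullet> i) + (j \<bullet> i) * W (norm (y + 0 *\<^sub>R j)))) (at 0)"
      by (rule DERIV_minus[OF DERIV_mult[OF 1 2]])
    moreover have eq: "x + t *\<^sub>R j - c = y + t *\<^sub>R j" for t by (simp add: y_def)
    ultimately show ?thesis unfolding D_def H_def eq by (simp add: y_def[symmetric] power2_eq_square mult.commute mult.left_commute)
  next
    case True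
    have R: "R > 0" using x zero_le_dist[of c x] unfolding mem_ball by linarith
    have n: "norm j = 1" using i by simp
    have "((\<lambda>t. - (W \<bar>t\<bar> * (j \<bullet> i))) \<longlongrightarrow> - (W 0 * (j \<bullet> i))) (at (0::real))"
    proof -
      have "continuous_on (ball 0 R) (\<lambda>t::real. W \<bar>t\<bar>)"
        by (rule continuous_on_compose2[OF contW]) (auto intro!: continuous_intros simp: dist_real_def)
      then have "isCont (\<lambda>t. W \<bar>t\<bar>) 0" using R continuous_on_eq_continuous_at[of "ball 0 R"] by force
      then have "((\<lambda>t. W \<bar>t\<bar>) \<longlongrightarrow> W 0) (at (0::real))" by (simp add: isCont_def)
      then show ?thesis by (intro tendsto_intros)
    qed
    then have "((\<lambda>t. (D i (c + (0 + t) *\<^sub>R j) - D i (c + 0 *\<^sub>R j)) / t) \<longlongrightarrow> - (W 0 * (j \<bullet> i))) (at 0)"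
      by (rule Lim_transform_eventually) (use n in \<open>auto simp: eventually_at_filter D_def\<close>)
    then show ?thesis unfolding DERIV_def using True by (simp add: H_def)
  qed
  have contD: "continuous_on (ball c R) (D i)" for i
    unfolding D_def[abs_def] by (intro continuous_intros comp contW)
  have contH: "continuous_on (ball c R) (H i j)" if "i \<in> Basis" "j \<in> Basis" for i j
  proof -
    define m where "m x = ((x - c) \<bullet> i) * ((x - c) \<bullet> j) / (norm (x - c))\<^sup>2" for x
    have m: "\<bar>m x\<bar> \<le> 1" for x
    proof -
      have "\<bar>(x - c) \<bullet> i\<bar> * \<bar>(x - c) \<bullet> j\<bar> \<le> norm (x - c) * norm (x - c)"
        using that by (intro mult_mono Basis_le_norm) auto
      then show ?thesis by (auto simp: m_def abs_mult power2_eq_square divide_le_eq_1 zero_less_mult_iff)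
    qed
    have "continuous_on {0..R} h" unfolding h_def[abs_def] by (intro continuous_intros f contW)
    note hc = comp[OF this]
    have hm: "continuous_on (ball c R) (\<lambda>x. h (norm (x - c)) * m x)"
    proof (rule continuous_at_imp_continuous_on, rule ballI)
      fix x assume x: "x \<in> ball c R"
      have hx: "isCont (\<lambda>x. h (norm (x - c))) x" using hc x continuous_on_eq_continuous_at[of "ball c R"] by blast
      show "isCont (\<lambda>x. h (norm (x - c)) * m x) x"
      proof (cases "x = c")
        case True
        have "((\<lambda>x. h (norm (x - c)) * m x) \<longlongrightarrow> 0) (at c)"
        proof (rule Lim_null_comparison)
          show "\<forall>\<^sub>F x in at c. norm (h (norm (x - c)) * m x) \<le> \<bar>h (norm (x - c))\<bar>"
            using m by (intro always_eventually allI) (simp add: abs_mult mult_left_le)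
          show "((\<lambda>x. \<bar>h (norm (x - c))\<bar>) \<longlongrightarrow> 0) (at c)"
            using hx True h0 by (auto simp: isCont_def intro!: tendsto_rabs_zero)
        qed
        then show ?thesis using True h0 by (simp add: isCont_def)
      next
        case False
        have "isCont m x" unfolding m_def using False by (intro continuous_intros) auto
        then show ?thesis by (intro continuous_intros hx)
      qed
    qed
    have "continuous_on (ball c R) (\<lambda>x. - (h (norm (x - c)) * m x + W (norm (x - c)) * (j \<bullet> i)))"
      by (intro continuous_on_minus continuous_on_add hm continuous_on_mult continuous_on_const comp contW)
    then show ?thesis unfolding H_def[abs_def] m_def .
  qed
  note C2 = C2_onI[of "ball c R" "\<lambda>x. U (norm (x - c))" D H, OF open_ball first second comp[OF contU] contD contH]
  show "(\<lambda>x. U (norm (x - c))) C2_on ball c R" by (rule C2(1))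
  fix x assume x: "x \<in> ball c R"
  have "laplacian (\<lambda>x. U (norm (x - c))) x = (\<Sum>i\<in>Basis. H i i x)" by (rule C2(2)) (use x in auto)
  also have "\<dots> = - (h (norm (x - c)) * ((\<Sum>i\<in>Basis. ((x - c) \<bullet> i) * ((x - c) \<bullet> i)) / (norm (x - c))\<^sup>2) + W (norm (x - c)) * (\<Sum>i\<in>(Basis::'a set). i \<bullet> i))"
    unfolding H_def by (simp only: sum_negf sum.distrib sum_distrib_left sum_divide_distrib)
  also have "(\<Sum>i\<in>Basis. ((x - c) \<bullet> i) * ((x - c) \<bullet> i)) = (norm (x - c))\<^sup>2"
    by (simp add: power2_norm_eq_inner euclidean_inner[symmetric])
  also have "(\<Sum>i\<in>(Basis::'a set). i \<bullet> i) = real d + 1" using d by (simp add: inner_Basis)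
  also have "h (norm (x - c)) * ((norm (x - c))\<^sup>2 / (norm (x - c))\<^sup>2) = h (norm (x - c))" using h0 by (cases "x = c") auto
  finally show "laplacian (\<lambda>x. U (norm (x - c))) x = - f (norm (x - c))" by (simp add: h_def algebra_simps)
qed

section \<open>From solutions in a ball to radial profiles\<close>

lemma lane_emden_normalized:
  fixes c :: "'a::euclidean_space"
  assumes s: "lane_emden_solution (ball c R) p q u v" and R: "R > 0" and pq: "p > 0" "q > 0"
  shows "normalized_solution (R\<^sup>2) p q (\<lambda>x. u (c + R *\<^sub>R x)) (\<lambda>x. v (c + R *\<^sub>R x))"
proof -
  have B: "closure (ball c R) = cball c R" "frontier (ball c R) = sphere c R"
    using R by (simp_all add: frontier_ball)
  have in_ball: "c + R *\<^sub>R x \<in> ball c R" if "norm x < 1" for x using that R by (simp add: dist_norm)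
  have lap: "\<exists>g. laplace_at (\<lambda>x. w (c + R *\<^sub>R x)) g (R\<^sup>2 * laplacian w (c + R *\<^sub>R x)) x"
    if w: "w C2_on ball c R" and x: "norm x < 1" for w x
  proof -
    obtain g where "laplace_at w g (laplacian w (c + R *\<^sub>R x)) (c + R *\<^sub>R x)"
      using C2_on_laplace_at[OF w open_ball in_ball[OF x]] by blast
    then have "laplace_at (\<lambda>y. w (c + y)) g (laplacian w (c + R *\<^sub>R x)) (R *\<^sub>R x)"
      by (simp add: laplace_at_shift)
    from laplace_at_scale[OF this] show ?thesis by blast
  qed
  have cont: "continuous_on (cball 0 1) (\<lambda>x. w (c + R *\<^sub>R x))" if "continuous_on (cball c R) w" for w :: "'a \<Rightarrow> real"
    by (rule continuous_on_compose2[OF that])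
       (use R in \<open>auto simp: dist_norm intro!: continuous_intros\<close>)
  show ?thesis
  proof
    show "R\<^sup>2 > 0" using R by simp
    show "p > 0" "q > 0" by (rule pq)+
    show "continuous_on (cball 0 1) (\<lambda>x. u (c + R *\<^sub>R x))" "continuous_on (cball 0 1) (\<lambda>x. v (c + R *\<^sub>R x))"
      using s B by (auto simp: lane_emden_solution_def intro!: cont)
  next
    fix x :: 'a assume x: "norm x < 1"
    have "laplacian u (c + R *\<^sub>R x) = - (v (c + R *\<^sub>R x) powr q)" "laplacian v (c + R *\<^sub>R x) = - (u (c + R *\<^sub>R x) powr p)"
      using s in_ball[OF x] by (auto simp: lane_emden_solution_def eq_neg_iff_add_eq_0)
    then show "\<exists>g. laplace_at (\<lambda>x. u (c + R *\<^sub>R x)) g (- R\<^sup>2 * v (c + R *\<^sub>R x) powr q) x"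
      "\<exists>g. laplace_at (\<lambda>x. v (c + R *\<^sub>R x)) g (- R\<^sup>2 * u (c + R *\<^sub>R x) powr p) x"
      using lap[of u x] lap[of v x] s x by (simp_all add: lane_emden_solution_def)
    show "0 < u (c + R *\<^sub>R x)" "0 < v (c + R *\<^sub>R x)"
      using s in_ball[OF x] by (auto simp: lane_emden_solution_def)
  next
    fix x :: 'a assume x: "norm x = 1"
    then have "c + R *\<^sub>R x \<in> frontier (ball c R)" unfolding B using R by (simp add: dist_norm)
    then show "u (c + R *\<^sub>R x) = 0" "v (c + R *\<^sub>R x) = 0" using s by (auto simp: lane_emden_solution_def)
  qed
qed

lemma lane_emden_swap: "lane_emden_solution B p q u v \<Longrightarrow> lane_emden_solution B q p v u"
  by (auto simp: lane_emden_solution_def)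

lemma lane_emden_radial:
  fixes c :: "'a::euclidean_space"
  assumes s: "lane_emden_solution (ball c R) p q u v" and R: "R > 0" and pq: "p > 0" "q > 0"
    and xy: "norm x = norm y" "norm x \<le> R"
  shows "u (c + x) = u (c + y)"
proof -
  interpret normalized_solution "R\<^sup>2" p q "\<lambda>x. u (c + R *\<^sub>R x)" "\<lambda>x. v (c + R *\<^sub>R x)"
    by (rule lane_emden_normalized[OF s R pq])
  show ?thesis using radial[of "x /\<^sub>R R" "y /\<^sub>R R"] xy R by (simp add: field_simps)
qed

lemma lane_emden_radial_strictly_decreasing:
  fixes c :: "'a::euclidean_space"
  assumes s: "lane_emden_solution (ball c R) p q u v" and R: "R > 0" and pq: "p > 0" "q > 0"
  shows "radial_strictly_decreasing c R u"
proof -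
  interpret normalized_solution "R\<^sup>2" p q "\<lambda>x. u (c + R *\<^sub>R x)" "\<lambda>x. v (c + R *\<^sub>R x)"
    by (rule lane_emden_normalized[OF s R pq])
  obtain i :: 'a where i: "i \<in> Basis" using nonempty_Basis by blast
  then have n: "norm i = 1" by simp
  show ?thesis unfolding radial_strictly_decreasing_def
  proof (intro exI[of _ "\<lambda>r. u (c + r *\<^sub>R i)"] conjI ballI)
    fix x assume "x \<in> cball c R"
    then show "u x = u (c + dist c x *\<^sub>R i)"
      using lane_emden_radial[OF s R pq, of "x - c" "dist c x *\<^sub>R i"] n
      by (simp add: dist_norm norm_minus_commute)
  next
    show "strict_antimono_on {0..R} (\<lambda>r. u (c + r *\<^sub>R i))"
    proof (rule monotone_onI)
      fix r t assume rt: "r \<in> {0..R}" "t \<in> {0..R}" "r < t"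
      have "0 \<le> r / R" "r / R < t / R" "t / R \<le> 1" using rt R by (auto simp: divide_strict_right_mono)
      from strictly_decreasing[OF n this] show "u (c + r *\<^sub>R i) > u (c + t *\<^sub>R i)" using R by simp
    qed
  qed
qed

text \<open>The difference is locally constant, so it and its negative both have a local minimum at
  \<open>x\<close>.\<close>

lemma laplace_at_unique_local:
  assumes 1: "laplace_at f g L x" and 2: "laplace_at f' g' L' x" and eq: "\<forall>\<^sub>F y in nhds x. f y = f' y"
  shows "L = L'"
proof -
  have x: "f x = f' x" using eq by (rule eventually_nhds_x_imp_x)
  have "\<forall>\<^sub>F y in nhds x. f x - f' x \<le> f y - f' y" "\<forall>\<^sub>F y in nhds x. f' x - f x \<le> f' y - f y"
    using eq by (eventually_elim; use x in simp)+
  then have "L - L' \<ge> 0" "L' - L \<ge> 0"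
    using laplace_at_local_min[OF laplace_at_diff[OF 1 2]] laplace_at_local_min[OF laplace_at_diff[OF 2 1]] by blast+
  then show ?thesis by simp
qed

definition ball_sol :: "nat \<Rightarrow> real \<Rightarrow> real \<Rightarrow> real \<Rightarrow> (real \<Rightarrow> real) \<Rightarrow> (real \<Rightarrow> real) \<Rightarrow> bool" where
  "ball_sol d p q R U V \<longleftrightarrow> 0 < R \<and> radial_sol d p q R U V \<and> U R = 0 \<and> V R = 0 \<and>
     (\<forall>r. 0 \<le> r \<and> r < R \<longrightarrow> 0 < U r \<and> 0 < V r)"

text \<open>By symmetry the equation restricts to an ordinary differential equation on the ray in
  direction \<open>i\<close>; the factor \<open>r ^ d\<close> integrates it to the formula with
  \<open>ball_avg\<close>. Derivatives exist only inside the ball, and the endpoint \<open>R\<close>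
  is reached by continuity.\<close>

lemma lane_emden_profile:
  fixes c :: "'a::euclidean_space"
  assumes s: "lane_emden_solution (ball c R) p q u v" and R: "R > 0" and pq: "p > 0" "q > 0"
    and d: "DIM('a) = Suc d" and i: "i \<in> Basis" and r: "0 \<le> r" "r \<le> R"
  shows "u (c + r *\<^sub>R i) = u c - radial_int d (\<lambda>s. ppow q (v (c + s *\<^sub>R i))) r"
proof -
  have n: "norm i = 1" using i by simp
  have in_ball: "c + r *\<^sub>R i \<in> ball c R" if "\<bar>r\<bar> < R" for r using that n by (simp add: dist_norm)
  have u2: "u C2_on ball c R" using s by (simp add: lane_emden_solution_def)
  define U where "U r = u (c + r *\<^sub>R i)" for r
  define f where "f r = ppow q (v (c + r *\<^sub>R i))" for r
  define P where "P r = partial i u (c + r *\<^sub>R i)" for r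
  define P' where "P' r = partial i (partial i u) (c + r *\<^sub>R i)" for r
  have radial: "u (c + x) = U (norm x)" if "norm x \<le> R" for x
    using lane_emden_radial[OF s R pq, of x "norm x *\<^sub>R i"] that n by (simp add: U_def)
  have U_deriv: "(U has_real_derivative P r) (at r)" and P_deriv: "(P has_real_derivative P' r) (at r)" if r: "\<bar>r\<bar> < R" for r
    unfolding U_def[abs_def] P_def[abs_def] P'_def
    using u2 i in_ball[OF r] by (auto simp: C2_on_def intro!: has_continuous_partials_line)
  have cl: "closure (ball c R) = cball c R" using R by simp
  have cont: "continuous_on {0..R} (\<lambda>r. w (c + r *\<^sub>R i))" if "continuous_on (cball c R) w" for w :: "'a \<Rightarrow> real"
    by (rule continuous_on_compose2[OF that]) (use n in \<open>auto simp: dist_norm intro!: continuous_intros\<close>)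
  have contf: "continuous_on {0..R} f" unfolding f_def[abs_def] using s cl pq
    by (intro continuous_on_ppow cont) (auto simp: lane_emden_solution_def)
  have contU: "continuous_on {0..R} U" unfolding U_def[abs_def] using s cl
    by (intro cont) (auto simp: lane_emden_solution_def)
  \<comment> \<open>Symmetry makes the profile even across the centre, so its slope there
    vanishes.\<close>
  have P0: "P 0 = 0"
  proof -
    have "U (- t) = U t" if "\<bar>t\<bar> < R" for t
      using radial[of "t *\<^sub>R i"] radial[of "(- t) *\<^sub>R i"] that n by (simp add: U_def)
    then have even: "U t = U (- t)" if "t \<in> {-R<..<R}" for t using that by auto
    have U0: "(U has_real_derivative P 0) (at 0)" using U_deriv[of 0] R by simp
    have "((\<lambda>t. U (- t)) has_real_derivative P 0) (at 0)"
      by (rule has_field_derivative_transform_within_open[of U "P 0" 0 "{-R<..<R}", OF U0 _ _ even]) (use R in auto)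
    moreover have "((\<lambda>t. U (- t)) has_real_derivative P 0 * (- 1)) (at 0)"
      by (rule DERIV_chain2[of U]) (use U0 in \<open>auto intro!: derivative_eq_intros\<close>)
    ultimately have "P 0 = P 0 * (- 1)" by (rule DERIV_unique)
    then show ?thesis by simp
  qed
  have ode: "P' r + real d / r * P r = - f r" if r: "0 < r" "r < R" for r
  proof -
    define x where "x = r *\<^sub>R i"
    have x: "x \<noteq> 0" "norm x = r" using r n by (auto simp: x_def)
    have "\<forall>\<^sub>F t in nhds r. (U has_real_derivative P t) (at t)"
      using eventually_nhds_in_open[of "{0<..<R}" r] r by (auto elim!: eventually_mono intro!: U_deriv)
    then have "laplace_at U (P r) (P' r) (norm x)" unfolding x by (rule laplace_at_real) (use P_deriv r in simp)
    from laplace_at_radial[OF x(1) this] d x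
    obtain g where 1: "laplace_at (\<lambda>y. U (norm y)) g (P' r + real d / r * P r) x" by auto
    have cx: "c + x \<in> ball c R" using in_ball[of r] r by (simp add: x_def)
    have 2: "laplace_at (\<lambda>y. u (c + y)) (\<Sum>i\<in>Basis. partial i u (c + x) *\<^sub>R i) (laplacian u (c + x)) x"
      unfolding laplace_at_shift by (rule C2_on_laplace_at[OF u2 open_ball cx])
    have "\<forall>\<^sub>F y in nhds x. U (norm y) = u (c + y)"
      using eventually_nhds_in_open[of "ball 0 R" x] x r by (auto elim!: eventually_mono simp: radial)
    from laplace_at_unique_local[OF 1 2 this] have "P' r + real d / r * P r = laplacian u (c + x)" .
    also have "\<dots> = - (v (c + x) powr q)" using s cx by (auto simp: lane_emden_solution_def eq_neg_iff_add_eq_0)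
    also have "v (c + x) > 0" using s cx by (auto simp: lane_emden_solution_def)
    then have "v (c + x) powr q = f r" by (simp add: f_def x_def ppow_nonneg_eq)
    finally show ?thesis .
  qed
  define W where "W = ball_avg d f"
  have P_eq: "P r = - (r * W r)" if r: "0 < r" "r < R" for r
  proof -
    define H where "H r = r ^ d * P r + r ^ Suc d * W r" for r
    have "H r = H 0"
    proof (rule DERIV_isconst_end[OF r(1)])
      have "continuous_on {0..r} P"
        by (rule DERIV_continuous_on[where D = P']) (use r in \<open>auto intro!: has_field_derivative_at_within[OF P_deriv]\<close>)
      moreover have "continuous_on {0..r} W"
        unfolding W_def using r by (intro continuous_on_ball_avg continuous_on_subset[OF contf]) auto
      ultimately show "continuous_on {0..r} H" unfolding H_def[abs_def] by (intro continuous_intros)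
      fix x assume x: "0 < x" "x < r"
      have "((\<lambda>r. r ^ d * P r) has_real_derivative real d * x ^ (d - Suc 0) * P x + P' x * x ^ d) (at x)"
        using x r by (intro DERIV_mult DERIV_pow P_deriv) auto
      moreover have "((\<lambda>r. r ^ Suc d * W r) has_real_derivative x ^ d * f x) (at x)"
        unfolding W_def by (rule ball_avg_weighted_derivative[OF contf]) (use x r in auto)
      ultimately have "(H has_real_derivative (real d * x ^ (d - Suc 0) * P x + P' x * x ^ d) + x ^ d * f x) (at x)"
        unfolding H_def[abs_def] by (rule DERIV_add)
      moreover have "real d * x ^ (d - Suc 0) = x ^ d * (real d / x)" using x by (cases d) auto
      then have "(real d * x ^ (d - Suc 0) * P x + P' x * x ^ d) + x ^ d * f x = x ^ d * (P' x + real d / x * P x + f x)"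
        by (simp add: algebra_simps)
      then have "(real d * x ^ (d - Suc 0) * P x + P' x * x ^ d) + x ^ d * f x = 0"
        using ode[of x] x r by simp
      ultimately show "(H has_real_derivative 0) (at x)" by (simp only:)
    qed
    \<comment> \<open>For \<open>d = 0\<close> the factor \<open>0 ^ d\<close> is one, and it is
      \<open>P0\<close> that makes the first term vanish.\<close>
    also have "H 0 = 0" by (simp add: H_def P0)
    finally have "r ^ d * (P r + r * W r) = 0" by (simp add: H_def algebra_simps)
    then show ?thesis using r by simp
  qed
  show ?thesis
  proof (cases "r = 0")
    case False
    have "U r + radial_int d f r = U 0 + radial_int d f 0"
    proof (rule DERIV_isconst_end[of 0 r "\<lambda>r. U r + radial_int d f r"])
      show "0 < r" using r False by simp
      show "continuous_on {0..r} (\<lambda>r. U r + radial_int d f r)"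
        using r by (intro continuous_on_add continuous_on_subset[OF contU] continuous_on_subset[OF continuous_on_radial_int[OF contf]]) auto
      fix x assume x: "0 < x" "x < r"
      then have "(U has_real_derivative - (x * W x)) (at x)" using U_deriv[of x] P_eq[of x] r by simp
      from DERIV_add[OF this radial_int_derivative[OF contf, of x d]] x r
      show "((\<lambda>r. U r + radial_int d f r) has_real_derivative 0) (at x)" by (simp add: W_def)
    qed
    then show ?thesis by (simp add: U_def f_def[abs_def])
  qed simp
qed

lemma lane_emden_ball_sol:
  fixes c :: "'a::euclidean_space"
  assumes s: "lane_emden_solution (ball c R) p q u v" and R: "R > 0" and pq: "p > 0" "q > 0"
    and d: "DIM('a) = Suc d" and i: "i \<in> Basis"
  shows "ball_sol d p q R (\<lambda>r. u (c + r *\<^sub>R i)) (\<lambda>r. v (c + r *\<^sub>R i))"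
  unfolding ball_sol_def
proof (intro conjI allI impI R)
  have n: "norm i = 1" using i by simp
  have cl: "closure (ball c R) = cball c R" "frontier (ball c R) = sphere c R" using R by (simp_all add: frontier_ball)
  have cont: "continuous_on {0..R} (\<lambda>r. w (c + r *\<^sub>R i))" if "continuous_on (cball c R) w" for w :: "'a \<Rightarrow> real"
    by (rule continuous_on_compose2[OF that]) (use n in \<open>auto simp: dist_norm intro!: continuous_intros\<close>)
  show "radial_sol d p q R (\<lambda>r. u (c + r *\<^sub>R i)) (\<lambda>r. v (c + r *\<^sub>R i))"
  proof (rule radial_solI)
    show "continuous_on {0..R} (\<lambda>r. u (c + r *\<^sub>R i))" "continuous_on {0..R} (\<lambda>r. v (c + r *\<^sub>R i))"
      using s cl by (auto simp: lane_emden_solution_def intro!: cont)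
    fix r assume r: "0 \<le> r" "r \<le> R"
    show "u (c + r *\<^sub>R i) = u (c + 0 *\<^sub>R i) - radial_int d (\<lambda>s. ppow q (v (c + s *\<^sub>R i))) r"
      using lane_emden_profile[OF s R pq d i r] by simp
    show "v (c + r *\<^sub>R i) = v (c + 0 *\<^sub>R i) - radial_int d (\<lambda>s. ppow p (u (c + s *\<^sub>R i))) r"
      using lane_emden_profile[OF lane_emden_swap[OF s] R pq(2,1) d i r] by simp
  qed
  have "c + R *\<^sub>R i \<in> frontier (ball c R)" unfolding cl using R n by (simp add: dist_norm)
  then show "u (c + R *\<^sub>R i) = 0" "v (c + R *\<^sub>R i) = 0" using s by (auto simp: lane_emden_solution_def)
  fix r assume "0 \<le> r \<and> r < R"
  then have "c + r *\<^sub>R i \<in> ball c R" using n by (simp add: dist_norm)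
  then show "0 < u (c + r *\<^sub>R i)" "0 < v (c + r *\<^sub>R i)" using s by (auto simp: lane_emden_solution_def)
qed

lemma ball_sol_lane_emden:
  fixes c :: "'a::euclidean_space"
  assumes s: "ball_sol d p q R U V" and d: "DIM('a) = Suc d" and pq: "p > 0" "q > 0"
  shows "lane_emden_solution (ball c R) p q (\<lambda>x. U (norm (x - c))) (\<lambda>x. V (norm (x - c)))"
proof -
  have R: "R > 0" and rs: "radial_sol d p q R U V" and z: "U R = 0" "V R = 0"
    and pos: "\<And>r. 0 \<le> r \<Longrightarrow> r < R \<Longrightarrow> 0 < U r \<and> 0 < V r"
    using s unfolding ball_sol_def by blast+
  have cl: "closure (ball c R) = cball c R" "frontier (ball c R) = sphere c R" using R by (simp_all add: frontier_ball)
  have b: "0 < U (norm (x - c))" "0 < V (norm (x - c))" if "x \<in> ball c R" for x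
    using pos[of "norm (x - c)"] that by (simp_all add: dist_norm norm_minus_commute)
  have comp: "continuous_on (cball c R) (\<lambda>x. g (norm (x - c)))" if "continuous_on {0..R} g" for g :: "real \<Rightarrow> real"
    by (rule continuous_on_compose2[OF that]) (auto intro!: continuous_intros simp: dist_norm norm_minus_commute)
  note u = radial_C2_on[OF radial_sol_continuous[OF rs pq(2)] d radial_sol_eq[OF rs]]
    and v = radial_C2_on[OF radial_sol_continuous[OF radial_sol_swap[OF rs] pq(1)] d radial_sol_eq[OF radial_sol_swap[OF rs]]]
  show ?thesis unfolding lane_emden_solution_def cl
  proof (intro conjI ballI)
    show "(\<lambda>x. U (norm (x - c))) C2_on ball c R" "(\<lambda>x. V (norm (x - c))) C2_on ball c R" by (rule u(1) v(1); assumption)+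
    show "continuous_on (cball c R) (\<lambda>x. U (norm (x - c)))" "continuous_on (cball c R) (\<lambda>x. V (norm (x - c)))"
      by (intro comp continuous_on_radial_sol[OF rs order_refl])+
    fix x assume x: "x \<in> ball c R"
    show "0 < U (norm (x - c))" "0 < V (norm (x - c))" by (rule b[OF x])+
    show "laplacian (\<lambda>x. U (norm (x - c))) x + V (norm (x - c)) powr q = 0"
      using u(2)[OF _ _ x] b[OF x] by (simp add: ppow_nonneg_eq)
    show "laplacian (\<lambda>x. V (norm (x - c))) x + U (norm (x - c)) powr p = 0"
      using v(2)[OF _ _ x] b[OF x] by (simp add: ppow_nonneg_eq)
  qed (use z in \<open>auto simp: dist_norm norm_minus_commute\<close>)
qed

section \<open>Scaling and uniqueness of the profile\<close>

lemma radial_int_scale: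
  assumes f: "continuous_on {0..l * r} f" and l: "l > 0" and r: "0 \<le> r"
  shows "radial_int d f (l * r) = l\<^sup>2 * radial_int d (\<lambda>s. f (l * s)) r"
proof -
  have "((\<lambda>s. l *\<^sub>R ((l * s) * ball_avg d f (l * s))) has_integral integral {l * 0..l * r} (\<lambda>s. s * ball_avg d f s)) {0..r}"
    by (rule has_integral_substitution[where c = 0 and d = "l * r"])
       (use l r in \<open>auto intro!: derivative_eq_intros radial_int_integrand f mult_left_mono\<close>)
  then have "integral {0..r} (\<lambda>s. l *\<^sub>R ((l * s) * ball_avg d f (l * s))) = integral {l * 0..l * r} (\<lambda>s. s * ball_avg d f s)"
    by (rule integral_unique)
  moreover have "(\<lambda>s. l *\<^sub>R ((l * s) * ball_avg d f (l * s))) = (\<lambda>s. l\<^sup>2 * (s * ball_avg d (\<lambda>s. f (l * s)) s))"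
    by (simp add: ball_avg_def power2_eq_square mult.assoc)
  ultimately show ?thesis
    by (simp only: radial_int_def integral_mult_right mult_zero_right)
qed

lemma ball_sol_scale:
  assumes s: "ball_sol d p q R U V" and pq: "p > 0" "q > 0" and l: "l > 0" and AB: "A > 0" "B > 0"
    and A: "A * l\<^sup>2 = B powr q" and B: "B * l\<^sup>2 = A powr p"
  shows "ball_sol d p q (R / l) (\<lambda>r. A * U (l * r)) (\<lambda>r. B * V (l * r))"
proof -
  have R: "R > 0" and rs: "radial_sol d p q R U V" and z: "U R = 0" "V R = 0"
    and pos: "\<And>r. 0 \<le> r \<Longrightarrow> r < R \<Longrightarrow> 0 < U r \<and> 0 < V r"
    using s unfolding ball_sol_def by blast+
  have ppow_mult: "ppow t (C * x) = C powr t * ppow t x" if "C > 0" for C t x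
  proof -
    have "max (C * x) 0 = C * max x 0" using that by (auto simp: max_def zero_le_mult_iff mult_le_0_iff)
    then show ?thesis using that by (simp add: ppow_def powr_mult)
  qed
  have rng: "0 \<le> l * r \<and> l * r \<le> R" if "0 \<le> r" "r \<le> R / l" for r
    using that l by (simp add: field_simps)
  have key: "A * U (l * r) = A * U 0 - radial_int d (\<lambda>s. ppow q (B * V (l * s))) r"
    if rs: "radial_sol d p q R U V" and q: "q > 0" and A: "A * l\<^sup>2 = B powr q" and B: "B > 0"
      and r: "0 \<le> r" "r \<le> R / l" for p q A B U V r
  proof -
    note lr = rng[OF r]
    have cf: "continuous_on {0..l * r} (\<lambda>s. ppow q (V s))"
      using lr by (intro continuous_on_subset[OF radial_sol_continuous[OF rs q]]) auto
    have cf': "continuous_on {0..r} (\<lambda>s. ppow q (V (l * s)))"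
      by (rule continuous_on_compose2[OF cf]) (use l in \<open>auto intro!: continuous_intros mult_left_mono\<close>)
    have "A * U (l * r) = A * U 0 - A * (l\<^sup>2 * radial_int d (\<lambda>s. ppow q (V (l * s))) r)"
      using radial_sol_eq[OF rs, of "l * r"] lr radial_int_scale[OF cf l r(1), of d] by (simp add: right_diff_distrib)
    also have "A * (l\<^sup>2 * radial_int d (\<lambda>s. ppow q (V (l * s))) r) = radial_int d (\<lambda>s. B powr q * ppow q (V (l * s))) r"
    proof -
      have "radial_int d (\<lambda>s. B powr q * ppow q (V (l * s))) r = B powr q * radial_int d (\<lambda>s. ppow q (V (l * s))) r"
        unfolding radial_int_def ball_avg_def integral_mult_right[symmetric]
        by (simp add: mult.left_commute)
      then show ?thesis by (simp add: A[symmetric])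
    qed
    finally show ?thesis by (simp add: ppow_mult[OF B])
  qed
  have cont: "continuous_on {0..R / l} (\<lambda>r. C * g (l * r))" if "continuous_on {0..R} g" for C and g :: "real \<Rightarrow> real"
    by (intro continuous_on_mult continuous_on_const continuous_on_compose2[OF that])
       (use rng in \<open>auto intro!: continuous_intros\<close>)
  show ?thesis unfolding ball_sol_def
  proof (intro conjI allI impI)
    show "radial_sol d p q (R / l) (\<lambda>r. A * U (l * r)) (\<lambda>r. B * V (l * r))"
    proof (rule radial_solI)
      show "continuous_on {0..R / l} (\<lambda>r. A * U (l * r))" "continuous_on {0..R / l} (\<lambda>r. B * V (l * r))"
        by (intro cont continuous_on_radial_sol[OF rs order_refl])+
      fix r assume r: "0 \<le> r" "r \<le> R / l"
      show "A * U (l * r) = A * U (l * 0) - radial_int d (\<lambda>s. ppow q (B * V (l * s))) r"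
        using key[OF rs pq(2) A AB(2) r] by simp
      show "B * V (l * r) = B * V (l * 0) - radial_int d (\<lambda>s. ppow p (A * U (l * s))) r"
        using key[OF radial_sol_swap[OF rs] pq(1) B AB(1) r] by simp
    qed
  next
    fix r assume "0 \<le> r \<and> r < R / l"
    then have "0 \<le> l * r" "l * r < R" using l by (auto simp: field_simps)
    then show "0 < A * U (l * r)" "0 < B * V (l * r)" using pos AB by auto
  qed (use R l z in auto)
qed

text \<open>The exponents of the two amplitudes solve a linear system: the one for \<open>U\<close>
  plus two is \<open>q\<close> times the one for \<open>V\<close>, and symmetrically with
  \<open>p\<close>. Its determinant is \<open>p * q - 1\<close> up to sign.\<close>

lemma scaling_exponents:
  fixes l p q :: real
  assumes pq: "p * q \<noteq> 1" and l: "l > 0"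
  shows "l powr (2 * (q + 1) / (p * q - 1)) * l\<^sup>2 = (l powr (2 * (p + 1) / (p * q - 1))) powr q"
proof -
  have "2 * (q + 1) / (p * q - 1) + 2 = 2 * (p + 1) / (p * q - 1) * q"
    using pq by (simp add: field_simps)
  then have "(l powr (2 * (p + 1) / (p * q - 1))) powr q = l powr (2 * (q + 1) / (p * q - 1) + 2)"
    by (simp add: powr_powr)
  also have "\<dots> = l powr (2 * (q + 1) / (p * q - 1)) * l\<^sup>2"
    using l by (simp add: powr_add)
  finally show ?thesis by simp
qed

lemma ball_sol_rescale:
  assumes s: "ball_sol d p q R U V" and pq: "p > 0" "q > 0" "p * q \<noteq> 1" and l: "l > 0"
  shows "ball_sol d p q (R / l) (\<lambda>r. l powr (2 * (q + 1) / (p * q - 1)) * U (l * r)) (\<lambda>r. l powr (2 * (p + 1) / (p * q - 1)) * V (l * r))"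
  using scaling_exponents[of p q l] scaling_exponents[of q p l] pq l
  by (intro ball_sol_scale[OF s]) (simp_all add: mult.commute[of q p])

text \<open>At the smaller radius one of the two orderings fails: if it is \<open>R1\<close>, then
  \<open>V1\<close> is zero while \<open>V2\<close> is nonnegative; if it is \<open>R2\<close>, then
  \<open>U2\<close> is zero while \<open>U1\<close> is still positive.\<close>

lemma ball_sol_comparison:
  assumes s1: "ball_sol d p q R1 U1 V1" and s2: "ball_sol d p q R2 U2 V2" and pq: "p > 0" "q > 0" and U0: "U1 0 = U2 0"
  shows "V1 0 \<le> V2 0"
proof (rule ccontr)
  assume "\<not> V1 0 \<le> V2 0"
  then have V0: "V2 0 < V1 0" by simp
  define T where "T = min R1 R2"
  have r: "radial_sol d p q T U1 V1" "radial_sol d p q T U2 V2" "0 \<le> T"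
    using s1 s2 unfolding ball_sol_def T_def by (auto intro: radial_sol_subset)
  have *: "V2 T < V1 T" "U1 T \<le> U2 T" using radial_sol_comparison[OF r(1,2) pq U0 V0, of T] r(3) by auto
  have e: "V1 R1 = 0" "U2 R2 = 0" "V2 R2 = 0" using s1 s2 by (auto simp: ball_sol_def)
  show False
  proof (cases "R1 \<le> R2")
    case True
    then have "V2 R1 \<ge> 0" using s1 s2 e by (cases "R1 = R2") (auto simp: ball_sol_def less_imp_le)
    then show ?thesis using True * e by (simp add: T_def)
  next
    case False
    then have "U1 R2 > 0" using s1 s2 by (auto simp: ball_sol_def)
    then show ?thesis using False * e by (simp add: T_def)
  qed
qed

text \<open>Uniqueness for the initial value problem covers the radii at which one of the solutions
  is positive, so different radii would contradict agreement at the smaller one; the endpoint is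
  settled by the boundary values.\<close>

lemma ball_sol_unique:
  assumes s1: "ball_sol d p q R1 U1 V1" and s2: "ball_sol d p q R2 U2 V2" and pq: "p > 0" "q > 0" and U0: "U1 0 = U2 0"
  shows "R1 = R2" and "\<And>r. 0 \<le> r \<Longrightarrow> r \<le> R1 \<Longrightarrow> U1 r = U2 r \<and> V1 r = V2 r"
proof -
  have V0: "V1 0 = V2 0"
    using ball_sol_comparison[OF s1 s2 pq U0] ball_sol_comparison[OF s2 s1 pq U0[symmetric]] by simp
  have agree: "U1 r = U2 r \<and> V1 r = V2 r"
    if s1: "ball_sol d p q R1 U1 V1" and s2: "ball_sol d p q R2 U2 V2" and i: "U1 0 = U2 0" "V1 0 = V2 0"
      and r: "0 \<le> r" "r < R1" "r \<le> R2" for R1 R2 r U1 U2 V1 V2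
  proof (rule radial_sol_unique[of d p q r U1 V1 U2 V2, OF _ _ pq i])
    show "radial_sol d p q r U1 V1" "radial_sol d p q r U2 V2"
      using s1 s2 r unfolding ball_sol_def by (auto intro: radial_sol_subset)
    show "U1 r > 0" "V1 r > 0" using s1 r by (auto simp: ball_sol_def)
  qed (use r in auto)
  have "\<not> R2 < R1"
  proof
    assume "R2 < R1"
    moreover have "0 \<le> R2" "U2 R2 = 0" using s2 by (auto simp: ball_sol_def)
    moreover have "0 < U1 R2" using s1 calculation by (auto simp: ball_sol_def)
    ultimately show False using agree[OF s1 s2 U0 V0, of R2] by simp
  qed
  moreover have "\<not> R1 < R2"
  proof
    assume "R1 < R2"
    moreover have "0 \<le> R1" "U1 R1 = 0" using s1 by (auto simp: ball_sol_def)
    moreover have "0 < U2 R1" using s2 calculation by (auto simp: ball_sol_def)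
    ultimately show False using agree[OF s2 s1 U0[symmetric] V0[symmetric], of R1] by simp
  qed
  ultimately show R: "R1 = R2" by simp
  fix r assume r: "0 \<le> r" "r \<le> R1"
  show "U1 r = U2 r \<and> V1 r = V2 r"
  proof (cases "r = R1")
    case True then show ?thesis using s1 s2 R by (simp add: ball_sol_def)
  next
    case False then show ?thesis using agree[OF s1 s2 U0 V0, of r] r R by simp
  qed
qed

text \<open>Dilating the second solution matches the values of \<open>U\<close> at the origin, which
  is possible because the exponent \<open>a\<close> is nonzero. Uniqueness then equates the radii
  \<open>R\<close> and \<open>R / l\<close>, and this forces \<open>l = 1\<close>.\<close>

lemma ball_sol_unique_radius:
  assumes s1: "ball_sol d p q R U1 V1" and s2: "ball_sol d p q R U2 V2" and pq: "p > 0" "q > 0" "p * q \<noteq> 1"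
    and r: "0 \<le> r" "r \<le> R"
  shows "U1 r = U2 r \<and> V1 r = V2 r"
proof -
  define a where "a = 2 * (q + 1) / (p * q - 1)"
  have a: "a \<noteq> 0" using pq by (simp add: a_def)
  have pos: "U1 0 > 0" "U2 0 > 0" "R > 0" using s1 s2 by (auto simp: ball_sol_def)
  define l where "l = (U1 0 / U2 0) powr (1 / a)"
  have l: "l > 0" using pos by (simp add: l_def)
  have "l powr a = U1 0 / U2 0" using pos a by (simp add: l_def powr_powr)
  then have i: "U1 0 = l powr a * U2 (l * 0)" using pos by simp
  note s3 = ball_sol_rescale[OF s2 pq l, folded a_def]
  have "R = R / l" by (rule ball_sol_unique(1)[OF s1 s3 pq(1,2) i])
  then have "l = 1" using l pos by (simp add: field_simps)
  then show ?thesis using ball_sol_unique(2)[OF s1 s3 pq(1,2) i r] by simp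
qed

theorem corollary1p4:
  fixes c :: "'a::euclidean_space" and R p q :: real
  assumes "R > 0" and "p > 0" and "q > 0"
  shows
    "(\<forall>u v. lane_emden_solution (ball c R) p q u v \<longrightarrow>
        radial_strictly_decreasing c R u \<and> radial_strictly_decreasing c R v) \<and>
     (real DIM('a) / (p + 1) + real DIM('a) / (q + 1) > real DIM('a) - 2 \<and> p * q \<noteq> 1 \<longrightarrow>
        (\<exists>u v. lane_emden_solution (ball c R) p q u v \<and>
          (\<forall>u' v'. lane_emden_solution (ball c R) p q u' v' \<longrightarrow>
            (\<forall>x\<in>cball c R. u' x = u x \<and> v' x = v x))))"
proof (intro conjI allI impI)
  fix u v assume s: "lane_emden_solution (ball c R) p q u v"
  show "radial_strictly_decreasing c R u"
    by (rule lane_emden_radial_strictly_decreasing[OF s assms])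
  show "radial_strictly_decreasing c R v"
    by (rule lane_emden_radial_strictly_decreasing[OF lane_emden_swap[OF s] assms(1,3,2)])
next
  assume *: "real DIM('a) / (p + 1) + real DIM('a) / (q + 1) > real DIM('a) - 2 \<and> p * q \<noteq> 1"
  obtain d where d: "DIM('a) = Suc d" using DIM_positive[where 'a = 'a] by (metis gr0_implies_Suc)
  obtain i :: 'a where i: "i \<in> Basis" using nonempty_Basis by blast
  have n: "norm i = 1" using i by simp
  interpret shooting d p q using assms by unfold_locales
  obtain R1 U1 V1 where s1: "ball_sol d p q R1 U1 V1"
    using dirichlet_solution * unfolding ball_sol_def d by (auto simp: add.commute)
  \<comment> \<open>Dilation by \<open>l\<close> carries the radius produced by shooting to the
    prescribed \<open>R\<close>.\<close>
  define l where "l = R1 / R"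
  have l: "l > 0" "R1 / l = R" using s1 assms by (auto simp: l_def ball_sol_def)
  obtain U V where s: "ball_sol d p q R U V"
    using ball_sol_rescale[OF s1 assms(2,3) _ l(1)] * l(2) by auto
  show "\<exists>u v. lane_emden_solution (ball c R) p q u v \<and>
      (\<forall>u' v'. lane_emden_solution (ball c R) p q u' v' \<longrightarrow> (\<forall>x\<in>cball c R. u' x = u x \<and> v' x = v x))"
  proof (intro exI conjI allI impI ballI)
    show "lane_emden_solution (ball c R) p q (\<lambda>x. U (norm (x - c))) (\<lambda>x. V (norm (x - c)))"
      by (rule ball_sol_lane_emden[OF s d assms(2,3)])
    fix u' v' x assume s': "lane_emden_solution (ball c R) p q u' v'" and x: "x \<in> cball c R"
    have nx: "norm (x - c) \<le> R" using x by (simp add: dist_norm norm_minus_commute)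
    \<comment> \<open>Symmetry reduces an arbitrary solution to its values on the ray in direction
      \<open>i\<close>, where uniqueness of the profile applies.\<close>
    have "u' x = u' (c + norm (x - c) *\<^sub>R i)" "v' x = v' (c + norm (x - c) *\<^sub>R i)"
      using lane_emden_radial[OF s' assms, of "x - c" "norm (x - c) *\<^sub>R i"]
        lane_emden_radial[OF lane_emden_swap[OF s'] assms(1,3,2), of "x - c" "norm (x - c) *\<^sub>R i"] nx n by simp_all
    then show "u' x = U (norm (x - c))" "v' x = V (norm (x - c))"
      using ball_sol_unique_radius[OF lane_emden_ball_sol[OF s' assms d i] s assms(2,3) _ norm_ge_zero nx] * by auto
  qed
qed

end
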